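(* For every polynomial knot $K$, there exists a knotted plane that contains a knotted disc bounded by $K\sharp K^*$.
   Context: A polynomial knot is a knot represented by a polynomial embedding $\mathbb{R}\to\mathbb{R}^3$, $t\mapsto(f(t),g(t),h(t))$ (a long knot); $K^*$ is the mirror image of $K$ and $K\sharp K^*$ denotes the connected sum. A knotted plane is a long $2$-knot: a proper, locally flat (smooth) embedding of $\mathbb{R}^2$ into $\mathbb{R}^4$ that is standard outside a compact region. A knotted disc bounded by a classical knot $J$ is a proper, locally flat embedding of the $2$-disc in a half-space of $\mathbb{R}^4$ bounded by a copy of $\mathbb{R}^3$ (e.g. $\{(x_1,x_2,x_3,x_4): x_3\ge 0\}$), whose boundary circle lies in the bounding $\mathbb{R}^3$ and is the knot $J$ there. "Knotted" here does not require non-triviality. *)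

theory Defs
  imports "HOL-Analysis.Analysis" "HOL-Computational_Algebra.Polynomial"
begin

text \<open>On Euclidean spaces this is \<open>C\<^sup>n\<close> for all \<open>n\<close>: every iterated directional derivative exists,
  and is itself (Frechet) differentiable.\<close>

primrec Ck :: "nat \<Rightarrow> ('a::euclidean_space \<Rightarrow> 'b::euclidean_space) \<Rightarrow> bool" where
  "Ck 0 f \<longleftrightarrow> continuous_on UNIV f"
| "Ck (Suc n) f \<longleftrightarrow> (\<forall>x. f differentiable (at x)) \<and>
                   (\<forall>v. Ck n (\<lambda>x. frechet_derivative f (at x) v))"

definition smooth :: "('a::euclidean_space \<Rightarrow> 'b::euclidean_space) \<Rightarrow> bool" where
  "smooth f \<longleftrightarrow> (\<forall>n. Ck n f)"

definition proper_smooth_embedding :: "('a::euclidean_space \<Rightarrow> 'b::euclidean_space) \<Rightarrow> bool" where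
  "proper_smooth_embedding f \<longleftrightarrow>
     smooth f \<and> (\<forall>x. inj (frechet_derivative f (at x))) \<and> inj f \<and>
     proper_map euclidean euclidean f"

text \<open>Long knots are oriented by their parameter.\<close>

definition polynomial_knot :: "(real \<Rightarrow> real^3) \<Rightarrow> bool" where
  "polynomial_knot \<kappa> \<longleftrightarrow>
     (\<exists>f g h. \<kappa> = (\<lambda>t. vector [poly f t, poly g t, poly h t])) \<and> proper_smooth_embedding \<kappa>"

definition standard_long_knot :: "(real \<Rightarrow> real^3) \<Rightarrow> bool" where
  "standard_long_knot k \<longleftrightarrow>
     proper_smooth_embedding k \<and>
     (\<forall>t. \<bar>t\<bar> \<ge> 1 \<longrightarrow> k t = vector [t, 0, 0]) \<and>
     (\<forall>t. \<bar>t\<bar> \<le> 1 \<longrightarrow> k t \<in> cball 0 1)"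

text \<open>An ambient isotopy of \<open>\<real>\<^sup>3\<close> extends, fixing the point at
  infinity, to the 3-sphere.\<close>

definition ambient_isotopy_end :: "(real^3 \<Rightarrow> real^3) \<Rightarrow> bool" where
  "ambient_isotopy_end \<Phi> \<longleftrightarrow>
     homotopic_with_canon (\<lambda>h. \<exists>h'. homeomorphism UNIV UNIV h h') UNIV UNIV id \<Phi>"

definition equivalent_long_knots :: "(real \<Rightarrow> real^3) \<Rightarrow> (real \<Rightarrow> real^3) \<Rightarrow> bool" where
  "equivalent_long_knots \<kappa> k \<longleftrightarrow>
     (\<exists>\<Phi> \<sigma>. ambient_isotopy_end \<Phi> \<and> strict_mono \<sigma> \<and> surj (\<sigma> :: real \<Rightarrow> real) \<and>
            \<Phi> \<circ> \<kappa> = k \<circ> \<sigma>)"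

definition equivalent_knots :: "(real^3) set \<Rightarrow> (real^3) set \<Rightarrow> bool" where
  "equivalent_knots J J' \<longleftrightarrow> (\<exists>\<Phi>. ambient_isotopy_end \<Phi> \<and> \<Phi> ` J = J')"

text \<open>The mirror image in the plane orthogonal to the first axis. The parameter is reversed, so that
  the mirror image of a standard long knot is again a standard long knot. Hence \<open>K\<^sup>*\<close> carries
  the orientation for which it is the inverse of \<open>K\<close> in the concordance group. (The orientation matters
  if \<open>K\<close> is not invertible: for the knot \<open>8\<^sub>1\<^sub>7\<close>, the sum with the mirror image whose orientation is not
  reversed is not slice, by Kirk and Livingston.)\<close>

definition mirror :: "(real \<Rightarrow> real^3) \<Rightarrow> (real \<Rightarrow> real^3)" where
  "mirror \<kappa> = (\<lambda>t. vector [- (\<kappa> (- t) $ 1), \<kappa> (- t) $ 2, \<kappa> (- t) $ 3])"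

text \<open>For standard long knots, the knotted parts are moved into the unit balls around \<open>(-1, 0, 0)\<close>
  and \<open>(1, 0, 0)\<close>. The result is a long knot that is standard outside the ball of radius 2.\<close>

definition concat_long :: "(real \<Rightarrow> real^3) \<Rightarrow> (real \<Rightarrow> real^3) \<Rightarrow> (real \<Rightarrow> real^3)" where
  "concat_long k1 k2 =
     (\<lambda>t. if t \<le> 0 then k1 (t + 1) - vector [1, 0, 0] else k2 (t - 1) + vector [1, 0, 0])"

text \<open>The closed knot given by a long knot that is standard outside the ball of radius \<open>r\<close>:
  the two ends are replaced by a semicircle on the boundary of that ball.\<close>

definition knot_closure :: "real \<Rightarrow> (real \<Rightarrow> real^3) \<Rightarrow> (real^3) set" where
  "knot_closure r k = k ` {-r..r} \<union> {x. norm x = r \<and> x $ 2 \<ge> 0 \<and> x $ 3 = 0}"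

definition is_connected_sum :: "(real^3) set \<Rightarrow> (real \<Rightarrow> real^3) \<Rightarrow> (real \<Rightarrow> real^3) \<Rightarrow> bool" where
  "is_connected_sum J \<kappa>1 \<kappa>2 \<longleftrightarrow>
     (\<exists>k1 k2. standard_long_knot k1 \<and> equivalent_long_knots \<kappa>1 k1 \<and>
              standard_long_knot k2 \<and> equivalent_long_knots \<kappa>2 k2 \<and>
              equivalent_knots J (knot_closure 2 (concat_long k1 k2)))"

definition knotted_plane :: "(real^4) set \<Rightarrow> bool" where
  "knotted_plane P \<longleftrightarrow>
     (\<exists>F :: real^2 \<Rightarrow> real^4. proper_smooth_embedding F \<and> range F = P \<and>
        (\<exists>R. \<forall>u. norm u \<ge> R \<longrightarrow> F u = vector [u $ 1, u $ 2, 0, 0]))"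

definition half_space4 :: "(real^4) set" where
  "half_space4 = {x. x $ 3 \<ge> 0}"

definition bounding_R3 :: "real^3 \<Rightarrow> real^4" where
  "bounding_R3 x = vector [x $ 1, x $ 2, 0, x $ 3]"

text \<open>Local flatness of a surface with boundary in the half-space: locally, the pair is
  homeomorphic to an open piece of the pair (half-space, half-plane). Homeomorphisms between relatively open
  subsets of the half-space preserve its boundary, so this covers both the interior points
  and the boundary points of a properly embedded surface.\<close>

definition locally_flat_in_half_space :: "(real^4) set \<Rightarrow> bool" where
  "locally_flat_in_half_space D \<longleftrightarrow>
     (\<forall>p\<in>D. \<exists>U V \<phi> \<psi>.
        openin (top_of_set half_space4) U \<and> p \<in> U \<and> openin (top_of_set half_space4) V \<and>
        homeomorphism U V \<phi> \<psi> \<and> \<phi> ` (U \<inter> D) = V \<inter> {x. x $ 1 = 0 \<and> x $ 2 = 0})"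

definition knotted_disc_bounded_by :: "(real^4) set \<Rightarrow> (real^3) set \<Rightarrow> bool" where
  "knotted_disc_bounded_by D J \<longleftrightarrow>
     (\<exists>d d'. homeomorphism (cball (0 :: real^2) 1) D d d' \<and>
             d ` sphere 0 1 = bounding_R3 ` J \<and>
             d ` ball 0 1 \<subseteq> {x. x $ 3 > 0}) \<and>
     locally_flat_in_half_space D"

end

theory Submission
  imports Defs
begin

text \<open>
  The disc is swept out by half a turn of a spinning motion, and the plane by the full turn.

  Consider first a long knot \<open>\<kappa>\<close> that follows the first axis outside a small ball. Shift this
  ball to \<open>(1, 0, 0)\<close>, keep only the part of the curve from the origin onwards, and rotate it in \<open>\<real>\<^sup>4\<close>, where
  \<open>\<real>\<^sup>3\<close> is the hyperplane \<open>x3 = 0\<close>, about the fixed plane \<open>x1 = x3 = 0\<close>. Artin's spinning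
  construction yields a plane: since the ball does not meet the fixed plane, the surface
  is embedded, and it is flat except in an annulus around the unit circle. The rotation by \<open>\<pi>\<close> acts
  on the hyperplane \<open>x3 = 0\<close> as a reflection. Hence the rotations by angles in \<open>[0, \<pi>]\<close> sweep out a
  surface in the half-space \<open>x3 \<ge> 0\<close> that meets the boundary in a long knot, namely the
  concatenation of the reversed mirror image of \<open>\<kappa>\<close> with \<open>\<kappa>\<close>. To obtain \<open>K\<close> as the first summand, the curve
  that is spun is the mirror image of \<open>K\<close>.

  The spun plane is vertical, that is, it contains the directions of \<open>x1\<close> and \<open>x3\<close>, whereas a knotted plane has
  to be horizontal at infinity; and the swept surface is a half-plane instead of a disc. One modification away from the
  knot repairs both: over the point \<open>(p, q)\<close>, replace the height \<open>x3 = q\<close> by \<open>q * bend (p\<^sup>2 + q\<^sup>2)\<close> and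
  add the difference to \<open>x2\<close>. The factor \<open>bend\<close> is \<open>1\<close> near the knot, changes sign on the circle of radius 2,
  and vanishes at infinity. Now the half-disc of radius 2 is mapped onto a disc in \<open>x3 \<ge> 0\<close>. Its
  boundary is the long knot closed up by a semicircle, exactly as in \<^const>\<open>knot_closure\<close>, which is
  \<open>spun_plane_boundary\<close>. The sum of the second and the third coordinate remains \<open>q\<close>, so
  the bent plane is still embedded (\<open>knotted_plane_range\<close>). Local flatness
  (\<open>locally_flat_disc\<close>) follows from explicit charts, and only the two corners at
  \<open>(\<plusminus>2, 0)\<close> need a chart that is not smooth.

  It remains to make a polynomial knot follow an axis at both ends (\<open>polynomial_knot_tame\<close>). After a shear by a high
  even power of another coordinate, the second coordinate \<open>l\<close> tends to infinity at both ends. Then every high level of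
  that coordinate meets the curve in one point of each end. As complex affine maps act simply
  transitively on pairs of distinct points, there is exactly one such map of the level that
  moves the two points to their parameters, taken as real numbers. The ends thus become those
  of the graph of \<open>l\<close>, and the shear by \<open>l\<close> straightens them. All these maps are isotopic to the identity.
\<close>

section \<open>Smooth maps on open sets\<close>

text \<open>Cut-offs and inverse branches are glued from pieces that are only defined locally, so
  \<^const>\<open>Ck\<close> is relativised to open sets.\<close>

primrec Ck_on :: "nat \<Rightarrow> 'a set \<Rightarrow> ('a::euclidean_space \<Rightarrow> 'b::euclidean_space) \<Rightarrow> bool" where
  "Ck_on 0 S f \<longleftrightarrow> continuous_on S f"
| "Ck_on (Suc n) S f \<longleftrightarrow> (\<forall>x\<in>S. f differentiable (at x)) \<and>
                   (\<forall>v. Ck_on n S (\<lambda>x. frechet_derivative f (at x) v))"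

definition smooth_on :: "'a set \<Rightarrow> ('a::euclidean_space \<Rightarrow> 'b::euclidean_space) \<Rightarrow> bool" where
  "smooth_on S f \<longleftrightarrow> (\<forall>n. Ck_on n S f)"

lemma Ck_on_UNIV: "Ck_on n UNIV f = Ck n f"
  by (induction n arbitrary: f) auto

lemma smooth_on_UNIV: "smooth_on UNIV f = smooth f"
  by (simp add: smooth_on_def smooth_def Ck_on_UNIV)

lemma frechet_derivative_eq_on_open:
  assumes "open S" "x \<in> S" "\<And>y. y \<in> S \<Longrightarrow> f y = g y" "f differentiable (at x)"
  shows "g differentiable (at x)" "frechet_derivative f (at x) = frechet_derivative g (at x)"
proof -
  have "(f has_derivative frechet_derivative f (at x)) (at x)"
    using assms(4) frechet_derivative_works by blast
  then have g: "(g has_derivative frechet_derivative f (at x)) (at x)"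
    using assms by (auto intro: has_derivative_transform_within_open)
  then show "g differentiable (at x)" by (auto simp: differentiable_def)
  show "frechet_derivative f (at x) = frechet_derivative g (at x)"
    using frechet_derivative_at[OF g] .
qed

lemma Ck_on_cong:
  assumes "open S" "\<And>x. x \<in> S \<Longrightarrow> f x = g x" "Ck_on n S f"
  shows "Ck_on n S g"
  using assms(2,3)
proof (induction n arbitrary: f g)
  case 0
  then show ?case using continuous_on_cong by (metis Ck_on.simps(1))
next
  case (Suc n)
  have d: "\<forall>x\<in>S. f differentiable (at x)" using Suc.prems(2) by simp
  have "Ck_on n S (\<lambda>x. frechet_derivative g (at x) v)" for v
  proof (rule Suc.IH)
    show "frechet_derivative f (at x) v = frechet_derivative g (at x) v" if "x \<in> S" for x
      using frechet_derivative_eq_on_open(2)[OF assms(1) that Suc.prems(1)] d that by simp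
    show "Ck_on n S (\<lambda>x. frechet_derivative f (at x) v)" using Suc.prems(2) by simp
  qed
  moreover have "\<forall>x\<in>S. g differentiable (at x)"
    using frechet_derivative_eq_on_open(1)[where f = f and g = g, OF assms(1)] Suc.prems(1) d by blast
  ultimately show ?case by simp
qed

lemma Ck_on_SucI:
  assumes "open S" "\<And>x. x \<in> S \<Longrightarrow> (f has_derivative f' x) (at x)"
    "\<And>v. Ck_on n S (\<lambda>x. f' x v)"
  shows "Ck_on (Suc n) S f"
proof -
  have eq: "f' x = frechet_derivative f (at x)" if "x \<in> S" for x
    using frechet_derivative_at assms(2) that by blast
  have "Ck_on n S (\<lambda>x. frechet_derivative f (at x) v)" for v
    by (rule Ck_on_cong[OF assms(1) _ assms(3)]) (simp add: eq)
  then show ?thesis using assms(2) by (auto simp: differentiable_def)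
qed

lemma Ck_on_SucD:
  assumes "Ck_on (Suc n) S f"
  shows "\<And>x. x \<in> S \<Longrightarrow> (f has_derivative frechet_derivative f (at x)) (at x)"
    "\<And>v. Ck_on n S (\<lambda>x. frechet_derivative f (at x) v)"
  using assms frechet_derivative_works by auto

lemma Ck_on_Suc_imp: "Ck_on (Suc n) S f \<Longrightarrow> Ck_on n S f"
proof (induction n arbitrary: f)
  case 0
  then show ?case
    by (auto intro!: continuous_at_imp_continuous_on differentiable_imp_continuous_within)
next
  case (Suc n)
  have "Ck_on n S (\<lambda>x. frechet_derivative f (at x) v)" for v
    using Suc.IH[of "\<lambda>x. frechet_derivative f (at x) v"] Suc.prems by simp
  then show ?case using Suc.prems by simp
qed

lemma Ck_on_subset: "Ck_on n S f \<Longrightarrow> T \<subseteq> S \<Longrightarrow> Ck_on n T f"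
  by (induction n arbitrary: f) (auto intro: continuous_on_subset)

lemma Ck_on_Un: "open S \<Longrightarrow> open T \<Longrightarrow> Ck_on n S f \<Longrightarrow> Ck_on n T f \<Longrightarrow> Ck_on n (S \<union> T) f"
  by (induction n arbitrary: f) (auto intro: continuous_on_open_Un)

lemma Ck_on_const: "Ck_on n S (\<lambda>x. c)"
  by (induction n arbitrary: c) (auto simp: frechet_derivative_const)

lemma Ck_on_bounded_linear:
  assumes "bounded_linear f" "open S"
  shows "Ck_on n S f"
proof (cases n)
  case 0
  then show ?thesis using assms by (simp add: linear_continuous_on)
next
  case (Suc m)
  show ?thesis unfolding Suc
    by (rule Ck_on_SucI[OF assms(2), of _ "\<lambda>x. f"])
       (auto intro: bounded_linear_imp_has_derivative assms Ck_on_const)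
qed

lemma Ck_on_add:
  assumes "open S" "Ck_on n S f" "Ck_on n S g"
  shows "Ck_on n S (\<lambda>x. f x + g x)"
  using assms(2,3)
proof (induction n arbitrary: f g)
  case 0
  then show ?case by (auto intro: continuous_on_add)
next
  case (Suc n)
  show ?case
    by (rule Ck_on_SucI[OF assms(1)], rule has_derivative_add)
       (use Ck_on_SucD[OF Suc.prems(1)] Ck_on_SucD[OF Suc.prems(2)] Suc.IH in auto)
qed

lemma Ck_on_scaleR:
  fixes f :: "'a::euclidean_space \<Rightarrow> real" and g :: "'a \<Rightarrow> 'b::euclidean_space"
  assumes "open S" "Ck_on n S f" "Ck_on n S g"
  shows "Ck_on n S (\<lambda>x. f x *\<^sub>R g x)"
  using assms(2,3)
proof (induction n arbitrary: f g)
  case 0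
  then show ?case by (auto intro: continuous_on_scaleR)
next
  case (Suc n)
  show ?case
    by (rule Ck_on_SucI[OF assms(1)], rule has_derivative_scaleR)
       (use Ck_on_SucD[OF Suc.prems(1)] Ck_on_SucD[OF Suc.prems(2)] Suc.IH
          Suc.prems[THEN Ck_on_Suc_imp] in \<open>auto intro: Ck_on_add assms(1)\<close>)
qed

lemma Ck_on_sum:
  assumes "open S" "\<And>i. i \<in> I \<Longrightarrow> Ck_on n S (f i)"
  shows "Ck_on n S (\<lambda>x. \<Sum>i\<in>I. f i x)"
  using assms(2) by (induction I rule: infinite_finite_induct) (auto intro: Ck_on_const Ck_on_add assms(1))

lemma Ck_on_linear_image:
  fixes L :: "'b::euclidean_space \<Rightarrow> 'c::euclidean_space"
  assumes "bounded_linear L" "open S" "Ck_on n S f"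
  shows "Ck_on n S (\<lambda>x. L (f x))"
  using assms(3)
proof (induction n arbitrary: f)
  case 0
  then show ?case using assms(1) by (auto intro: bounded_linear.continuous_on)
next
  case (Suc n)
  show ?case
    by (rule Ck_on_SucI[OF assms(2)], rule bounded_linear.has_derivative[OF assms(1)])
       (use Ck_on_SucD[OF Suc.prems] Suc.IH in auto)
qed

text \<open>The chain rule expresses the derivative of a composition through compositions and products
  of maps that are smooth of one order less, which drives the induction.\<close>

lemma Ck_on_compose:
  fixes f :: "'b::euclidean_space \<Rightarrow> 'c::euclidean_space" and g :: "'a::euclidean_space \<Rightarrow> 'b"
  assumes "open S" "open T" "g ` S \<subseteq> T" "Ck_on n T f" "Ck_on n S g"
  shows "Ck_on n S (\<lambda>x. f (g x))"
  using assms(4,5)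
proof (induction n arbitrary: f)
  case 0
  then show ?case using assms(3) by (auto intro: continuous_on_compose2)
next
  case (Suc n)
  note f = Ck_on_SucD[OF Suc.prems(1)] and g = Ck_on_SucD[OF Suc.prems(2)]
  let ?D = "\<lambda>x. frechet_derivative f (at (g x))"
  have lin: "?D x (v :: 'b) = (\<Sum>b\<in>Basis. (v \<bullet> b) *\<^sub>R ?D x b)" if "x \<in> S" for x v
  proof -
    have "linear (?D x)" using f(1)[of "g x"] assms(3) that
      by (meson has_derivative_linear image_subset_iff)
    then have "?D x (\<Sum>b\<in>Basis. (v \<bullet> b) *\<^sub>R b) = (\<Sum>b\<in>Basis. (v \<bullet> b) *\<^sub>R ?D x b)"
      by (simp add: linear_sum linear_scale)
    then show ?thesis by (simp add: euclidean_representation)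
  qed
  show ?case
  proof (rule Ck_on_SucI[OF assms(1)])
    fix x assume x: "x \<in> S"
    have "(f \<circ> g has_derivative ?D x \<circ> frechet_derivative g (at x)) (at x)"
      using f(1) g(1) x assms(3) by (intro diff_chain_at) auto
    then show "((\<lambda>x. f (g x)) has_derivative
        (\<lambda>v. \<Sum>b\<in>Basis. (frechet_derivative g (at x) v \<bullet> b) *\<^sub>R ?D x b)) (at x)"
      unfolding comp_def by (subst (asm) lin[OF x])
  next
    fix v
    show "Ck_on n S (\<lambda>x. \<Sum>b\<in>Basis. (frechet_derivative g (at x) v \<bullet> b) *\<^sub>R ?D x b)"
      by (intro Ck_on_sum Ck_on_scaleR assms(1) Suc.IH f(2) Ck_on_Suc_imp[OF Suc.prems(2)]
          Ck_on_linear_image[OF bounded_linear_inner_left] g(2))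
  qed
qed

named_theorems smooth_intros

lemma smooth_on_cong:
  "smooth_on S f \<Longrightarrow> open S \<Longrightarrow> (\<And>x. x \<in> S \<Longrightarrow> f x = g x) \<Longrightarrow> smooth_on S g"
  unfolding smooth_on_def using Ck_on_cong by blast

lemma smooth_on_Un:
  "open S \<Longrightarrow> open T \<Longrightarrow> smooth_on S f \<Longrightarrow> smooth_on T f \<Longrightarrow> smooth_on (S \<union> T) f"
  unfolding smooth_on_def using Ck_on_Un by blast

lemma smooth_on_subset: "smooth_on S f \<Longrightarrow> T \<subseteq> S \<Longrightarrow> smooth_on T f"
  unfolding smooth_on_def using Ck_on_subset by blast

lemma smooth_on_const [smooth_intros]: "smooth_on S (\<lambda>x. c)"
  unfolding smooth_on_def using Ck_on_const by blast

lemma smooth_on_linear: "bounded_linear f \<Longrightarrow> open S \<Longrightarrow> smooth_on S f"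
  unfolding smooth_on_def using Ck_on_bounded_linear by blast

lemma smooth_on_id [smooth_intros]: "open S \<Longrightarrow> smooth_on S (\<lambda>x. x)"
  by (rule smooth_on_linear[OF bounded_linear_ident])

lemma smooth_on_linear_image:
  "bounded_linear L \<Longrightarrow> open S \<Longrightarrow> smooth_on S f \<Longrightarrow> smooth_on S (\<lambda>x. L (f x))"
  unfolding smooth_on_def using Ck_on_linear_image by blast

lemma smooth_on_add [smooth_intros]:
  "open S \<Longrightarrow> smooth_on S f \<Longrightarrow> smooth_on S g \<Longrightarrow> smooth_on S (\<lambda>x. f x + g x)"
  unfolding smooth_on_def using Ck_on_add by blast

lemma smooth_on_minus [smooth_intros]:
  "open S \<Longrightarrow> smooth_on S f \<Longrightarrow> smooth_on S (\<lambda>x. - f x)"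
  by (rule smooth_on_linear_image[OF bounded_linear_minus[OF bounded_linear_ident]])

lemma smooth_on_diff [smooth_intros]:
  "open S \<Longrightarrow> smooth_on S f \<Longrightarrow> smooth_on S g \<Longrightarrow> smooth_on S (\<lambda>x. f x - g x)"
  using smooth_on_add[of S f "\<lambda>x. - g x"] smooth_on_minus[of S g] by simp

lemma smooth_on_scaleR [smooth_intros]:
  fixes f :: "'a::euclidean_space \<Rightarrow> real" and g :: "'a \<Rightarrow> 'b::euclidean_space"
  shows "open S \<Longrightarrow> smooth_on S f \<Longrightarrow> smooth_on S g \<Longrightarrow> smooth_on S (\<lambda>x. f x *\<^sub>R g x)"
  unfolding smooth_on_def using Ck_on_scaleR by blast

lemma smooth_on_mult [smooth_intros]:
  fixes f g :: "'a::euclidean_space \<Rightarrow> real"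
  shows "open S \<Longrightarrow> smooth_on S f \<Longrightarrow> smooth_on S g \<Longrightarrow> smooth_on S (\<lambda>x. f x * g x)"
  using smooth_on_scaleR[of S f g] by simp

lemma smooth_on_sum [smooth_intros]:
  "open S \<Longrightarrow> (\<And>i. i \<in> I \<Longrightarrow> smooth_on S (f i)) \<Longrightarrow> smooth_on S (\<lambda>x. \<Sum>i\<in>I. f i x)"
  by (simp add: smooth_on_def Ck_on_sum)

lemma smooth_on_power [smooth_intros]:
  fixes f :: "'a::euclidean_space \<Rightarrow> real"
  shows "open S \<Longrightarrow> smooth_on S f \<Longrightarrow> smooth_on S (\<lambda>x. f x ^ n)"
  by (induction n) (auto intro: smooth_intros)

lemma smooth_on_compose:
  "smooth_on T f \<Longrightarrow> smooth_on S g \<Longrightarrow> open S \<Longrightarrow> open T \<Longrightarrow> g ` S \<subseteq> T \<Longrightarrow>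
    smooth_on S (\<lambda>x. f (g x))"
  unfolding smooth_on_def using Ck_on_compose by blast

lemma smooth_on_compose_UNIV:
  "smooth_on UNIV f \<Longrightarrow> smooth_on S g \<Longrightarrow> open S \<Longrightarrow> smooth_on S (\<lambda>x. f (g x))"
  by (rule smooth_on_compose[of UNIV]) auto

lemma smooth_on_vec_nth [smooth_intros]:
  fixes f :: "'a::euclidean_space \<Rightarrow> real^'n"
  shows "open S \<Longrightarrow> smooth_on S f \<Longrightarrow> smooth_on S (\<lambda>x. f x $ i)"
  by (rule smooth_on_linear_image[OF bounded_linear_vec_nth])

lemma smooth_on_vec:
  fixes f :: "'a::euclidean_space \<Rightarrow> real^'n"
  assumes "open S" "\<And>i. smooth_on S (\<lambda>x. f x $ i)"
  shows "smooth_on S f"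
proof -
  have "smooth_on S (\<lambda>x. \<Sum>i\<in>UNIV. (f x $ i) *\<^sub>R (axis i 1 :: real^'n))"
    by (intro smooth_intros assms)
  moreover have "(\<Sum>i\<in>UNIV. (f x $ i) *\<^sub>R (axis i 1 :: real^'n)) = f x" for x
    by (simp add: vec_eq_iff axis_def if_distrib cong: if_cong)
  ultimately show ?thesis by (simp only:)
qed

lemma smooth_on_continuous: "smooth_on S f \<Longrightarrow> continuous_on S f"
  unfolding smooth_on_def using Ck_on.simps(1) by blast

lemma smooth_on_differentiable: "smooth_on S f \<Longrightarrow> x \<in> S \<Longrightarrow> f differentiable (at x)"
  unfolding smooth_on_def using Ck_on.simps(2) by blast

subsection \<open>Functions of one real variable\<close>

lemma Ck_on_Suc_real:
  fixes f :: "real \<Rightarrow> real"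
  assumes "open S" "\<And>x. x \<in> S \<Longrightarrow> (f has_real_derivative f' x) (at x)" "Ck_on n S f'"
  shows "Ck_on (Suc n) S f"
proof (rule Ck_on_SucI[OF assms(1)])
  show "(f has_derivative (\<lambda>v. f' x * v)) (at x)" if "x \<in> S" for x
    using assms(2)[OF that] by (simp add: has_field_derivative_def)
  show "Ck_on n S (\<lambda>x. f' x * v)" for v
    using Ck_on_scaleR[OF assms(1,3) Ck_on_const, of v] by simp
qed

lemma smooth_on_poly [smooth_intros]:
  fixes f :: "'a::euclidean_space \<Rightarrow> real"
  shows "open S \<Longrightarrow> smooth_on S f \<Longrightarrow> smooth_on S (\<lambda>x. poly p (f x))"
  by (induction p) (auto intro: smooth_intros)

lemma smooth_on_inverse_real: "smooth_on {x::real. x \<noteq> 0} inverse"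
proof -
  have o: "open {x::real. x \<noteq> 0}" by (intro open_Collect_neq) auto
  have "Ck_on n {x::real. x \<noteq> 0} inverse" for n
  proof (induction n)
    case 0
    then show ?case by (auto intro!: continuous_intros)
  next
    case (Suc n)
    show ?case
    proof (rule Ck_on_Suc_real[OF o])
      show "(inverse has_real_derivative - (inverse x * inverse x)) (at x)" if "x \<in> {x. x \<noteq> 0}" for x :: real
        using that by (auto intro!: derivative_eq_intros simp: field_simps)
      have "Ck_on n {x::real. x \<noteq> 0} (\<lambda>x. (-1) *\<^sub>R (inverse x *\<^sub>R inverse x))"
        by (intro Ck_on_scaleR Ck_on_const o Suc)
      then show "Ck_on n {x::real. x \<noteq> 0} (\<lambda>x. - (inverse x * inverse x))" by simp
    qed
  qed
  then show ?thesis by (simp add: smooth_on_def)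
qed

lemma smooth_on_divide [smooth_intros]:
  fixes f g :: "'a::euclidean_space \<Rightarrow> real"
  assumes "open S" "smooth_on S f" "smooth_on S g" "\<And>x. x \<in> S \<Longrightarrow> g x \<noteq> 0"
  shows "smooth_on S (\<lambda>x. f x / g x)"
proof -
  have "open {x::real. x \<noteq> 0}" by (intro open_Collect_neq) auto
  then have "smooth_on S (\<lambda>x. inverse (g x))"
    using assms by (intro smooth_on_compose[OF smooth_on_inverse_real]) auto
  then show ?thesis using assms by (auto simp: divide_inverse intro!: smooth_intros)
qed

text \<open>Since \<open>\<tau>' = 1 / (f' \<circ> \<tau>)\<close>, each derivative of \<open>\<tau>\<close> is as smooth as \<open>\<tau>\<close> itself.\<close>

lemma smooth_on_inverse_function:
  fixes f f' \<tau> :: "real \<Rightarrow> real"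
  assumes S: "open S" "continuous_on S \<tau>"
    and inv: "\<And>x. x \<in> S \<Longrightarrow> f (\<tau> x) = x"
    and der: "\<And>t. t \<in> \<tau> ` S \<Longrightarrow> (f has_real_derivative f' t) (at t)"
    and nz: "\<And>t. t \<in> \<tau> ` S \<Longrightarrow> f' t \<noteq> 0"
    and T: "open T" "\<tau> ` S \<subseteq> T" and f': "smooth_on T f'"
  shows "smooth_on S \<tau>"
proof -
  have d: "(\<tau> has_real_derivative inverse (f' (\<tau> x))) (at x)" if x: "x \<in> S" for x
  proof -
    obtain e where e: "e > 0" "ball x e \<subseteq> S" using S(1) x openE by blast
    have i: "f (\<tau> y) = y" if "x - e < y" "y < x + e" for y
      using that e(2) inv[of y] by (auto simp: subset_iff dist_real_def)
    have "isCont \<tau> x" using S x continuous_on_eq_continuous_at by blast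
    then show ?thesis
      by (intro DERIV_inverse_function[where f = f and a = "x - e" and b = "x + e"])
         (use der nz x i e(1) in auto)
  qed
  have o: "open {x::real. x \<noteq> 0}" by (intro open_Collect_neq) auto
  have "Ck_on n S \<tau>" for n
  proof (induction n)
    case 0
    then show ?case using S by simp
  next
    case (Suc n)
    have 1: "Ck_on n S (\<lambda>x. f' (\<tau> x))"
      using f' Ck_on_compose[OF S(1) T(1) T(2) _ Suc] unfolding smooth_on_def by blast
    have "Ck_on n S (\<lambda>x. inverse (f' (\<tau> x)))"
    proof (rule Ck_on_compose[OF S(1) o _ _ 1])
      show "(\<lambda>x. f' (\<tau> x)) ` S \<subseteq> {x. x \<noteq> 0}"
        using nz[OF imageI] by (simp add: image_subset_iff)
      show "Ck_on n {x::real. x \<noteq> 0} inverse"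
        using smooth_on_inverse_real by (simp add: smooth_on_def)
    qed
    from d this show ?case by (rule Ck_on_Suc_real[OF S(1)])
  qed
  then show ?thesis by (simp add: smooth_on_def)
qed

lemma smooth_on_sqrt: "smooth_on {0<..} sqrt"
proof (rule smooth_on_inverse_function[where f = "\<lambda>x. x^2" and f' = "\<lambda>x. 2 * x" and T = UNIV])
  show "((\<lambda>x. x\<^sup>2) has_real_derivative 2 * t) (at t)" for t :: real
    by (auto intro!: derivative_eq_intros)
  show "smooth_on UNIV (\<lambda>x::real. 2 * x)"
    by (intro smooth_intros open_UNIV)
qed (auto intro!: continuous_intros)

text \<open>The functions \<open>P(1/x) e\<^bsup>-1/x\<^esup>\<close>, extended by zero to the left half-line, are closed under
  differentiation; in particular \<open>e\<^bsup>-1/x\<^esup>\<close> is a smooth function that is flat at zero.\<close>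

definition flat_exp :: "real poly \<Rightarrow> real \<Rightarrow> real" where
  "flat_exp p x = (if x > 0 then poly p (1/x) * exp (- (1/x)) else 0)"

lemma poly_exp_tendsto_0: "((\<lambda>y::real. poly p y * exp (-y)) \<longlongrightarrow> 0) at_top"
proof -
  have "((\<lambda>y::real. \<Sum>i\<le>degree p. coeff p i * (y ^ i / exp y)) \<longlongrightarrow> (\<Sum>i\<le>degree p. coeff p i * 0)) at_top"
    by (intro tendsto_sum tendsto_mult tendsto_const tendsto_power_div_exp_0)
  moreover have "(\<Sum>i\<le>degree p. coeff p i * (y ^ i / exp y)) = poly p y * exp (-y)" for y :: real
    by (simp add: poly_altdef sum_distrib_right exp_minus divide_inverse mult.assoc)
  ultimately show ?thesis by simp
qed

lemma flat_exp_tendsto_0: "(flat_exp p \<longlongrightarrow> 0) (at 0)"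
proof -
  have "((\<lambda>x. poly p (inverse x) * exp (- inverse x)) \<longlongrightarrow> 0) (at_right (0::real))"
    using filterlim_compose[OF poly_exp_tendsto_0 filterlim_inverse_at_top_right] .
  moreover have "eventually (\<lambda>x. poly p (inverse x) * exp (- inverse x) = flat_exp p x) (at_right (0::real))"
    unfolding eventually_at_right_field by (intro exI[of _ 1]) (auto simp: flat_exp_def inverse_eq_divide)
  ultimately have r: "(flat_exp p \<longlongrightarrow> 0) (at_right 0)"
    by (rule Lim_transform_eventually)
  have "eventually (\<lambda>x. flat_exp p x = 0) (at_left (0::real))"
    unfolding eventually_at_left_field by (intro exI[of _ "-1"]) (auto simp: flat_exp_def)
  then have "(flat_exp p \<longlongrightarrow> 0) (at_left 0)"
    by (rule tendsto_eventually)
  with r show ?thesis by (simp add: filterlim_split_at_real)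
qed

lemma flat_exp_deriv:
  "(flat_exp p has_real_derivative flat_exp ([:0, 0, 1:] * (p - pderiv p)) x) (at x)"
proof -
  consider "x > 0" | "x < 0" | "x = 0" by linarith
  then show ?thesis
  proof cases
    case 1
    have "((\<lambda>x. poly p (1/x) * exp (- (1/x))) has_real_derivative
       flat_exp ([:0, 0, 1:] * (p - pderiv p)) x) (at x)"
      using 1 by (auto intro!: derivative_eq_intros simp: flat_exp_def field_simps power2_eq_square)
    then show ?thesis
      by (rule has_field_derivative_transform_within_open[of _ _ _ "{0<..}"])
         (use 1 in \<open>auto simp: flat_exp_def\<close>)
  next
    case 2
    have "((\<lambda>x::real. 0) has_real_derivative flat_exp ([:0, 0, 1:] * (p - pderiv p)) x) (at x)"
      using 2 by (auto simp: flat_exp_def)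
    then show ?thesis
      by (rule has_field_derivative_transform_within_open[of _ _ _ "{..<0}"])
         (use 2 in \<open>auto simp: flat_exp_def\<close>)
  next
    case 3
    have "(\<lambda>h. (flat_exp p (0 + h) - flat_exp p 0) / h) = flat_exp ([:0, 1:] * p)"
      by (auto simp: flat_exp_def fun_eq_iff)
    moreover have "flat_exp ([:0, 0, 1:] * (p - pderiv p)) 0 = 0"
      by (simp add: flat_exp_def)
    ultimately show ?thesis
      using flat_exp_tendsto_0[of "[:0, 1:] * p"] unfolding 3 DERIV_def by (simp only:)
  qed
qed

lemma smooth_on_flat_exp: "smooth_on UNIV (flat_exp p)"
proof -
  have "Ck_on n UNIV (flat_exp p)" for n
  proof (induction n arbitrary: p)
    case 0
    show ?case
      by (simp add: continuous_at_imp_continuous_on DERIV_isCont[OF flat_exp_deriv])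
  next
    case (Suc n)
    show ?case by (rule Ck_on_Suc_real[OF open_UNIV flat_exp_deriv Suc])
  qed
  then show ?thesis by (simp add: smooth_on_def)
qed

definition smooth_step :: "real \<Rightarrow> real" where
  "smooth_step x = flat_exp 1 x / (flat_exp 1 x + flat_exp 1 (1 - x))"

lemma smooth_step_denominator: "flat_exp 1 x + flat_exp 1 (1 - x) > 0"
  by (auto simp: flat_exp_def add_pos_pos)

lemma smooth_on_step [smooth_intros]:
  fixes f :: "'a::euclidean_space \<Rightarrow> real"
  assumes "open S" "smooth_on S f"
  shows "smooth_on S (\<lambda>x. smooth_step (f x))"
proof -
  have "smooth_on UNIV smooth_step"
    unfolding smooth_step_def[abs_def] using smooth_step_denominator
    by (intro smooth_intros smooth_on_compose_UNIV[OF smooth_on_flat_exp])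
       (auto intro!: smooth_intros simp: less_le)
  then show ?thesis by (rule smooth_on_compose_UNIV) (use assms in auto)
qed

lemma smooth_step_0: "x \<le> 0 \<Longrightarrow> smooth_step x = 0"
  and smooth_step_1: "x \<ge> 1 \<Longrightarrow> smooth_step x = 1"
  and smooth_step_bounds: "0 \<le> smooth_step x" "smooth_step x \<le> 1"
  by (auto simp: smooth_step_def flat_exp_def field_simps add_pos_pos)

subsection \<open>Proper embeddings\<close>

text \<open>Used for maps that preserve the norm near infinity.\<close>

lemma proper_map_if_norm_ge:
  fixes f :: "'a::euclidean_space \<Rightarrow> 'b::euclidean_space"
  assumes c: "continuous_on UNIV f" and n: "\<And>x. norm x \<ge> R \<Longrightarrow> norm x \<le> norm (f x)"
  shows "proper_map euclidean euclidean f"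
proof -
  have "compact {x. f x \<in> K}" if K: "compact K" for K
  proof -
    obtain B where B: "\<And>y. y \<in> K \<Longrightarrow> norm y \<le> B"
      using K compact_imp_bounded bounded_iff by metis
    have "norm x \<le> max R B" if "f x \<in> K" for x
      using n[of x] B[OF that] by (cases "norm x \<ge> R") auto
    then have "bounded {x. f x \<in> K}" unfolding bounded_iff by blast
    moreover have "closed {x. f x \<in> K}"
      using continuous_closed_vimage[of K f] c compact_imp_closed[OF K]
      by (simp add: vimage_def continuous_on_eq_continuous_at)
    ultimately show ?thesis by (simp add: compact_eq_bounded_closed)
  qed
  then show ?thesis using c
    by (intro compact_imp_proper_map)
       (auto simp: locally_compact_imp_k_space Hausdorff_imp_kc_space Hausdorff_space_euclidean locally_compact_space_euclidean)
qed

section \<open>Coordinates and ambient isotopies\<close>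

lemma vector_4 [simp]:
  "(vector [a, b, c, d] :: ('a::zero)^4) $ 1 = a"
  "(vector [a, b, c, d] :: ('a::zero)^4) $ 2 = b"
  "(vector [a, b, c, d] :: ('a::zero)^4) $ 3 = c"
  "(vector [a, b, c, d] :: ('a::zero)^4) $ 4 = d"
  by (simp_all add: vector_def)

lemma vec2_eq_iff: "(x :: 'a^2) = y \<longleftrightarrow> x $ 1 = y $ 1 \<and> x $ 2 = y $ 2"
  and vec3_eq_iff: "(u :: 'a^3) = v \<longleftrightarrow> u $ 1 = v $ 1 \<and> u $ 2 = v $ 2 \<and> u $ 3 = v $ 3"
  and vec4_eq_iff: "(p :: 'a^4) = q \<longleftrightarrow> p $ 1 = q $ 1 \<and> p $ 2 = q $ 2 \<and> p $ 3 = q $ 3 \<and> p $ 4 = q $ 4"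
  by (simp_all add: vec_eq_iff forall_2 forall_3 forall_4)

lemma norm_vec2: "norm (x :: real^2) = sqrt ((x $ 1)\<^sup>2 + (x $ 2)\<^sup>2)"
  and norm_vec3: "norm (u :: real^3) = sqrt ((u $ 1)\<^sup>2 + (u $ 2)\<^sup>2 + (u $ 3)\<^sup>2)"
  and norm_vec4: "norm (p :: real^4) = sqrt ((p $ 1)\<^sup>2 + (p $ 2)\<^sup>2 + (p $ 3)\<^sup>2 + (p $ 4)\<^sup>2)"
  by (simp_all add: norm_vec_def L2_set_def sum_2 sum_3 sum_4)

lemma continuous_on_vecI:
  fixes f :: "'a::topological_space \<Rightarrow> 'b::real_normed_vector^'n"
  assumes "\<And>i. continuous_on S (\<lambda>x. f x $ i)"
  shows "continuous_on S f"
proof -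
  have "continuous_on S (\<lambda>x. \<chi> i. f x $ i)"
    by (intro continuous_on_vec_lambda assms)
  then show ?thesis by simp
qed

lemma continuous_on_vector [continuous_intros]:
  fixes a b c d :: "'a::topological_space \<Rightarrow> real"
  assumes "continuous_on S a" "continuous_on S b"
  shows "continuous_on S (\<lambda>x. vector [a x, b x] :: real^2)"
    "continuous_on S c \<Longrightarrow> continuous_on S (\<lambda>x. vector [a x, b x, c x] :: real^3)"
    "continuous_on S c \<Longrightarrow> continuous_on S d \<Longrightarrow>
      continuous_on S (\<lambda>x. vector [a x, b x, c x, d x] :: real^4)"
proof -
  show "continuous_on S (\<lambda>x. vector [a x, b x] :: real^2)"
  proof (rule continuous_on_vecI)
    show "continuous_on S (\<lambda>x. (vector [a x, b x] :: real^2) $ i)" for i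
      using exhaust_2[of i] assms by auto
  qed
  show "continuous_on S (\<lambda>x. vector [a x, b x, c x] :: real^3)" if "continuous_on S c"
  proof (rule continuous_on_vecI)
    show "continuous_on S (\<lambda>x. (vector [a x, b x, c x] :: real^3) $ i)" for i
      using exhaust_3[of i] assms that by auto
  qed
  show "continuous_on S (\<lambda>x. vector [a x, b x, c x, d x] :: real^4)"
    if "continuous_on S c" "continuous_on S d"
  proof (rule continuous_on_vecI)
    show "continuous_on S (\<lambda>x. (vector [a x, b x, c x, d x] :: real^4) $ i)" for i
      using exhaust_4[of i] assms that by auto
  qed
qed

lemma smooth_on_vector [smooth_intros]:
  fixes a b c d :: "'a::euclidean_space \<Rightarrow> real"
  assumes "open S" "smooth_on S a" "smooth_on S b" "smooth_on S c"
  shows "smooth_on S (\<lambda>x. vector [a x, b x, c x] :: real^3)"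
    "smooth_on S d \<Longrightarrow> smooth_on S (\<lambda>x. vector [a x, b x, c x, d x] :: real^4)"
proof -
  show "smooth_on S (\<lambda>x. vector [a x, b x, c x] :: real^3)"
  proof (rule smooth_on_vec[OF assms(1)])
    show "smooth_on S (\<lambda>x. (vector [a x, b x, c x] :: real^3) $ i)" for i
      using exhaust_3[of i] assms by auto
  qed
  show "smooth_on S (\<lambda>x. vector [a x, b x, c x, d x] :: real^4)" if "smooth_on S d"
  proof (rule smooth_on_vec[OF assms(1)])
    show "smooth_on S (\<lambda>x. (vector [a x, b x, c x, d x] :: real^4) $ i)" for i
      using exhaust_4[of i] assms that by auto
  qed
qed

lemma ambient_isotopy_end_iff:
  "ambient_isotopy_end \<Phi> \<longleftrightarrow>
    (\<exists>H :: real \<times> (real^3) \<Rightarrow> real^3.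
         continuous_on ({0..1} \<times> UNIV) H \<and> (\<forall>x. H (0, x) = x) \<and> (\<forall>x. H (1, x) = \<Phi> x) \<and>
         (\<forall>s\<in>{0..1}. \<exists>h'. homeomorphism UNIV UNIV (\<lambda>x. H (s, x)) h'))"
  unfolding ambient_isotopy_end_def homotopic_with_def
  by (simp add: prod_topology_subtopology continuous_map_into_subtopology)

lemma ambient_isotopy_endI:
  fixes H G :: "real \<times> (real^3) \<Rightarrow> real^3"
  assumes H: "continuous_on ({0..1} \<times> UNIV) H" and G: "continuous_on ({0..1} \<times> UNIV) G"
    and inv: "\<And>s x. 0 \<le> s \<Longrightarrow> s \<le> 1 \<Longrightarrow> G (s, H (s, x)) = x"
      "\<And>s x. 0 \<le> s \<Longrightarrow> s \<le> 1 \<Longrightarrow> H (s, G (s, x)) = x"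
    and "\<And>x. H (0, x) = x" "\<And>x. H (1, x) = \<Phi> x"
  shows "ambient_isotopy_end \<Phi>"
  unfolding ambient_isotopy_end_iff
proof (intro exI[of _ H] conjI ballI)
  fix s :: real assume s: "s \<in> {0..1}"
  have c: "continuous_on UNIV (\<lambda>x. (s, x))" and sub: "range (\<lambda>x. (s, x)) \<subseteq> {0..1} \<times> UNIV"
    using s by (auto intro!: continuous_intros)
  have "continuous_on UNIV (\<lambda>x. H (s, x))" "continuous_on UNIV (\<lambda>x. G (s, x))"
    using continuous_on_compose2[OF H c sub] continuous_on_compose2[OF G c sub] .
  then show "\<exists>h'. homeomorphism UNIV UNIV (\<lambda>x. H (s, x)) h'"
    by (intro exI[of _ "\<lambda>x. G (s, x)"] homeomorphismI) (use inv s in auto)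
qed (use assms in auto)

lemma ambient_isotopy_end_bij:
  assumes "ambient_isotopy_end \<Phi>"
  shows "bij \<Phi>"
proof -
  have "\<exists>h'. homeomorphism UNIV UNIV \<Phi> h'"
    using homotopic_with_imp_property[OF assms[unfolded ambient_isotopy_end_def]] by blast
  then obtain h' where h: "homeomorphism UNIV UNIV \<Phi> h'" by blast
  then show "bij \<Phi>"
    by (intro bij_betw_byWitness[where f' = h']) (auto simp: homeomorphism_def)
qed

lemma ambient_isotopy_end_id: "ambient_isotopy_end (\<lambda>x. x)"
  by (rule ambient_isotopy_endI[where H = snd and G = snd]) (auto intro!: continuous_intros)

lemma ambient_isotopy_end_compose:
  assumes "ambient_isotopy_end \<Phi>" "ambient_isotopy_end \<Psi>"
  shows "ambient_isotopy_end (\<lambda>x. \<Psi> (\<Phi> x))"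
proof -
  obtain H where H: "continuous_on ({0..1} \<times> UNIV) H" "\<forall>x. H (0, x) = x" "\<forall>x. H (1, x) = \<Phi> x"
      "\<forall>s\<in>{0..1}. \<exists>h'. homeomorphism UNIV UNIV (\<lambda>x. H (s::real, x)) h'"
    using assms(1) unfolding ambient_isotopy_end_iff by auto
  obtain G where G: "continuous_on ({0..1} \<times> UNIV) G" "\<forall>x. G (0, x) = x" "\<forall>x. G (1, x) = \<Psi> x"
      "\<forall>s\<in>{0..1}. \<exists>h'. homeomorphism UNIV UNIV (\<lambda>x. G (s::real, x)) h'"
    using assms(2) unfolding ambient_isotopy_end_iff by auto
  show ?thesis unfolding ambient_isotopy_end_iff
  proof (intro exI[of _ "\<lambda>z. G (fst z, H z)"] conjI ballI)
    show "continuous_on ({0..1} \<times> UNIV) (\<lambda>z. G (fst z, H z))"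
      by (rule continuous_on_compose2[OF G(1)]) (use H(1) in \<open>auto intro!: continuous_intros\<close>)
    fix s :: real assume "s \<in> {0..1}"
    then obtain h g where "homeomorphism UNIV UNIV (\<lambda>x. H (s, x)) h" "homeomorphism UNIV UNIV (\<lambda>x. G (s, x)) g"
      using H(4) G(4) by meson
    from homeomorphism_compose[OF this]
    show "\<exists>h'. homeomorphism UNIV UNIV (\<lambda>x. G (fst (s, x), H (s, x))) h'"
      by (auto simp: comp_def)
  qed (use H G in auto)
qed

text \<open>For a reflection \<open>\<rho>\<close>, which is not isotopic to the identity, conjugation turns an isotopy for a
  knot into one for its mirror image.\<close>

lemma ambient_isotopy_end_conjugate:
  fixes \<rho> :: "real^3 \<Rightarrow> real^3"
  assumes "ambient_isotopy_end \<Phi>" "continuous_on UNIV \<rho>" "\<And>x. \<rho> (\<rho> x) = x"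
  shows "ambient_isotopy_end (\<lambda>x. \<rho> (\<Phi> (\<rho> x)))"
proof -
  obtain H where H: "continuous_on ({0..1} \<times> UNIV) H" "\<forall>x. H (0, x) = x" "\<forall>x. H (1, x) = \<Phi> x"
      "\<forall>s\<in>{0..1}. \<exists>h'. homeomorphism UNIV UNIV (\<lambda>x. H (s::real, x)) h'"
    using assms(1) unfolding ambient_isotopy_end_iff by auto
  have r: "homeomorphism UNIV UNIV \<rho> \<rho>"
    by (intro homeomorphismI) (use assms(2,3) in auto)
  show ?thesis unfolding ambient_isotopy_end_iff
  proof (intro exI[of _ "\<lambda>z. \<rho> (H (fst z, \<rho> (snd z)))"] conjI ballI)
    show "continuous_on ({0..1} \<times> UNIV) (\<lambda>z. \<rho> (H (fst z, \<rho> (snd z))))"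
      by (rule continuous_on_compose2[OF assms(2)], rule continuous_on_compose2[OF H(1)])
         (auto intro!: continuous_intros continuous_on_compose2[OF assms(2)])
    fix s :: real assume "s \<in> {0..1}"
    then obtain h where "homeomorphism UNIV UNIV (\<lambda>x. H (s, x)) h"
      using H(4) by meson
    from homeomorphism_compose[OF homeomorphism_compose[OF r this] r]
    show "\<exists>h'. homeomorphism UNIV UNIV (\<lambda>x. \<rho> (H (fst (s, x), \<rho> (snd (s, x))))) h'"
      by (auto simp: comp_def)
  qed (use H assms(3) in auto)
qed

text \<open>The displacement is constant along the lines in the direction \<open>e\<close>, so that subtracting it is inverse to
  adding it, for all multiples of \<open>\<phi>\<close>.\<close>

lemma ambient_isotopy_end_shear:
  fixes \<phi> :: "real^3 \<Rightarrow> real" and e :: "real^3"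
  assumes c: "continuous_on UNIV \<phi>" and inv: "\<And>x c. \<phi> (x + c *\<^sub>R e) = \<phi> x"
  shows "ambient_isotopy_end (\<lambda>x. x + \<phi> x *\<^sub>R e)"
proof -
  have inv': "\<phi> (x - c *\<^sub>R e) = \<phi> x" for x c using inv[of x "- c"] by simp
  show ?thesis
    by (rule ambient_isotopy_endI[where H = "\<lambda>z. snd z + (fst z * \<phi> (snd z)) *\<^sub>R e"
          and G = "\<lambda>z. snd z - (fst z * \<phi> (snd z)) *\<^sub>R e"])
       (auto simp: inv inv' intro!: continuous_intros continuous_on_compose2[OF c])
qed

lemma ambient_isotopy_end_scale:
  assumes "c > 0"
  shows "ambient_isotopy_end (\<lambda>x. c *\<^sub>R x)"
proof -
  have pos: "1 - s + s * c > 0" if "0 \<le> s" "s \<le> 1" for s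
    using that assms by (cases "s = 1") (auto simp: add_pos_nonneg)
  show ?thesis
    by (rule ambient_isotopy_endI[where H = "\<lambda>z. (1 - fst z + fst z * c) *\<^sub>R snd z"
          and G = "\<lambda>z. (1 / (1 - fst z + fst z * c)) *\<^sub>R snd z"])
       (use pos in \<open>force intro!: continuous_intros\<close>)+
qed

text \<open>Each plane \<open>x $ 2 = const\<close> is identified with \<open>\<complex>\<close> and mapped to itself by a complex affine map.
  The factor of \<open>\<real> \<rightarrow> \<complex> - {0}\<close> has a logarithm, which is scaled down to zero.\<close>

lemma ambient_isotopy_end_levelwise:
  fixes a b c d :: "real \<Rightarrow> real"
  assumes cont: "continuous_on UNIV a" "continuous_on UNIV b" "continuous_on UNIV c" "continuous_on UNIV d"
    and nz: "\<And>y. a y \<noteq> 0 \<or> b y \<noteq> 0"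
  shows "ambient_isotopy_end (\<lambda>x. vector [a (x $ 2) * x $ 1 - b (x $ 2) * x $ 3 + c (x $ 2), x $ 2,
    a (x $ 2) * x $ 3 + b (x $ 2) * x $ 1 + d (x $ 2)])"
proof -
  have "continuous_on UNIV (\<lambda>y. Complex (a y) (b y))"
    using cont by (auto intro!: continuous_intros simp: Complex_eq)
  moreover have "Complex (a y) (b y) \<noteq> 0" for y using nz[of y] by (simp add: complex_eq_iff)
  ultimately obtain l where l: "continuous_on UNIV l" "\<And>y. Complex (a y) (b y) = exp (l y)"
    using continuous_logarithm_on_contractible[of "UNIV :: real set" "\<lambda>y. Complex (a y) (b y)", OF _ contractible_UNIV]
    by auto
  define W :: "real \<times> (real^3) \<Rightarrow> complex" where
    "W z = exp (of_real (fst z) * l (snd z $ 2)) * Complex (snd z $ 1) (snd z $ 3)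
            + of_real (fst z) * Complex (c (snd z $ 2)) (d (snd z $ 2))" for z
  define V :: "real \<times> (real^3) \<Rightarrow> complex" where
    "V z = exp (- (of_real (fst z) * l (snd z $ 2))) * (Complex (snd z $ 1) (snd z $ 3)
            - of_real (fst z) * Complex (c (snd z $ 2)) (d (snd z $ 2)))" for z
  have cont': "continuous_on X (\<lambda>z::real \<times> (real^3). f (snd z $ 2))"
    if "continuous_on UNIV f" for f :: "real \<Rightarrow> 'a::topological_space" and X
    by (rule continuous_on_compose2[OF that]) (auto intro!: continuous_intros)
  show ?thesis
  proof (rule ambient_isotopy_endI[where H = "\<lambda>z. vector [Re (W z), snd z $ 2, Im (W z)]"
        and G = "\<lambda>z. vector [Re (V z), snd z $ 2, Im (V z)]"])
    have "continuous_on ({0..1} \<times> UNIV) W" "continuous_on ({0..1} \<times> UNIV) V"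
      unfolding W_def[abs_def] V_def[abs_def] Complex_eq
      by (intro continuous_intros cont' cont l)+
    then show "continuous_on ({0..1} \<times> UNIV) (\<lambda>z. vector [Re (W z), snd z $ 2, Im (W z)] :: real^3)"
       "continuous_on ({0..1} \<times> UNIV) (\<lambda>z. vector [Re (V z), snd z $ 2, Im (V z)] :: real^3)"
      by (auto intro!: continuous_intros)
    fix s :: real and x :: "real^3"
    have V: "V (s, vector [Re w, y, Im w]) = exp (- (of_real s * l y)) * (w - of_real s * Complex (c y) (d y))"
     and W: "W (s, vector [Re w, y, Im w]) = exp (of_real s * l y) * w + of_real s * Complex (c y) (d y)" for w y
      by (simp_all add: V_def W_def)
    have "V (s, vector [Re (W (s, x)), x $ 2, Im (W (s, x))]) = Complex (x $ 1) (x $ 3)"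
      unfolding V by (simp add: W_def exp_minus field_simps)
    then show "vector [Re (V (s, vector [Re (W (s, x)), snd (s, x) $ 2, Im (W (s, x))])),
        snd (s, vector [Re (W (s, x)), snd (s, x) $ 2, Im (W (s, x))] :: real^3) $ 2,
        Im (V (s, vector [Re (W (s, x)), snd (s, x) $ 2, Im (W (s, x))]))] = x"
      by (simp add: vec3_eq_iff)
    have "W (s, vector [Re (V (s, x)), x $ 2, Im (V (s, x))]) = Complex (x $ 1) (x $ 3)"
      unfolding W by (simp add: V_def exp_minus field_simps)
    then show "vector [Re (W (s, vector [Re (V (s, x)), snd (s, x) $ 2, Im (V (s, x))])),
        snd (s, vector [Re (V (s, x)), snd (s, x) $ 2, Im (V (s, x))] :: real^3) $ 2,
        Im (W (s, vector [Re (V (s, x)), snd (s, x) $ 2, Im (V (s, x))]))] = x"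
      by (simp add: vec3_eq_iff)
    show "vector [Re (W (0, x)), snd (0::real, x) $ 2, Im (W (0, x))] = x"
      by (simp add: vec3_eq_iff W_def)
    have "W (1, x) = Complex (a (x $ 2)) (b (x $ 2)) * Complex (x $ 1) (x $ 3) + Complex (c (x $ 2)) (d (x $ 2))"
      by (simp add: W_def l(2))
    then show "vector [Re (W (1, x)), snd (1::real, x) $ 2, Im (W (1, x))] =
       (vector [a (x $ 2) * x $ 1 - b (x $ 2) * x $ 3 + c (x $ 2), x $ 2,
          a (x $ 2) * x $ 3 + b (x $ 2) * x $ 1 + d (x $ 2)] :: real^3)"
      by (simp add: vec3_eq_iff)
  qed
qed

section \<open>Long knots and their equivalence\<close>

lemma equivalent_long_knots_ambient:
  assumes "ambient_isotopy_end \<Phi>" "equivalent_long_knots (\<lambda>t. \<Phi> (\<kappa> t)) k"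
  shows "equivalent_long_knots \<kappa> k"
proof -
  obtain \<Psi> \<sigma> where "ambient_isotopy_end \<Psi>" "strict_mono \<sigma>" "surj (\<sigma> :: real \<Rightarrow> real)"
     "\<Psi> \<circ> (\<lambda>t. \<Phi> (\<kappa> t)) = k \<circ> \<sigma>"
    using assms(2) unfolding equivalent_long_knots_def by blast
  then show ?thesis
    unfolding equivalent_long_knots_def using ambient_isotopy_end_compose[OF assms(1)]
    by (intro exI[of _ "\<lambda>x. \<Psi> (\<Phi> x)"] exI[of _ \<sigma>]) (auto simp: comp_def)
qed

lemma equivalent_long_knots_mirror:
  assumes "equivalent_long_knots \<kappa> k"
  shows "equivalent_long_knots (mirror \<kappa>) (mirror k)"
proof -
  define \<rho> :: "real^3 \<Rightarrow> real^3" where "\<rho> x = vector [- (x $ 1), x $ 2, x $ 3]" for x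
  obtain \<Phi> \<sigma> where *: "ambient_isotopy_end \<Phi>" "strict_mono \<sigma>" "surj (\<sigma> :: real \<Rightarrow> real)" "\<Phi> \<circ> \<kappa> = k \<circ> \<sigma>"
    using assms unfolding equivalent_long_knots_def by blast
  have m: "mirror f t = \<rho> (f (- t))" for f t by (simp add: mirror_def \<rho>_def)
  have rr: "\<rho> (\<rho> x) = x" for x by (simp add: \<rho>_def vec3_eq_iff)
  have "continuous_on UNIV \<rho>" unfolding \<rho>_def[abs_def] by (intro continuous_intros)
  then have "ambient_isotopy_end (\<lambda>x. \<rho> (\<Phi> (\<rho> x)))"
    using ambient_isotopy_end_conjugate[OF *(1) _ rr] by blast
  moreover have "strict_mono (\<lambda>t. - \<sigma> (- t))" using *(2) by (auto simp: strict_mono_def)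
  moreover have "surj (\<lambda>t. - \<sigma> (- t))"
    using *(3) by (metis (no_types, lifting) add.inverse_inverse surj_def)
  moreover have "\<rho> (\<Phi> (\<rho> (mirror \<kappa> t))) = mirror k (- \<sigma> (- t))" for t
    using fun_cong[OF *(4), of "- t"] by (simp add: m rr)
  ultimately show ?thesis
    unfolding equivalent_long_knots_def by (intro exI conjI) auto
qed

lemma inj_frechet_derivative_curve_iff:
  fixes f :: "real \<Rightarrow> real^'n"
  assumes "f differentiable (at t)"
  shows "inj (frechet_derivative f (at t)) \<longleftrightarrow> \<not> (\<forall>i. ((\<lambda>s. f s $ i) has_real_derivative 0) (at t))"
proof -
  let ?D = "frechet_derivative f (at t)"
  have D: "(f has_derivative ?D) (at t)" using assms frechet_derivative_works by blast
  then have lin: "linear ?D" by (rule has_derivative_linear)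
  have comp: "((\<lambda>s. f s $ i) has_derivative (\<lambda>v. ?D v $ i)) (at t)" for i
    using bounded_linear.has_derivative[OF bounded_linear_vec_nth D] .
  have sc: "?D v = v *\<^sub>R ?D 1" for v using linear_scale[OF lin, of v 1] by simp
  have "inj ?D \<longleftrightarrow> ?D 1 \<noteq> 0"
  proof
    show "inj ?D \<Longrightarrow> ?D 1 \<noteq> 0" using linear_injective_0[OF lin] by (metis zero_neq_one)
    show "?D 1 \<noteq> 0 \<Longrightarrow> inj ?D" unfolding linear_injective_0[OF lin] by (metis sc scaleR_eq_0_iff)
  qed
  moreover have "((\<lambda>s. f s $ i) has_real_derivative 0) (at t) \<longleftrightarrow> ?D 1 $ i = 0" for i
  proof -
    have "((\<lambda>s. f s $ i) has_real_derivative (?D 1 $ i)) (at t)"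
    proof -
      have "(\<lambda>v. ?D v $ i) = (*) (?D 1 $ i)" by (rule ext, subst sc) simp
      then show ?thesis using comp[of i] unfolding has_field_derivative_def by simp
    qed
    then show ?thesis using DERIV_unique by force
  qed
  ultimately show ?thesis by (simp add: vec_eq_iff)
qed

section \<open>Straightening the ends of a polynomial knot\<close>

lemma poly_eventually_gt:
  fixes p :: "real poly"
  assumes "degree p > 0" "lead_coeff p > 0"
  shows "\<exists>n. \<forall>t\<ge>n. poly p t > B"
proof -
  have d: "degree [:- B:] < degree p" using assms(1) by simp
  have "lead_coeff ([:- B:] + p) > 0" using lead_coeff_add_le[OF d] assms(2) by simp
  then obtain n where "\<forall>t\<ge>n. poly ([:- B:] + p) t \<ge> lead_coeff ([:- B:] + p)"
    using poly_pinfty_gt_lc by blast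
  with \<open>lead_coeff ([:- B:] + p) > 0\<close> have "\<forall>t\<ge>n. poly ([:- B:] + p) t > 0"
    by force
  then show ?thesis by (intro exI[of _ n]) auto
qed

lemma even_poly_reflection:
  fixes p :: "real poly"
  assumes p: "degree p > 0" "lead_coeff p > 0" "even (degree p)"
  shows "\<exists>q. (\<forall>t. poly q t = poly p (- t)) \<and> degree q > 0 \<and> lead_coeff q > 0"
proof -
  define q where "q = pcompose p [:0, -1:]"
  have "lead_coeff q = lead_coeff p * (-1) ^ degree p"
    unfolding q_def by (subst lead_coeff_comp) auto
  then show ?thesis
    using p by (intro exI[of _ q]) (simp add: q_def degree_pcompose poly_pcompose)
qed

lemma poly_even_eventually_gt:
  fixes p :: "real poly"
  assumes p: "degree p > 0" "lead_coeff p > 0" "even (degree p)"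
  shows "\<exists>R. \<forall>t. \<bar>t\<bar> \<ge> R \<longrightarrow> poly p t > B"
proof -
  obtain q where q_eq: "\<And>t. poly q t = poly p (- t)" and q: "degree q > 0" "lead_coeff q > 0"
    using even_poly_reflection[OF p] by blast
  obtain m n where mn: "\<forall>t\<ge>m. poly p t > B" "\<forall>t\<ge>n. poly q t > B"
    using poly_eventually_gt[OF p(1,2)] poly_eventually_gt[OF q] by blast
  have "poly p t > B" if "\<bar>t\<bar> \<ge> max m n" for t
  proof (cases "t \<ge> 0")
    case True
    then show ?thesis using mn(1) that by auto
  next
    case False
    then have "poly q (- t) > B" using mn(2) that by auto
    then show ?thesis by (simp add: q_eq)
  qed
  then show ?thesis by blast
qed

lemma poly_pderiv_eventually_pos:
  fixes p :: "real poly"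
  assumes "degree p > 0" "lead_coeff p > 0"
  shows "\<exists>n. \<forall>t\<ge>n. poly (pderiv p) t > 0"
proof -
  have "lead_coeff (pderiv p) > 0"
    using assms by (simp add: degree_pderiv coeff_pderiv)
  then obtain n where "\<forall>t\<ge>n. poly (pderiv p) t \<ge> lead_coeff (pderiv p)"
    using poly_pinfty_gt_lc by blast
  with \<open>lead_coeff (pderiv p) > 0\<close> show ?thesis by force
qed

text \<open>The branches are the smooth functions from which the affine maps of the levels are
  built.\<close>

lemma poly_inverse_branch:
  fixes p :: "real poly"
  assumes p: "degree p > 0" "lead_coeff p > 0" and inc: "\<And>t. t \<ge> T \<Longrightarrow> poly (pderiv p) t > 0"
  obtains \<tau> where "smooth_on {poly p T<..} \<tau>"
    "\<And>x. x > poly p T \<Longrightarrow> \<tau> x > T" "\<And>x. x > poly p T \<Longrightarrow> poly p (\<tau> x) = x"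
    "\<And>t. t > T \<Longrightarrow> \<tau> (poly p t) = t"
proof -
  have mono: "poly p s < poly p t" if "T \<le> s" "s < t" for s t
    using DERIV_pos_imp_increasing[OF that(2), of "poly p"] inc that
    by (metis order_trans poly_DERIV)
  have inj: "inj_on (poly p) {T<..}"
  proof (rule linorder_inj_onI')
    fix i j assume "i \<in> {T<..}" "j \<in> {T<..}" "i < j"
    then show "poly p i \<noteq> poly p j" using mono[of i j] by simp
  qed
  have surj: "\<exists>t>T. poly p t = x" if x: "x > poly p T" for x
  proof -
    obtain n where n: "\<forall>t\<ge>n. poly p t > x" using poly_eventually_gt[OF p] by blast
    have "\<exists>t\<ge>T. t \<le> max n T \<and> poly p t = x"
      by (rule IVT') (use x n in \<open>auto simp: less_imp_le intro!: continuous_intros\<close>)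
    then show ?thesis using x by (metis less_eq_real_def less_irrefl)
  qed
  define \<tau> where "\<tau> = inv_into {T<..} (poly p)"
  have img: "x \<in> poly p ` {T<..}" if "x > poly p T" for x
    using surj[OF that] by auto
  have \<tau>1: "\<tau> x > T" if "x > poly p T" for x
    using inv_into_into[OF img[OF that]] by (simp add: \<tau>_def)
  have \<tau>2: "poly p (\<tau> x) = x" if "x > poly p T" for x
    using f_inv_into_f[OF img[OF that]] by (simp add: \<tau>_def)
  have \<tau>3: "\<tau> (poly p t) = t" if "t > T" for t
    using inv_into_f_f[OF inj, of t] that by (simp add: \<tau>_def)
  have "isCont \<tau> x" if x: "x > poly p T" for x
  proof -
    have t: "\<tau> x > T" using \<tau>1[OF x] .
    have "isCont \<tau> (poly p (\<tau> x))"
    proof (rule isCont_inverse_function[where f = "poly p" and x = "\<tau> x" and d = "(\<tau> x - T) / 2"])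
      show "0 < (\<tau> x - T) / 2" using t by simp
      show "\<tau> (poly p z) = z" if "\<bar>z - \<tau> x\<bar> \<le> (\<tau> x - T) / 2" for z
      proof -
        have "- ((\<tau> x - T) / 2) \<le> z - \<tau> x" using that by linarith
        then have "z > T" using t by (simp add: field_simps)
        then show ?thesis by (rule \<tau>3)
      qed
    qed simp
    then show ?thesis using \<tau>2[OF x] by simp
  qed
  then have cont: "continuous_on {poly p T<..} \<tau>"
    by (auto intro: continuous_at_imp_continuous_on)
  have "smooth_on {poly p T<..} \<tau>"
  proof (rule smooth_on_inverse_function[where f = "poly p" and f' = "poly (pderiv p)" and T = UNIV])
    show "smooth_on UNIV (poly (pderiv p))"
      using smooth_on_poly[OF open_UNIV smooth_on_id[OF open_UNIV]] .
    fix t assume "t \<in> \<tau> ` {poly p T<..}"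
    then have "t > T" using \<tau>1 by auto
    then show "poly (pderiv p) t \<noteq> 0" using inc[of t] by simp
  qed (use cont \<tau>2 in auto)
  then show ?thesis using that \<tau>1 \<tau>2 \<tau>3 by blast
qed

lemma poly_even_inverse_branches:
  fixes p :: "real poly"
  assumes p: "degree p > 0" "lead_coeff p > 0" "even (degree p)"
  obtains M \<tau>1 \<tau>2 where "smooth_on {M<..} \<tau>1" "smooth_on {M<..} \<tau>2"
    "\<And>x. x > M \<Longrightarrow> \<tau>2 x < 0 \<and> 0 < \<tau>1 x \<and> poly p (\<tau>1 x) = x \<and> poly p (\<tau>2 x) = x"
    "\<And>t. poly p t > M \<Longrightarrow> t = (if t \<ge> 0 then \<tau>1 (poly p t) else \<tau>2 (poly p t))"
proof -
  obtain q where q_eq: "\<And>t. poly q t = poly p (- t)" and q: "degree q > 0" "lead_coeff q > 0"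
    using even_poly_reflection[OF p] by blast
  obtain n1 n2 where n: "\<And>t. t \<ge> n1 \<Longrightarrow> poly (pderiv p) t > 0" "\<And>t. t \<ge> n2 \<Longrightarrow> poly (pderiv q) t > 0"
    using poly_pderiv_eventually_pos[OF p(1,2)] poly_pderiv_eventually_pos[OF q] by blast
  define T where "T = max 1 (max n1 n2)"
  have T: "T > 0" "T \<ge> n1" "T \<ge> n2" by (auto simp: T_def)
  obtain \<tau> where \<tau>: "smooth_on {poly p T<..} \<tau>" "\<And>x. x > poly p T \<Longrightarrow> \<tau> x > T"
    "\<And>x. x > poly p T \<Longrightarrow> poly p (\<tau> x) = x" "\<And>t. t > T \<Longrightarrow> \<tau> (poly p t) = t"
    by (rule poly_inverse_branch[OF p(1,2), of T]) (use n T in auto)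
  obtain \<upsilon> where \<upsilon>: "smooth_on {poly q T<..} \<upsilon>" "\<And>x. x > poly q T \<Longrightarrow> \<upsilon> x > T"
    "\<And>x. x > poly q T \<Longrightarrow> poly q (\<upsilon> x) = x" "\<And>t. t > T \<Longrightarrow> \<upsilon> (poly q t) = t"
    by (rule poly_inverse_branch[OF q, of T]) (use n T in auto)
  have "bounded (poly p ` {-T..T})"
    by (intro compact_imp_bounded compact_continuous_image) (auto intro!: continuous_intros)
  then obtain M where M: "\<And>t. t \<in> {-T..T} \<Longrightarrow> poly p t \<le> M"
    unfolding bounded_iff by (metis abs_le_D1 imageI real_norm_def)
  have MT: "poly p T \<le> M" "poly q T \<le> M" using M[of T] M[of "- T"] T by (auto simp: q_eq)
  show ?thesis
  proof (rule that[of M \<tau> "\<lambda>x. - \<upsilon> x"])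
    show "smooth_on {M<..} \<tau>" using smooth_on_subset[OF \<tau>(1)] MT by auto
    show "smooth_on {M<..} (\<lambda>x. - \<upsilon> x)"
      by (intro smooth_on_minus smooth_on_subset[OF \<upsilon>(1)]) (use MT in auto)
    show "- \<upsilon> x < 0 \<and> 0 < \<tau> x \<and> poly p (\<tau> x) = x \<and> poly p (- \<upsilon> x) = x" if "x > M" for x
      using \<tau>(2,3)[of x] \<upsilon>(2,3)[of x] that MT T by (auto simp: q_eq)
    fix t assume t: "poly p t > M"
    then have "t \<notin> {-T..T}" using M[of t] by auto
    then consider "t > T" | "- t > T" by force
    then show "t = (if t \<ge> 0 then \<tau> (poly p t) else - \<upsilon> (poly p t))"
    proof cases
      case 1
      then show ?thesis using \<tau>(4)[of t] T by simp
    next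
      case 2
      then show ?thesis using \<upsilon>(4)[of "- t"] T by (simp add: q_eq)
    qed
  qed
qed

text \<open>The radius \<open>\<delta>\<close> leaves room for spinning the knotted part of the axis around a
  plane without self-intersections.\<close>

definition long_knot_within :: "real \<Rightarrow> (real \<Rightarrow> real^3) \<Rightarrow> bool" where
  "long_knot_within \<delta> k \<longleftrightarrow> proper_smooth_embedding k \<and>
     (\<forall>t. \<bar>t\<bar> \<ge> \<delta> \<longrightarrow> k t = vector [t, 0, 0]) \<and> (\<forall>t. \<bar>t\<bar> \<le> \<delta> \<longrightarrow> norm (k t) \<le> \<delta>)"

lemma long_knot_within_imp_standard:
  assumes "long_knot_within \<delta> k" "\<delta> \<le> 1"
  shows "standard_long_knot k"
proof -
  have "norm (k t) \<le> 1" if "\<bar>t\<bar> \<le> 1" for t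
  proof (cases "\<bar>t\<bar> \<le> \<delta>")
    case True
    then show ?thesis using assms by (force simp: long_knot_within_def)
  next
    case False
    then show ?thesis using assms that by (simp add: long_knot_within_def norm_vec3)
  qed
  then show ?thesis using assms by (auto simp: standard_long_knot_def long_knot_within_def)
qed

lemma proper_smooth_embedding_curveI:
  fixes k :: "real \<Rightarrow> real^3"
  assumes "smooth_on UNIV k" "\<And>t. \<exists>i. \<not> ((\<lambda>s. k s $ i) has_real_derivative 0) (at t)" "inj k"
    and ends: "\<And>t. \<bar>t\<bar> \<ge> R \<Longrightarrow> k t = vector [t, 0, 0]"
  shows "proper_smooth_embedding k"
  unfolding proper_smooth_embedding_def
proof (intro conjI allI)
  show "smooth k" using assms(1) by (simp add: smooth_on_UNIV)
  show "inj (frechet_derivative k (at t))" for t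
    using inj_frechet_derivative_curve_iff[of k t] smooth_on_differentiable[OF assms(1)] assms(2) by auto
  show "proper_map euclidean euclidean k"
    by (rule proper_map_if_norm_ge[of _ R])
       (use ends in \<open>auto simp: norm_vec3 intro: smooth_on_continuous[OF assms(1)]\<close>)
qed fact

lemma proper_smooth_embedding_curveD:
  assumes "proper_smooth_embedding (k :: real \<Rightarrow> real^3)"
  shows "smooth_on UNIV k" "\<exists>i. \<not> ((\<lambda>s. k s $ i) has_real_derivative 0) (at t)" "inj k"
proof -
  show s: "smooth_on UNIV k" and "inj k"
    using assms by (auto simp: proper_smooth_embedding_def smooth_on_UNIV)
  show "\<exists>i. \<not> ((\<lambda>s. k s $ i) has_real_derivative 0) (at t)"
    using inj_frechet_derivative_curve_iff[of k t] smooth_on_differentiable[OF s] assms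
    by (auto simp: proper_smooth_embedding_def)
qed

lemma DERIV_zero_reparam:
  assumes "((\<lambda>s. c * f (a * s + b)) has_real_derivative 0) (at t)" "a \<noteq> 0" "c \<noteq> 0"
    "(f :: real \<Rightarrow> real) differentiable (at (a * t + b))"
  shows "(f has_real_derivative 0) (at (a * t + b))"
proof -
  obtain D where D: "(f has_real_derivative D) (at (a * t + b))"
    using assms(4) real_differentiable_def by blast
  have "((\<lambda>s. a * s + b) has_real_derivative a) (at t)"
    by (auto intro!: derivative_eq_intros)
  then have "((\<lambda>s. c * f (a * s + b)) has_real_derivative c * (D * a)) (at t)"
    by (intro DERIV_cmult DERIV_chain2[where f = f and g = "\<lambda>s. a * s + b", OF D])
  then have "c * (D * a) = 0" using DERIV_unique assms(1) by blast
  then show ?thesis using D assms by simp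
qed

lemma long_knot_within_mirror:
  assumes k: "long_knot_within \<delta> k"
  shows "long_knot_within \<delta> (mirror k)"
  unfolding long_knot_within_def
proof (intro conjI allI impI)
  have e: "proper_smooth_embedding k" using k by (simp add: long_knot_within_def)
  note k' = proper_smooth_embedding_curveD[OF e]
  have k2: "smooth_on UNIV (\<lambda>t. k (- t))"
    by (intro smooth_on_compose_UNIV[OF k'(1)] smooth_intros open_UNIV)
  show ends: "mirror k t = vector [t, 0, 0]" if "\<bar>t\<bar> \<ge> \<delta>" for t
    using k that by (simp add: long_knot_within_def mirror_def)
  show "norm (mirror k t) \<le> \<delta>" if "\<bar>t\<bar> \<le> \<delta>" for t
  proof -
    have "norm (mirror k t) = norm (k (- t))" by (simp add: mirror_def norm_vec3)
    then show ?thesis using k that by (simp add: long_knot_within_def)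
  qed
  show "proper_smooth_embedding (mirror k)"
  proof (rule proper_smooth_embedding_curveI[OF _ _ _ ends])
    show "smooth_on UNIV (mirror k)" unfolding mirror_def
      by (intro smooth_intros k2 open_UNIV)
    show "inj (mirror k)"
    proof (rule injI)
      fix s t assume "mirror k s = mirror k t"
      then have "k (- s) = k (- t)" by (simp add: mirror_def vec3_eq_iff)
      then show "s = t" using injD[OF k'(3)] by force
    qed
    fix t
    obtain i where i: "\<not> ((\<lambda>s. k s $ i) has_real_derivative 0) (at (- t))" using k'(2) by blast
    have d: "(\<lambda>s. k s $ i) differentiable at (- 1 * t + 0)"
      by (rule smooth_on_differentiable[of UNIV]) (auto intro!: smooth_intros k')
    define c :: real where "c = (if i = 1 then -1 else 1)"
    have eq: "(\<lambda>s. mirror k s $ i) = (\<lambda>s. c * k (-1 * s + 0) $ i)"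
      using exhaust_3[of i] by (auto simp: mirror_def c_def fun_eq_iff)
    have "\<not> ((\<lambda>s. mirror k s $ i) has_real_derivative 0) (at t)"
      unfolding eq using DERIV_zero_reparam[of c "\<lambda>s. k s $ i" "-1" 0 t] i d
      by (auto simp: c_def split: if_splits)
    then show "\<exists>i. \<not> ((\<lambda>s. mirror k s $ i) has_real_derivative 0) (at t)" by blast
  qed
qed

text \<open>A homothety centred at the origin maps the ends into themselves and fits the rest into any ball.
  Scaling the parameter by the same factor makes the ends the identity again.\<close>

lemma long_knot_within_rescale:
  fixes k :: "real \<Rightarrow> real^3"
  assumes k: "proper_smooth_embedding k" and ends: "\<And>t. \<bar>t\<bar> \<ge> R \<Longrightarrow> k t = vector [t, 0, 0]" and d: "\<delta> > 0"
  obtains k' where "long_knot_within \<delta> k'" "equivalent_long_knots k k'"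
proof -
  note k' = proper_smooth_embedding_curveD[OF k]
  have "bounded (k ` {-R..R})"
    by (intro compact_imp_bounded compact_continuous_image)
       (auto intro: continuous_on_subset[OF smooth_on_continuous[OF k'(1)]])
  then obtain B where B: "\<And>t. \<bar>t\<bar> \<le> R \<Longrightarrow> norm (k t) \<le> B"
    unfolding bounded_iff by (metis abs_le_iff atLeastAtMost_iff imageI minus_le_iff)
  define S where "S = max 1 (max B R)"
  have S: "S > 0" "S \<ge> B" "S \<ge> R" by (auto simp: S_def)
  define c where "c = \<delta> / S"
  have c: "c > 0" using S d by (simp add: c_def)
  define k1 where "k1 = (\<lambda>t. c *\<^sub>R k (t / c))"
  have ends1: "k1 t = vector [t, 0, 0]" if "\<bar>t\<bar> \<ge> \<delta>" for t
  proof -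
    have "\<bar>t / c\<bar> \<ge> S" using that d S by (simp add: c_def abs_mult field_simps)
    then have "k (t / c) = vector [t / c, 0, 0]" using S ends[of "t / c"] by simp
    then show ?thesis using c by (simp add: k1_def vec3_eq_iff)
  qed
  have "proper_smooth_embedding k1"
  proof (rule proper_smooth_embedding_curveI[OF _ _ _ ends1])
    show "smooth_on UNIV k1" unfolding k1_def
      by (intro smooth_intros open_UNIV smooth_on_compose_UNIV[OF k'(1)]) (use c in auto)
    show "inj k1"
    proof (rule injI)
      fix s t assume "k1 s = k1 t"
      then have "k (s / c) = k (t / c)" using c by (simp add: k1_def)
      then show "s = t" using injD[OF k'(3)] c by force
    qed
    fix t
    obtain i where i: "\<not> ((\<lambda>s. k s $ i) has_real_derivative 0) (at (t / c))" using k'(2) by blast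
    have d: "(\<lambda>s. k s $ i) differentiable at (1 / c * t + 0)"
      by (rule smooth_on_differentiable[of UNIV]) (auto intro!: smooth_intros k')
    have eq: "(\<lambda>s. k1 s $ i) = (\<lambda>s. c * k (1 / c * s + 0) $ i)"
      by (auto simp: k1_def)
    have "\<not> ((\<lambda>s. k1 s $ i) has_real_derivative 0) (at t)"
      unfolding eq using DERIV_zero_reparam[of c "\<lambda>s. k s $ i" "1 / c" 0 t] i d c by auto
    then show "\<exists>i. \<not> ((\<lambda>s. k1 s $ i) has_real_derivative 0) (at t)" by blast
  qed
  moreover have "norm (k1 t) \<le> \<delta>" if "\<bar>t\<bar> \<le> \<delta>" for t
  proof -
    have t: "\<bar>t / c\<bar> \<le> S" using that d S by (simp add: c_def abs_mult field_simps)
    have "norm (k (t / c)) \<le> S"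
    proof (cases "\<bar>t / c\<bar> \<le> R")
      case True
      then show ?thesis using B[OF True] S by linarith
    next
      case False
      then show ?thesis using ends[of "t / c"] t by (simp add: norm_vec3)
    qed
    then have "c * norm (k (t / c)) \<le> c * S" using c by simp
    then show ?thesis using c S d by (simp add: k1_def c_def)
  qed
  ultimately have "long_knot_within \<delta> k1" using ends1 by (simp add: long_knot_within_def)
  moreover have "equivalent_long_knots k k1"
    unfolding equivalent_long_knots_def
  proof (intro exI conjI)
    show "ambient_isotopy_end (\<lambda>x. c *\<^sub>R x)" by (rule ambient_isotopy_end_scale[OF c])
    show "strict_mono (\<lambda>t. c * t)" using c by (simp add: strict_mono_def)
    show "surj (\<lambda>t. c * t)" by (rule surjI[where f = "\<lambda>t. t / c"]) (use c in simp)
    show "(\<lambda>x. c *\<^sub>R x) \<circ> k = k1 \<circ> (\<lambda>t. c * t)" using c by (auto simp: k1_def)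
  qed
  ultimately show ?thesis using that by blast
qed

text \<open>If the second coordinate tends to infinity at both ends, then each high level \<open>x $ 2 = y\<close> contains
  exactly one point of each end, and a complex affine map of the level moves these points to the
  real numbers \<open>\<tau>1 y\<close> and \<open>\<tau>2 y\<close>, which are their parameters. Thus the ends become
  the ends of the graph of \<open>l\<close>, and shearing by \<open>l\<close> makes them straight.\<close>

lemma polynomial_knot_tame_even:
  fixes f l h :: "real poly"
  assumes inj: "\<And>s t. poly f s = poly f t \<Longrightarrow> poly l s = poly l t \<Longrightarrow> poly h s = poly h t \<Longrightarrow> s = t"
    and reg: "\<And>t. poly (pderiv f) t = 0 \<Longrightarrow> poly (pderiv l) t = 0 \<Longrightarrow> poly (pderiv h) t \<noteq> 0"
    and l: "degree l > 0" "lead_coeff l > 0" "even (degree l)"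
    and \<delta>: "\<delta> > 0"
  obtains k where "long_knot_within \<delta> k"
    "equivalent_long_knots (\<lambda>t. vector [poly f t, poly l t, poly h t]) k"
proof -
  obtain M \<tau>1 \<tau>2 where \<tau>: "smooth_on {M<..} \<tau>1" "smooth_on {M<..} \<tau>2"
    "\<And>y. y > M \<Longrightarrow> \<tau>2 y < 0 \<and> 0 < \<tau>1 y \<and> poly l (\<tau>1 y) = y \<and> poly l (\<tau>2 y) = y"
    "\<And>t. poly l t > M \<Longrightarrow> t = (if t \<ge> 0 then \<tau>1 (poly l t) else \<tau>2 (poly l t))"
    by (rule poly_even_inverse_branches[OF l]) blast
  \<comment> \<open>The branches exist only above the level \<open>M\<close>; \<open>\<theta>\<close> freezes the affine map below the level \<open>M + 1\<close>.\<close>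
  define \<theta> where "\<theta> y = M + 1 + (y - (M + 1)) * smooth_step (y - (M + 1))" for y
  have \<theta>_gt: "\<theta> y > M" for y
  proof (cases "y \<le> M + 1")
    case True
    then show ?thesis by (simp add: \<theta>_def smooth_step_0)
  next
    case False
    then have "(y - (M + 1)) * smooth_step (y - (M + 1)) \<ge> 0"
      using smooth_step_bounds(1) by (intro mult_nonneg_nonneg) auto
    then show ?thesis by (simp add: \<theta>_def)
  qed
  have \<theta>_id: "\<theta> y = y" if "y \<ge> M + 2" for y using that by (simp add: \<theta>_def smooth_step_1)
  have \<theta>_smooth: "smooth_on UNIV \<theta>"
    unfolding \<theta>_def[abs_def] by (intro smooth_intros open_UNIV)
  define u1 u2 where "u1 y = \<tau>1 (\<theta> y)" and "u2 y = \<tau>2 (\<theta> y)" for y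
  have u_smooth: "smooth_on UNIV u1" "smooth_on UNIV u2"
    unfolding u1_def[abs_def] u2_def[abs_def]
    by (rule smooth_on_compose[OF \<tau>(1) \<theta>_smooth] smooth_on_compose[OF \<tau>(2) \<theta>_smooth];
        use \<theta>_gt in auto)+
  have u_sign: "u2 y < 0" "0 < u1 y" and lu: "poly l (u1 y) = poly l (u2 y)" for y
    using \<tau>(3)[OF \<theta>_gt[of y]] by (auto simp: u1_def u2_def)
  define p q where "p y = poly f (u1 y) - poly f (u2 y)" and "q y = poly h (u1 y) - poly h (u2 y)" for y
  have pq: "(p y)\<^sup>2 + (q y)\<^sup>2 \<noteq> 0" for y
    using inj[of "u1 y" "u2 y"] lu[of y] u_sign[of y] by (auto simp: p_def q_def sum_power2_eq_zero_iff)
  \<comment> \<open>The complex affine map has the factor \<open>a + \<i>b = (u1 - u2) / (p + \<i>q)\<close> and sends the point at \<open>u1\<close> to \<open>u1\<close>.\<close>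
  define a b where "a y = (u1 y - u2 y) * p y / ((p y)\<^sup>2 + (q y)\<^sup>2)"
    and "b y = - ((u1 y - u2 y) * q y / ((p y)\<^sup>2 + (q y)\<^sup>2))" for y
  define c d where "c y = u1 y - (a y * poly f (u1 y) - b y * poly h (u1 y))"
    and "d y = - (a y * poly h (u1 y) + b y * poly f (u1 y))" for y
  have pq_smooth: "smooth_on UNIV p" "smooth_on UNIV q"
    unfolding p_def[abs_def] q_def[abs_def] by (intro smooth_intros open_UNIV u_smooth)+
  have ab_smooth: "smooth_on UNIV a" "smooth_on UNIV b"
    unfolding a_def[abs_def] b_def[abs_def] by (intro smooth_intros open_UNIV u_smooth pq_smooth pq)+
  have cd_smooth: "smooth_on UNIV c" "smooth_on UNIV d"
    unfolding c_def[abs_def] d_def[abs_def] by (intro smooth_intros open_UNIV u_smooth ab_smooth)+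
  have ab: "(a y)\<^sup>2 + (b y)\<^sup>2 \<noteq> 0" for y
    using pq[of y] u_sign[of y] by (auto simp: a_def b_def sum_power2_eq_zero_iff)
  have at_u1: "a y * poly f (u1 y) - b y * poly h (u1 y) + c y = u1 y"
    "a y * poly h (u1 y) + b y * poly f (u1 y) + d y = 0" for y
    by (simp_all add: c_def d_def)
  have abpq: "a y * p y - b y * q y = u1 y - u2 y" "a y * q y + b y * p y = 0" for y
  proof -
    have "a y * p y - b y * q y = (u1 y - u2 y) * ((p y)\<^sup>2 + (q y)\<^sup>2) / ((p y)\<^sup>2 + (q y)\<^sup>2)"
      unfolding a_def b_def by (simp add: power2_eq_square add_divide_distrib diff_divide_distrib algebra_simps)
    then show "a y * p y - b y * q y = u1 y - u2 y" using pq[of y] by (auto split: if_splits)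
    show "a y * q y + b y * p y = 0" by (simp add: a_def b_def)
  qed
  have at_u2: "a y * poly f (u2 y) - b y * poly h (u2 y) + c y = u2 y"
    "a y * poly h (u2 y) + b y * poly f (u2 y) + d y = 0" for y
    using at_u1[of y] abpq[of y] unfolding p_def q_def by (auto simp: algebra_simps)
  define \<Phi>1 :: "real^3 \<Rightarrow> real^3" where
    "\<Phi>1 x = vector [a (x $ 2) * x $ 1 - b (x $ 2) * x $ 3 + c (x $ 2), x $ 2,
       a (x $ 2) * x $ 3 + b (x $ 2) * x $ 1 + d (x $ 2)]" for x
  define \<Phi>2 :: "real^3 \<Rightarrow> real^3" where "\<Phi>2 x = x + (- poly l (x $ 1)) *\<^sub>R axis 2 1" for x
  have \<Phi>1: "ambient_isotopy_end \<Phi>1" unfolding \<Phi>1_def[abs_def]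
    by (rule ambient_isotopy_end_levelwise)
       (use ab in \<open>auto simp: sum_power2_eq_zero_iff intro!: smooth_on_continuous ab_smooth cd_smooth\<close>)
  have \<Phi>2: "ambient_isotopy_end \<Phi>2" unfolding \<Phi>2_def[abs_def]
    by (rule ambient_isotopy_end_shear) (auto simp: axis_def intro!: continuous_intros)
  have \<Phi>: "ambient_isotopy_end (\<lambda>x. \<Phi>2 (\<Phi>1 x))" by (rule ambient_isotopy_end_compose[OF \<Phi>1 \<Phi>2])
  define X Z where "X t = a (poly l t) * poly f t - b (poly l t) * poly h t + c (poly l t)"
    and "Z t = a (poly l t) * poly h t + b (poly l t) * poly f t + d (poly l t)" for t
  define K :: "real \<Rightarrow> real^3" where "K t = vector [poly f t, poly l t, poly h t]" for t
  define k where "k t = \<Phi>2 (\<Phi>1 (K t))" for t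
  have k_eq: "k t = vector [X t, poly l t - poly l (X t), Z t]" for t
    by (simp add: k_def K_def \<Phi>1_def \<Phi>2_def X_def Z_def vec3_eq_iff axis_def)
  obtain R where R: "\<And>t. \<bar>t\<bar> \<ge> R \<Longrightarrow> poly l t > M + 2"
    using poly_even_eventually_gt[OF l] by blast
  have ends: "k t = vector [t, 0, 0]" if "\<bar>t\<bar> \<ge> R" for t
  proof -
    have lt: "poly l t > M + 2" using R[OF that] .
    then have "\<theta> (poly l t) = poly l t" by (simp add: \<theta>_id)
    moreover have "t = (if t \<ge> 0 then \<tau>1 (poly l t) else \<tau>2 (poly l t))"
      using \<tau>(4) lt by simp
    ultimately have "t = u1 (poly l t) \<or> t = u2 (poly l t)"
      unfolding u1_def u2_def by metis
    then have "X t = t \<and> Z t = 0"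
    proof
      assume t: "t = u1 (poly l t)"
      show ?thesis using at_u1[of "poly l t"] unfolding t[symmetric] by (simp add: X_def Z_def)
    next
      assume t: "t = u2 (poly l t)"
      show ?thesis using at_u2[of "poly l t"] unfolding t[symmetric] by (simp add: X_def Z_def)
    qed
    then show ?thesis by (simp add: k_eq vec3_eq_iff)
  qed
  have comp_smooth: "smooth_on UNIV (\<lambda>t. e (poly l t))" if "smooth_on UNIV e" for e :: "real \<Rightarrow> real"
    by (intro smooth_on_compose_UNIV[OF that] smooth_intros open_UNIV)
  have XZ_smooth: "smooth_on UNIV X" "smooth_on UNIV Z"
    unfolding X_def[abs_def] Z_def[abs_def]
    by (intro smooth_intros comp_smooth ab_smooth cd_smooth open_UNIV)+
  have "proper_smooth_embedding k"
  proof (rule proper_smooth_embedding_curveI[OF _ _ _ ends])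
    show "smooth_on UNIV k" unfolding k_eq[abs_def]
      by (intro smooth_intros XZ_smooth open_UNIV)
    show "inj k"
    proof (rule injI)
      fix s t assume "k s = k t"
      then have "K s = K t"
        using ambient_isotopy_end_bij[OF \<Phi>] unfolding k_def bij_def inj_def by blast
      then show "s = t" using inj[of s t] by (simp add: K_def vec3_eq_iff)
    qed
    fix t
    show "\<exists>i. \<not> ((\<lambda>s. k s $ i) has_real_derivative 0) (at t)"
    proof (rule ccontr)
      assume "\<nexists>i. \<not> ((\<lambda>s. k s $ i) has_real_derivative 0) (at t)"
      then have zero: "((\<lambda>s. k s $ i) has_real_derivative 0) (at t)" for i by blast
      \<comment> \<open>The second component yields \<open>l' = 0\<close>, so the coefficients of the affine map are stationary at \<open>t\<close>.\<close>
      have X0: "(X has_real_derivative 0) (at t)" and Z0: "(Z has_real_derivative 0) (at t)"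
        and Y0: "((\<lambda>s. poly l s - poly l (X s)) has_real_derivative 0) (at t)"
        using zero[of 1] zero[of 2] zero[of 3] by (simp_all add: k_eq)
      have "((\<lambda>s. poly l (X s)) has_real_derivative poly (pderiv l) (X t) * 0) (at t)"
        by (rule DERIV_chain2[OF poly_DERIV X0])
      from DERIV_add[OF Y0 this] have "(poly l has_real_derivative 0) (at t)" by simp
      then have l0: "poly (pderiv l) t = 0" using DERIV_unique[OF poly_DERIV] by blast
      have comp0: "((\<lambda>s. e (poly l s)) has_real_derivative 0) (at t)"
        if e: "smooth_on UNIV e" for e :: "real \<Rightarrow> real"
      proof -
        obtain D where "(e has_real_derivative D) (at (poly l t))"
          using smooth_on_differentiable[OF e] real_differentiable_def by blast
        from DERIV_chain2[OF this poly_DERIV] show ?thesis using l0 by simp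
      qed
      have "(X has_real_derivative a (poly l t) * poly (pderiv f) t - b (poly l t) * poly (pderiv h) t) (at t)"
        unfolding X_def[abs_def]
        by (rule derivative_eq_intros refl comp0 ab_smooth cd_smooth poly_DERIV)+ simp
      then have x: "a (poly l t) * poly (pderiv f) t - b (poly l t) * poly (pderiv h) t = 0"
        using DERIV_unique X0 by blast
      have "(Z has_real_derivative a (poly l t) * poly (pderiv h) t + b (poly l t) * poly (pderiv f) t) (at t)"
        unfolding Z_def[abs_def]
        by (rule derivative_eq_intros refl comp0 ab_smooth cd_smooth poly_DERIV)+ simp
      then have z: "a (poly l t) * poly (pderiv h) t + b (poly l t) * poly (pderiv f) t = 0"
        using DERIV_unique Z0 by blast
      have "((a (poly l t))\<^sup>2 + (b (poly l t))\<^sup>2) * poly (pderiv f) t = 0"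
        "((a (poly l t))\<^sup>2 + (b (poly l t))\<^sup>2) * poly (pderiv h) t = 0"
        using x z by algebra+
      then show False using ab[of "poly l t"] reg[of t] l0 by (simp only: mult_eq_0_iff simp_thms)
    qed
  qed
  from long_knot_within_rescale[OF this ends \<delta>]
  obtain k' where "long_knot_within \<delta> k'" "equivalent_long_knots k k'" by blast
  moreover from this(2) have "equivalent_long_knots K k'"
    unfolding k_def[abs_def] by (rule equivalent_long_knots_ambient[OF \<Phi>])
  ultimately show ?thesis using that by (simp add: K_def[abs_def])
qed

text \<open>Adding a large even power of the nonconstant first coordinate to the second one makes the latter
  a polynomial of even degree with positive leading coefficient.\<close>

lemma polynomial_knot_tame_nonconstant:
  fixes f g h :: "real poly"
  assumes inj: "\<And>s t. poly f s = poly f t \<Longrightarrow> poly g s = poly g t \<Longrightarrow> poly h s = poly h t \<Longrightarrow> s = t"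
    and reg: "\<And>t. poly (pderiv f) t = 0 \<Longrightarrow> poly (pderiv g) t = 0 \<Longrightarrow> poly (pderiv h) t \<noteq> 0"
    and f: "degree f > 0" and \<delta>: "\<delta> > 0"
  obtains k where "long_knot_within \<delta> k"
    "equivalent_long_knots (\<lambda>t. vector [poly f t, poly g t, poly h t]) k"
proof -
  define N where "N = 2 * (degree g + 1)"
  define l where "l = g + f ^ N"
  have "f \<noteq> 0" using f by auto
  then have dN: "degree (f ^ N) = N * degree f" by (rule degree_power_eq)
  have "degree g < N" by (simp add: N_def)
  also have "N \<le> N * degree f" using f by simp
  finally have lt: "degree g < degree (f ^ N)" using dN by simp
  have l: "degree l > 0" "even (degree l)" "lead_coeff l > 0"
  proof -
    have d: "degree l = N * degree f" using degree_add_eq_right[OF lt] dN by (simp add: l_def)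
    then show "degree l > 0" "even (degree l)" using f by (auto simp: N_def)
    have "lead_coeff l = lead_coeff f ^ N"
      using lead_coeff_add_le[OF lt] by (simp add: l_def lead_coeff_power)
    moreover have "even N" by (simp add: N_def)
    ultimately show "lead_coeff l > 0" using \<open>f \<noteq> 0\<close> by (simp add: zero_less_power_eq)
  qed
  have "poly (pderiv l) t = poly (pderiv g) t + of_nat N * (poly f t ^ (N - 1) * poly (pderiv f) t)" for t
    by (simp add: l_def pderiv_add pderiv_power poly_power)
  then have reg': "poly (pderiv h) t \<noteq> 0" if "poly (pderiv f) t = 0" "poly (pderiv l) t = 0" for t
    using that reg by simp
  have inj': "s = t" if "poly f s = poly f t" "poly l s = poly l t" "poly h s = poly h t" for s t
    using inj[of s t] that by (simp add: l_def poly_power)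
  obtain k where k: "long_knot_within \<delta> k"
    "equivalent_long_knots (\<lambda>t. vector [poly f t, poly l t, poly h t]) k"
    using polynomial_knot_tame_even[OF inj' reg' l(1,3,2) \<delta>] by blast
  define \<Phi> :: "real^3 \<Rightarrow> real^3" where "\<Phi> x = x + ((x $ 1) ^ N) *\<^sub>R axis 2 1" for x
  have \<Phi>: "ambient_isotopy_end \<Phi>" unfolding \<Phi>_def[abs_def]
    by (rule ambient_isotopy_end_shear) (auto simp: axis_def intro!: continuous_intros)
  have "\<Phi> (vector [poly f t, poly g t, poly h t]) = vector [poly f t, poly l t, poly h t]" for t
    by (simp add: \<Phi>_def vec3_eq_iff axis_def l_def poly_power)
  then have "equivalent_long_knots (\<lambda>t. vector [poly f t, poly g t, poly h t]) k"
    using equivalent_long_knots_ambient[OF \<Phi>, of "\<lambda>t. vector [poly f t, poly g t, poly h t]" k] k(2)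
    by simp
  then show ?thesis using k(1) that by blast
qed

theorem polynomial_knot_tame:
  assumes "polynomial_knot K" and \<delta>: "\<delta> > 0"
  obtains k where "long_knot_within \<delta> k" "equivalent_long_knots K k"
proof -
  obtain f g h where K: "K = (\<lambda>t. vector [poly f t, poly g t, poly h t])" and e: "proper_smooth_embedding K"
    using assms unfolding polynomial_knot_def by blast
  have inj: "s = t" if "poly f s = poly f t" "poly g s = poly g t" "poly h s = poly h t" for s t
    using proper_smooth_embedding_curveD(3)[OF e] that by (simp add: K inj_def)
  have reg: "poly (pderiv h) t \<noteq> 0" if "poly (pderiv f) t = 0" "poly (pderiv g) t = 0" for t
  proof
    assume h: "poly (pderiv h) t = 0"
    have "((\<lambda>s. K s $ i) has_real_derivative 0) (at t)" for i
      using exhaust_3[of i] poly_DERIV[of f t] poly_DERIV[of g t] poly_DERIV[of h t] that h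
      by (auto simp: K)
    then show False using proper_smooth_embedding_curveD(2)[OF e] by blast
  qed
  note result = that
  show ?thesis
  proof (cases "degree f > 0")
    case True
    then show ?thesis
      using polynomial_knot_tame_nonconstant[OF inj reg True \<delta>] result K by blast
  next
    case False
    then have f': "poly f s = poly f t" "poly (pderiv f) t = 0" for s t
      by (auto elim!: degree_eq_zeroE simp: pderiv_pCons)
    \<comment> \<open>A shear adds a nonconstant coordinate to the constant first one.\<close>
    have shear: thesis if e: "degree e > 0" and i: "i \<noteq> 1" "\<And>t. K t $ i = poly e t"
      and e': "e = g \<or> e = h" for e i
    proof -
      define \<Phi> :: "real^3 \<Rightarrow> real^3" where "\<Phi> x = x + (x $ i) *\<^sub>R axis 1 1" for x
      have \<Phi>: "ambient_isotopy_end \<Phi>" unfolding \<Phi>_def[abs_def]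
        by (rule ambient_isotopy_end_shear) (use i in \<open>auto simp: axis_def intro!: continuous_intros\<close>)
      have d: "degree (f + e) > 0" using False e by (subst degree_add_eq_right) auto
      have inj': "s = t" if "poly (f + e) s = poly (f + e) t" "poly g s = poly g t" "poly h s = poly h t" for s t
        using inj[of s t] f'(1)[of s t] that by simp
      have reg': "poly (pderiv h) t \<noteq> 0" if "poly (pderiv (f + e)) t = 0" "poly (pderiv g) t = 0" for t
        using reg[OF f'(2)] that by simp
      obtain k where k: "long_knot_within \<delta> k"
        "equivalent_long_knots (\<lambda>t. vector [poly (f + e) t, poly g t, poly h t]) k"
        using polynomial_knot_tame_nonconstant[OF inj' reg' d \<delta>] by blast
      have "\<Phi> (K t) = vector [poly (f + e) t, poly g t, poly h t]" for t
        using i unfolding \<Phi>_def by (simp add: K vec3_eq_iff axis_def)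
      then have "equivalent_long_knots K k"
        using equivalent_long_knots_ambient[OF \<Phi>, of K k] k(2) by simp
      then show thesis using k(1) result by blast
    qed
    show ?thesis
    proof (cases "degree g > 0")
      case True
      then show ?thesis by (rule shear[of _ 2]) (auto simp: K)
    next
      case g: False
      have "degree h > 0"
      proof (rule ccontr)
        assume "\<not> degree h > 0"
        then have "poly h 0 = poly h 1" "poly g 0 = poly g 1"
          using g by (auto elim!: degree_eq_zeroE)
        then show False using inj[OF f'(1)[of 0 1]] by simp
      qed
      then show ?thesis by (rule shear[of _ 3]) (auto simp: K)
    qed
  qed
qed

section \<open>The spun plane and its bent half\<close>

text \<open>The height of the plane over \<open>(p, q)\<close> is \<open>q * bend (p\<^sup>2 + q\<^sup>2)\<close> away from the knot. In the middle range
  the factor is linear with its zero at \<open>4\<close>, which makes \<open>q\<close> and \<open>4 - p\<^sup>2 - q\<^sup>2\<close> natural coordinates of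
  charts near the semicircle.\<close>

definition bend :: "real \<Rightarrow> real" where
  "bend r = (1 - smooth_step (r - 2) * (r / 4)) * (1 - smooth_step (r - 5))"

lemma bend_eq_1: "r \<le> 2 \<Longrightarrow> bend r = 1"
  and bend_eq_0: "r \<ge> 6 \<Longrightarrow> bend r = 0"
  and bend_middle: "3 \<le> r \<Longrightarrow> r \<le> 5 \<Longrightarrow> bend r = (4 - r) / 4"
  by (simp_all add: bend_def smooth_step_0 smooth_step_1 field_simps)

lemma bend_pos: 
  assumes "r < 4"
  shows "bend r > 0"
proof (cases "r \<le> 2")
  case True
  then show ?thesis by (simp add: bend_eq_1)
next
  case False
  then have "smooth_step (r - 2) * (r / 4) \<le> 1 * (r / 4)"
    using smooth_step_bounds by (intro mult_right_mono) auto
  then show ?thesis using assms by (simp add: bend_def smooth_step_0)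
qed

lemma smooth_on_bend [smooth_intros]:
  fixes f :: "'a::euclidean_space \<Rightarrow> real"
  shows "open S \<Longrightarrow> smooth_on S f \<Longrightarrow> smooth_on S (\<lambda>x. bend (f x))"
  unfolding bend_def by (intro smooth_intros) auto

lemma continuous_on_bend [continuous_intros]:
  "continuous_on S f \<Longrightarrow> continuous_on S (\<lambda>x. bend (f x))"
  by (rule continuous_on_compose2[OF smooth_on_continuous[OF smooth_on_bend[OF open_UNIV smooth_on_id[OF open_UNIV]]]])
     auto

definition sq_norm :: "real^2 \<Rightarrow> real" where
  "sq_norm u = (u $ 1)\<^sup>2 + (u $ 2)\<^sup>2"

lemma sq_norm_nonneg: "sq_norm u \<ge> 0"
  by (simp add: sq_norm_def)

lemma norm_eq_sqrt_sq_norm: "norm u = sqrt (sq_norm u)"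
  by (simp add: sq_norm_def norm_vec2)

definition half_disc :: "(real^2) set" where
  "half_disc = {u. u $ 2 \<ge> 0 \<and> sq_norm u \<le> 4}"

locale small_long_knot =
  fixes \<kappa> :: "real \<Rightarrow> real^3"
  assumes knot: "long_knot_within (1/8) \<kappa>"
begin

definition profile :: "real \<Rightarrow> real^3" where
  "profile s = \<kappa> (s - 1) + vector [1, 0, 0]"

text \<open>The radial factor is applied to both coordinates of the plane of rotation. As a function of
  the squared radius it extends smoothly over the centre, where its limit is \<open>1\<close>.\<close>

definition stretch :: "real \<Rightarrow> real" where
  "stretch r = (if r = 0 then 1 else profile (sqrt r) $ 1 / sqrt r)"

definition spun_plane :: "real^2 \<Rightarrow> real^4" where
  "spun_plane u = (let r = sq_norm u; e = u $ 2 * (1 - bend r) in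
     vector [stretch r * u $ 1, profile (sqrt r) $ 2 + e, stretch r * u $ 2 - e, profile (sqrt r) $ 3])"

lemma embedding: "proper_smooth_embedding \<kappa>"
  using knot by (simp add: long_knot_within_def)

lemma smooth_on_profile [smooth_intros]:
  fixes f :: "'a::euclidean_space \<Rightarrow> real"
  shows "open S \<Longrightarrow> smooth_on S f \<Longrightarrow> smooth_on S (\<lambda>x. profile (f x))"
  unfolding profile_def
  by (intro smooth_intros smooth_on_compose_UNIV[OF proper_smooth_embedding_curveD(1)[OF embedding]])

lemma continuous_on_profile: "continuous_on S profile"
  using smooth_on_continuous[OF smooth_on_profile[OF open_UNIV smooth_on_id[OF open_UNIV]]]
  by (rule continuous_on_subset) simp

lemma profile_standard: "\<bar>s - 1\<bar> \<ge> 1/8 \<Longrightarrow> profile s = vector [s, 0, 0]"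
  using knot by (simp add: profile_def long_knot_within_def vec3_eq_iff)

lemma profile_near: "\<bar>s - 1\<bar> \<le> 1/8 \<Longrightarrow> norm (profile s - vector [1, 0, 0]) \<le> 1/8"
  using knot by (simp add: profile_def long_knot_within_def)

lemma profile_comp_bounds:
  assumes "\<bar>s - 1\<bar> \<le> 1/8"
  shows "\<bar>profile s $ 1 - 1\<bar> \<le> 1/8" "\<bar>profile s $ 2\<bar> \<le> 1/8" "\<bar>profile s $ 3\<bar> \<le> 1/8"
proof -
  have "\<bar>(profile s - vector [1, 0, 0]) $ i\<bar> \<le> 1/8" for i
    using component_le_norm_cart[of "profile s - vector [1, 0, 0]" i] profile_near[OF assms] by linarith
  from this[of 1] this[of 2] this[of 3]
  show "\<bar>profile s $ 1 - 1\<bar> \<le> 1/8" "\<bar>profile s $ 2\<bar> \<le> 1/8" "\<bar>profile s $ 3\<bar> \<le> 1/8" by simp_all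
qed

lemma profile_1_pos: 
  assumes "s > 0"
  shows "profile s $ 1 > 0"
proof (cases "\<bar>s - 1\<bar> \<le> 1/8")
  case True
  then show ?thesis using profile_comp_bounds(1)[of s] by linarith
next
  case False
  then show ?thesis using profile_standard[of s] assms by simp
qed

lemma profile_0: "profile 0 = 0"
  using profile_standard[of 0] by (simp add: vec3_eq_iff)

lemma inj_profile: "profile s = profile t \<Longrightarrow> s = t"
  using injD[OF proper_smooth_embedding_curveD(3)[OF embedding], of "s - 1" "t - 1"]
  by (simp add: profile_def)

lemma profile_regular: "\<exists>i. \<not> ((\<lambda>s. profile s $ i) has_real_derivative 0) (at s)"
proof -
  obtain i where i: "\<not> ((\<lambda>s. \<kappa> s $ i) has_real_derivative 0) (at (s - 1))"
    using proper_smooth_embedding_curveD(2)[OF embedding] by blast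
  have "((\<lambda>s. \<kappa> s $ i) has_real_derivative 0) (at (s - 1))"
    if "((\<lambda>s. profile s $ i) has_real_derivative 0) (at s)"
  proof -
    have "((\<lambda>t. profile (t + 1) $ i) has_real_derivative 0) (at (s - 1))"
      using that DERIV_shift[of "\<lambda>s. profile s $ i" 0 "s - 1" 1] by simp
    from DERIV_diff[OF this DERIV_const[of "(vector [1,0,0] :: real^3) $ i"]]
    show ?thesis by (simp add: profile_def)
  qed
  then show ?thesis using i by blast
qed

lemma stretch_eq_1:
  assumes "\<bar>sqrt r - 1\<bar> \<ge> 1/8"
  shows "stretch r = 1"
  using assms profile_standard[of "sqrt r"] by (auto simp: stretch_def)

lemma stretch_pos: "r \<ge> 0 \<Longrightarrow> stretch r > 0"
  by (auto simp: stretch_def intro!: divide_pos_pos profile_1_pos)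

lemma stretch_mult_sqrt: "stretch r * sqrt r = profile (sqrt r) $ 1"
  by (simp add: stretch_def profile_0)

lemma sqrt_far: "r < 1/2 \<or> r > 3/2 \<Longrightarrow> \<bar>sqrt r - 1\<bar> \<ge> 1/8"
proof -
  assume "r < 1/2 \<or> r > 3/2"
  moreover have "sqrt r \<le> 7/8" if "r < 1/2"
    by (rule real_le_lsqrt) (use that in \<open>auto simp: power2_eq_square\<close>)
  moreover have "sqrt r \<ge> 9/8" if "r > 3/2"
    by (rule real_le_rsqrt) (use that in \<open>auto simp: power2_eq_square\<close>)
  ultimately show ?thesis by linarith
qed

lemma smooth_on_profile_sqrt: "smooth_on UNIV (\<lambda>r. profile (sqrt r) $ i)" if "i \<noteq> 1"
proof -
  have 1: "smooth_on {0<..} (\<lambda>r. profile (sqrt r) $ i)"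
    by (intro smooth_intros smooth_on_sqrt) auto
  have "smooth_on {..<1/2} (\<lambda>r. profile (sqrt r) $ i)"
  proof (rule smooth_on_cong[where f = "\<lambda>r. 0"])
    show "0 = profile (sqrt r) $ i" if "r \<in> {..<1/2}" for r
      using profile_standard[OF sqrt_far, of r] that exhaust_3[of i] \<open>i \<noteq> 1\<close> by auto
  qed (auto intro: smooth_intros)
  from smooth_on_Un[OF _ _ 1 this] show ?thesis
    by (rule smooth_on_subset) auto
qed

lemma smooth_on_stretch: "smooth_on UNIV stretch"
proof -
  have "smooth_on {0<..} (\<lambda>r. profile (sqrt r) $ 1 / sqrt r)"
    by (intro smooth_intros smooth_on_sqrt) auto
  then have 1: "smooth_on {0<..} stretch"
    by (rule smooth_on_cong) (auto simp: stretch_def)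
  have "smooth_on {..<1/2} stretch"
    by (rule smooth_on_cong[where f = "\<lambda>r. 1"])
       (use stretch_eq_1[OF sqrt_far] in \<open>auto intro: smooth_intros\<close>)
  from smooth_on_Un[OF _ _ 1 this] show ?thesis
    by (rule smooth_on_subset) auto
qed

lemma smooth_on_spun_plane: "smooth_on UNIV spun_plane"
proof -
  have sq: "smooth_on UNIV sq_norm"
    unfolding sq_norm_def[abs_def] by (intro smooth_intros open_UNIV)
  have s: "smooth_on UNIV (\<lambda>u. f (sq_norm u))" if "smooth_on UNIV f" for f :: "real \<Rightarrow> real"
    by (rule smooth_on_compose_UNIV[OF that sq open_UNIV])
  show ?thesis
    unfolding spun_plane_def[abs_def] Let_def
    by (intro smooth_intros open_UNIV sq s[OF smooth_on_stretch] s[OF smooth_on_profile_sqrt]) simp_all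
qed

lemma spun_plane_outer:
  assumes "\<bar>norm u - 1\<bar> \<ge> 1/8"
  shows "spun_plane u = vector [u $ 1, u $ 2 * (1 - bend (sq_norm u)), u $ 2 * bend (sq_norm u), 0]"
  using assms profile_standard[of "sqrt (sq_norm u)"] stretch_eq_1[of "sq_norm u"]
  by (simp add: spun_plane_def Let_def norm_eq_sqrt_sq_norm algebra_simps)

lemma spun_plane_core:
  assumes "sq_norm u \<le> 2"
  shows "spun_plane u = vector [stretch (sq_norm u) * u $ 1, profile (norm u) $ 2,
           stretch (sq_norm u) * u $ 2, profile (norm u) $ 3]"
  using assms by (simp add: spun_plane_def Let_def bend_eq_1 norm_eq_sqrt_sq_norm)

lemma spun_plane_core_radius:
  assumes "sq_norm u \<le> 2"
  shows "(spun_plane u $ 1)\<^sup>2 + (spun_plane u $ 3)\<^sup>2 = (profile (norm u) $ 1)\<^sup>2"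
proof -
  have "(stretch (sq_norm u) * u $ 1)\<^sup>2 + (stretch (sq_norm u) * u $ 2)\<^sup>2
      = (stretch (sq_norm u))\<^sup>2 * sq_norm u"
    by (simp add: sq_norm_def algebra_simps power_mult_distrib)
  also have "\<dots> = (stretch (sq_norm u) * sqrt (sq_norm u))\<^sup>2"
    by (simp add: power_mult_distrib sq_norm_nonneg)
  finally show ?thesis
    by (simp add: spun_plane_core[OF assms] stretch_mult_sqrt norm_eq_sqrt_sq_norm)
qed

lemma sq_norm_far: "sq_norm u < 1/2 \<or> sq_norm u > 3/2 \<Longrightarrow> \<bar>norm u - 1\<bar> \<ge> 1/8"
  using sqrt_far by (simp add: norm_eq_sqrt_sq_norm)

text \<open>Separates the spun part from the rest of the plane, where \<open>(x1, x2 + x3)\<close> is the parameter and so has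
  squared norm greater than \<open>2\<close>.\<close>

lemma spun_plane_core_bound:
  assumes "sq_norm u \<le> 2"
  shows "(spun_plane u $ 1)\<^sup>2 + (spun_plane u $ 2 + spun_plane u $ 3)\<^sup>2 \<le> 2"
proof (cases "\<bar>norm u - 1\<bar> \<ge> 1/8")
  case True
  then show ?thesis using assms spun_plane_outer[OF True]
    by (simp add: bend_eq_1 sq_norm_def)
next
  case False
  then have s: "\<bar>norm u - 1\<bar> \<le> 1/8" by simp
  define x y z where "x = spun_plane u $ 1" and "y = spun_plane u $ 2" and "z = spun_plane u $ 3"
  have y: "\<bar>y\<bar> \<le> 1/8" using profile_comp_bounds(2)[OF s] by (simp add: y_def spun_plane_core[OF assms])
  have a: "\<bar>profile (norm u) $ 1\<bar> \<le> 9/8" using profile_comp_bounds(1)[OF s] by linarith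
  have r: "x\<^sup>2 + z\<^sup>2 = (profile (norm u) $ 1)\<^sup>2"
    using spun_plane_core_radius[OF assms] by (simp add: x_def z_def)
  have "x\<^sup>2 + z\<^sup>2 \<le> (9/8)\<^sup>2" unfolding r using a by (subst abs_le_square_iff[symmetric]) simp
  moreover have z: "\<bar>z\<bar> \<le> 9/8"
  proof -
    have "\<bar>z\<bar> \<le> \<bar>profile (norm u) $ 1\<bar>" unfolding abs_le_square_iff r[symmetric] by simp
    then show ?thesis using a by linarith
  qed
  moreover have "\<bar>y * z\<bar> \<le> 1/8 * (9/8)" unfolding abs_mult using y z by (intro mult_mono) auto
  moreover have "y\<^sup>2 \<le> (1/8)\<^sup>2" using y by (subst abs_le_square_iff[symmetric]) simp
  moreover have "x\<^sup>2 + (y + z)\<^sup>2 = (x\<^sup>2 + z\<^sup>2) + y\<^sup>2 + 2 * (y * z)" by (simp add: power2_eq_square algebra_simps)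
  ultimately have "x\<^sup>2 + (y + z)\<^sup>2 \<le> 2" by (simp add: power2_eq_square abs_le_iff)
  then show ?thesis by (simp add: x_def y_def z_def)
qed

text \<open>For \<open>sq_norm u \<le> 2\<close> the radius in the plane of rotation and the two fixed coordinates determine the point
  of the profile, hence the norm of \<open>u\<close>, and then the direction of \<open>u\<close> can be read off. Elsewhere
  \<open>(x1, x2 + x3)\<close> recovers \<open>u\<close>.\<close>

lemma inj_spun_plane: "inj spun_plane"
proof (rule injI)
  have outer: "spun_plane u $ 1 = u $ 1" "spun_plane u $ 2 + spun_plane u $ 3 = u $ 2"
    if "\<not> sq_norm u \<le> 2" for u
    using spun_plane_outer[OF sq_norm_far, of u] that by (auto simp: algebra_simps)
  have mixed: False if uv: "spun_plane u = spun_plane v" and "sq_norm u \<le> 2" "\<not> sq_norm v \<le> 2" for u v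
    using spun_plane_core_bound[OF that(2)] outer[OF that(3)] that(3) uv by (simp add: sq_norm_def)
  fix u v assume eq: "spun_plane u = spun_plane v"
  consider "sq_norm u \<le> 2" "sq_norm v \<le> 2" | "\<not> sq_norm u \<le> 2" "\<not> sq_norm v \<le> 2"
    using mixed[of u v] mixed[of v u] eq by force
  then show "u = v"
  proof cases
    case 1
    have nonneg: "profile (norm w) $ 1 \<ge> 0" for w :: "real^2"
      using profile_1_pos[of "norm w"] profile_0 by (cases "w = 0") auto
    have "(profile (norm u) $ 1)\<^sup>2 = (profile (norm v) $ 1)\<^sup>2"
      using spun_plane_core_radius[OF 1(1)] spun_plane_core_radius[OF 1(2)] eq by simp
    then have "profile (norm u) $ 1 = profile (norm v) $ 1"
      using nonneg by (simp add: power2_eq_iff_nonneg)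
    moreover have "profile (norm u) $ 2 = profile (norm v) $ 2" "profile (norm u) $ 3 = profile (norm v) $ 3"
      using eq unfolding spun_plane_core[OF 1(1)] spun_plane_core[OF 1(2)] by (simp_all add: vec4_eq_iff)
    ultimately have "norm u = norm v" by (intro inj_profile) (simp add: vec3_eq_iff)
    then have sq: "sq_norm u = sq_norm v" by (simp add: norm_eq_sqrt_sq_norm)
    show ?thesis
      using eq stretch_pos[OF sq_norm_nonneg[of v]]
      unfolding spun_plane_core[OF 1(1)] spun_plane_core[OF 1(2)] sq
      by (simp add: vec4_eq_iff vec2_eq_iff)
  next
    case 2
    then show ?thesis using outer[of u] outer[of v] eq by (simp add: vec2_eq_iff)
  qed
qed

lemma spun_plane_at_infinity:
  assumes "norm u \<ge> 3"
  shows "spun_plane u = vector [u $ 1, u $ 2, 0, 0]"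
proof -
  have "3\<^sup>2 \<le> (norm u)\<^sup>2" using assms by (intro power_mono) auto
  then have "sq_norm u \<ge> 9" by (simp add: norm_eq_sqrt_sq_norm sq_norm_nonneg)
  then show ?thesis using spun_plane_outer[of u] assms by (simp add: bend_eq_0)
qed

text \<open>Where the plane is a graph, \<open>(x1, x2 + x3)\<close> is a left inverse that can be differentiated. In the spun part a
  kernel vector would have no radial component, because the profile is regular, and no angular
  one, because the radius is positive.\<close>

lemma spun_plane_immersion: "inj (frechet_derivative spun_plane (at u))"
proof -
  let ?D = "frechet_derivative spun_plane (at u)"
  have D: "(spun_plane has_derivative ?D) (at u)"
    using smooth_on_differentiable[OF smooth_on_spun_plane] frechet_derivative_works by blast
  have comp: "((\<lambda>w. spun_plane w $ i) has_derivative (\<lambda>v. ?D v $ i)) (at u)" for i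
    using bounded_linear.has_derivative[OF bounded_linear_vec_nth D] .
  have cont_sq: "continuous_on UNIV sq_norm"
    unfolding sq_norm_def[abs_def] by (intro continuous_intros)
  have "v = 0" if v: "?D v = 0" for v
  proof (cases "sq_norm u < 1/2 \<or> sq_norm u > 3/2")
    case True
    let ?S = "{w. sq_norm w < 1/2} \<union> {w. sq_norm w > 3/2}"
    have "open ?S" by (intro open_Un open_Collect_less cont_sq continuous_on_const)
    moreover have "u \<in> ?S" using True by simp
    ultimately have S: "open ?S" "u \<in> ?S" by blast+
    have "((\<lambda>w. w $ 1) has_derivative (\<lambda>v. ?D v $ 1)) (at u)"
      by (rule has_derivative_transform_within_open[OF comp S])
         (use spun_plane_outer[OF sq_norm_far] in auto)
    then have 1: "(\<lambda>v. ?D v $ 1) = (\<lambda>v. v $ 1)"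
      by (rule has_derivative_unique) (rule bounded_linear_imp_has_derivative[OF bounded_linear_vec_nth])
    have "((\<lambda>w. w $ 2) has_derivative (\<lambda>v. ?D v $ 2 + ?D v $ 3)) (at u)"
      by (rule has_derivative_transform_within_open[OF has_derivative_add[OF comp comp] S])
         (use spun_plane_outer[OF sq_norm_far] in \<open>auto simp: algebra_simps\<close>)
    then have 2: "(\<lambda>v. ?D v $ 2 + ?D v $ 3) = (\<lambda>v. v $ 2)"
      by (rule has_derivative_unique) (rule bounded_linear_imp_has_derivative[OF bounded_linear_vec_nth])
    show ?thesis using fun_cong[OF 1, of v] fun_cong[OF 2, of v] v by (simp add: vec2_eq_iff)
  next
    case False
    then have r: "1/2 \<le> sq_norm u" "sq_norm u \<le> 3/2" by auto
    \<comment> \<open>Restricted to the line through \<open>u\<close> in a direction \<open>v\<close> of the kernel, the profile at the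
      distance from the origin has derivative zero, so the distance itself has.\<close>
    define c where "c t = u + t *\<^sub>R v" for t
    define \<rho> where "\<rho> t = sqrt (sq_norm (c t))" for t
    have c0: "c 0 = u" by (simp add: c_def)
    have \<rho>0: "\<rho> 0 > 0" using r by (simp add: \<rho>_def c0)
    have dc: "(c has_derivative (\<lambda>t. t *\<^sub>R v)) (at 0)"
      unfolding c_def[abs_def] by (auto intro!: derivative_eq_intros)
    have dF: "((\<lambda>t. spun_plane (c t) $ i) has_real_derivative 0) (at 0)" for i
    proof -
      have "linear ?D" using D by (rule has_derivative_linear)
      then have z: "?D (t *\<^sub>R v) = 0" for t using v by (simp add: linear_scale)
      have "((\<lambda>t. spun_plane (c t) $ i) has_derivative (\<lambda>t. ?D (t *\<^sub>R v) $ i)) (at 0)"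
        using diff_chain_at[OF dc, of "\<lambda>w. spun_plane w $ i" "\<lambda>v. ?D v $ i"] comp[of i]
        by (simp add: c0 comp_def)
      then show ?thesis by (simp add: z has_field_derivative_def lambda_zero[symmetric])
    qed
    define d where "d = 2 * (u $ 1 * v $ 1 + u $ 2 * v $ 2)"
    have dsq: "((\<lambda>t. sq_norm (c t)) has_real_derivative d) (at 0)"
      unfolding sq_norm_def c_def d_def by (auto intro!: derivative_eq_intros)
    have d\<rho>: "(\<rho> has_real_derivative d / (2 * \<rho> 0)) (at 0)"
      unfolding \<rho>_def[abs_def]
      using DERIV_chain2[OF DERIV_real_sqrt dsq] r by (simp add: c0 field_simps)
    have ev: "\<exists>S. open S \<and> 0 \<in> S \<and> (\<forall>t\<in>S. sq_norm (c t) > 1/4 \<and> sq_norm (c t) < 2)"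
    proof (intro exI conjI ballI)
      have "continuous_on UNIV (\<lambda>t. sq_norm (c t))"
        unfolding sq_norm_def c_def by (intro continuous_intros)
      then show "open ({t. sq_norm (c t) > 1/4} \<inter> {t. sq_norm (c t) < 2})"
        by (intro open_Int open_Collect_less continuous_intros) auto
    qed (use r in \<open>auto simp: c0\<close>)
    then obtain S where S: "open S" "0 \<in> S" "\<And>t. t \<in> S \<Longrightarrow> sq_norm (c t) > 1/4"
       "\<And>t. t \<in> S \<Longrightarrow> sq_norm (c t) < 2" by blast
    have core: "spun_plane (c t) = vector [stretch (sq_norm (c t)) * c t $ 1, profile (\<rho> t) $ 2,
           stretch (sq_norm (c t)) * c t $ 2, profile (\<rho> t) $ 3]" if "t \<in> S" for t
      using spun_plane_core[of "c t"] S(4)[OF that] by (simp add: \<rho>_def norm_eq_sqrt_sq_norm)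
    define G where "G t = (spun_plane (c t) $ 1)\<^sup>2 + (spun_plane (c t) $ 3)\<^sup>2" for t
    have dG: "(G has_real_derivative 0) (at 0)"
      unfolding G_def[abs_def] by (rule derivative_eq_intros dF refl)+ simp
    have G0: "G 0 > 0"
      using spun_plane_core_radius[of u] r profile_1_pos[OF \<rho>0]
      by (simp add: G_def c0 \<rho>_def norm_eq_sqrt_sq_norm)
    have sqrtG: "sqrt (G t) = profile (\<rho> t) $ 1" if "t \<in> S" for t
    proof -
      have "\<rho> t > 0" using S(3)[OF that] by (simp add: \<rho>_def)
      then show ?thesis using spun_plane_core_radius[of "c t"] S(4)[OF that] profile_1_pos[of "\<rho> t"]
        by (simp add: G_def \<rho>_def norm_eq_sqrt_sq_norm)
    qed
    have "((\<lambda>t. sqrt (G t)) has_real_derivative 0) (at 0)"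
      using DERIV_chain2[OF DERIV_real_sqrt[OF G0] dG] by simp
    then have profile1: "((\<lambda>t. profile (\<rho> t) $ 1) has_real_derivative 0) (at 0)"
      by (rule has_field_derivative_transform_within_open[OF _ S(1,2) sqrtG])
    have profile_i: "((\<lambda>t. profile (\<rho> t) $ i) has_real_derivative 0) (at 0)" for i
    proof -
      have "((\<lambda>t. profile (\<rho> t) $ 2) has_real_derivative 0) (at 0)"
        by (rule has_field_derivative_transform_within_open[OF dF[of 2] S(1,2)]) (simp add: core)
      moreover have "((\<lambda>t. profile (\<rho> t) $ 3) has_real_derivative 0) (at 0)"
        by (rule has_field_derivative_transform_within_open[OF dF[of 4] S(1,2)]) (simp add: core)
      ultimately show ?thesis using profile1 exhaust_3[of i] by auto
    qed
    have "d = 0"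
    proof (rule ccontr)
      assume "d \<noteq> 0"
      have "((\<lambda>s. profile s $ i) has_real_derivative 0) (at (\<rho> 0))" for i
      proof -
        have "(\<lambda>s. profile s $ i) differentiable at (\<rho> 0)"
          by (rule smooth_on_differentiable[of UNIV]) (auto intro!: smooth_intros)
        then obtain a where a: "((\<lambda>s. profile s $ i) has_real_derivative a) (at (\<rho> 0))"
          using real_differentiable_def by blast
        from DERIV_chain2[OF this d\<rho>] have "a * (d / (2 * \<rho> 0)) = 0"
          using DERIV_unique profile_i by blast
        then show ?thesis using a \<open>d \<noteq> 0\<close> \<rho>0 by simp
      qed
      then show False using profile_regular by blast
    qed
    obtain m where "(stretch has_real_derivative m) (at (sq_norm u))"
      using smooth_on_differentiable[OF smooth_on_stretch] real_differentiable_def by blast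
    then have m: "((\<lambda>t. stretch (sq_norm (c t))) has_real_derivative 0) (at 0)"
      using DERIV_chain2[of stretch m "\<lambda>t. sq_norm (c t)" 0 d] dsq \<open>d = 0\<close> by (simp add: c0)
    have "v $ 1 = 0 \<and> v $ 2 = 0"
    proof -
      have c1: "((\<lambda>t. c t $ i) has_real_derivative v $ i) (at 0)" for i
        unfolding c_def by (auto intro!: derivative_eq_intros)
      have P: "((\<lambda>t. stretch (sq_norm (c t)) * c t $ i) has_real_derivative stretch (sq_norm u) * v $ i) (at 0)" for i
        using DERIV_mult[OF m c1[of i]] by (simp add: c0 mult.commute)
      have "((\<lambda>t. stretch (sq_norm (c t)) * c t $ 1) has_real_derivative 0) (at 0)"
        by (rule has_field_derivative_transform_within_open[OF dF[of 1] S(1,2)]) (simp add: core)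
      moreover have "((\<lambda>t. stretch (sq_norm (c t)) * c t $ 2) has_real_derivative 0) (at 0)"
        by (rule has_field_derivative_transform_within_open[OF dF[of 3] S(1,2)]) (simp add: core)
      ultimately have "stretch (sq_norm u) * v $ 1 = 0" "stretch (sq_norm u) * v $ 2 = 0"
        using DERIV_unique P by blast+
      then show ?thesis using stretch_pos[of "sq_norm u"] r by auto
    qed
    then show ?thesis by (simp add: vec2_eq_iff)
  qed
  then show ?thesis using linear_injective_0[OF has_derivative_linear[OF D]] by blast
qed

theorem knotted_plane_range: "knotted_plane (range spun_plane)"
  unfolding knotted_plane_def
proof (intro exI conjI allI impI)
  show "proper_smooth_embedding spun_plane"
    unfolding proper_smooth_embedding_def
  proof (intro conjI allI)
    show "smooth spun_plane" using smooth_on_spun_plane by (simp add: smooth_on_UNIV)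
    show "inj (frechet_derivative spun_plane (at u))" for u by (rule spun_plane_immersion)
    show "inj spun_plane" by (rule inj_spun_plane)
    show "proper_map euclidean euclidean spun_plane"
      by (rule proper_map_if_norm_ge[OF smooth_on_continuous[OF smooth_on_spun_plane], of 3])
         (simp add: spun_plane_at_infinity norm_vec2 norm_vec4)
  qed
  show "spun_plane u = vector [u $ 1, u $ 2, 0, 0]" if "3 \<le> norm u" for u
    using that by (rule spun_plane_at_infinity)
qed simp

end

section \<open>Local flatness from explicit charts\<close>

text \<open>The condition on a single point separates the choice of charts for the different parts of
  the disc.\<close>

definition flat_at :: "(real^4) set \<Rightarrow> real^4 \<Rightarrow> bool" where
  "flat_at X p \<longleftrightarrow> (\<exists>U V \<phi> \<psi>.
        openin (top_of_set half_space4) U \<and> p \<in> U \<and> openin (top_of_set half_space4) V \<and>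
        homeomorphism U V \<phi> \<psi> \<and> \<phi> ` (U \<inter> X) = V \<inter> {x. x $ 1 = 0 \<and> x $ 2 = 0})"

lemma locally_flat_in_half_space_iff: "locally_flat_in_half_space D \<longleftrightarrow> (\<forall>p\<in>D. flat_at D p)"
  by (simp add: locally_flat_in_half_space_def flat_at_def)

lemma flat_at_chart:
  assumes N: "open N" "p \<in> half_space4 \<inter> N" and M: "open M"
    and cont: "continuous_on (half_space4 \<inter> N) \<phi>" "continuous_on (half_space4 \<inter> M) \<psi>"
    and \<phi>: "\<And>x. x \<in> half_space4 \<inter> N \<Longrightarrow> \<phi> x \<in> half_space4 \<inter> M \<and> \<psi> (\<phi> x) = x"
    and \<psi>: "\<And>y. y \<in> half_space4 \<inter> M \<Longrightarrow> \<psi> y \<in> half_space4 \<inter> N \<and> \<phi> (\<psi> y) = y"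
    and X: "\<And>x. x \<in> half_space4 \<inter> N \<Longrightarrow> x \<in> X \<longleftrightarrow> \<phi> x $ 1 = 0 \<and> \<phi> x $ 2 = 0"
  shows "flat_at X p"
  unfolding flat_at_def
proof (intro exI conjI)
  show "openin (top_of_set half_space4) (half_space4 \<inter> N)"
    "openin (top_of_set half_space4) (half_space4 \<inter> M)"
    using N(1) M by (auto simp: openin_open)
  show "homeomorphism (half_space4 \<inter> N) (half_space4 \<inter> M) \<phi> \<psi>"
    by (rule homeomorphismI[OF cont]) (use \<phi> \<psi> in auto)
  show "\<phi> ` (half_space4 \<inter> N \<inter> X) = half_space4 \<inter> M \<inter> {x. x $ 1 = 0 \<and> x $ 2 = 0}"
  proof (intro equalityI subsetI)
    fix y assume "y \<in> \<phi> ` (half_space4 \<inter> N \<inter> X)"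
    then obtain x where "x \<in> half_space4 \<inter> N" "x \<in> X" "y = \<phi> x" by blast
    then show "y \<in> half_space4 \<inter> M \<inter> {x. x $ 1 = 0 \<and> x $ 2 = 0}"
      using \<phi>[of x] X[of x] by simp
  next
    fix y assume y: "y \<in> half_space4 \<inter> M \<inter> {x. x $ 1 = 0 \<and> x $ 2 = 0}"
    then have "\<psi> y \<in> half_space4 \<inter> N" "\<phi> (\<psi> y) = y" using \<psi>[of y] by auto
    moreover from this have "\<psi> y \<in> X" using X[of "\<psi> y"] y by simp
    ultimately show "y \<in> \<phi> ` (half_space4 \<inter> N \<inter> X)" by (metis IntI imageI)
  qed
qed (use N in auto)

text \<open>Each part of the disc coincides locally with a simpler set, for which a chart is written down.\<close>

lemma flat_at_local:
  assumes "flat_at Y p" "open N" "p \<in> N" "X \<inter> N = Y \<inter> N"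
  shows "flat_at X p"
proof -
  obtain U V \<phi> \<psi> where U: "openin (top_of_set half_space4) U" "p \<in> U"
    and V: "openin (top_of_set half_space4) V" and h: "homeomorphism U V \<phi> \<psi>"
    and Y: "\<phi> ` (U \<inter> Y) = V \<inter> {x. x $ 1 = 0 \<and> x $ 2 = 0}"
    using assms(1) unfolding flat_at_def by blast
  have o: "openin (top_of_set U) (U \<inter> N)" using assms(2) by (auto simp: openin_open)
  show ?thesis unfolding flat_at_def
  proof (intro exI conjI)
    show "openin (top_of_set half_space4) (U \<inter> N)"
      using U(1) assms(2) by (rule openin_Int_open)
    show "openin (top_of_set half_space4) (\<phi> ` (U \<inter> N))"
      using homeomorphism_imp_open_map[OF h o] V by (rule openin_trans)
    show "homeomorphism (U \<inter> N) (\<phi> ` (U \<inter> N)) \<phi> \<psi>"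
      by (rule homeomorphism_of_subsets[OF h, of _ V]) auto
    have "inj_on \<phi> U" using h unfolding homeomorphism_def by (metis inj_on_inverseI)
    then have "\<phi> ` (U \<inter> N \<inter> Y) = \<phi> ` (U \<inter> N) \<inter> \<phi> ` (U \<inter> Y)"
      by (subst inj_on_image_Int[symmetric, of \<phi> U]) (auto intro: arg_cong[of _ _ "(`) \<phi>"])
    moreover have "U \<inter> N \<inter> X = U \<inter> N \<inter> Y" using assms(4) by blast
    moreover have "\<phi> ` (U \<inter> N) \<subseteq> V" using h unfolding homeomorphism_def by blast
    ultimately show "\<phi> ` (U \<inter> N \<inter> X) = \<phi> ` (U \<inter> N) \<inter> {x. x $ 1 = 0 \<and> x $ 2 = 0}"
      using Y by auto
  qed (use U assms in auto)
qed

subsection \<open>Graphs of height functions\<close>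

text \<open>The linear map \<open>(x1, x2, x3, x4) \<mapsto> (x1, x2 + x3, x3, x4)\<close> turns the surface into the graph of the height
  \<open>H\<close> over the planar region \<open>\<Omega>\<close>. If planar coordinates \<open>T = (v, w)\<close> describe \<open>\<Omega>\<close> as \<open>w \<ge> 0\<close>, and
  \<open>H\<close> is \<open>w\<close> times a positive factor, then after rescaling the height the graph is \<open>w = x3\<close>.\<close>

lemma flat_at_graph:
  fixes T T' :: "real \<times> real \<Rightarrow> real \<times> real" and H \<mu> :: "real \<times> real \<Rightarrow> real"
  assumes B: "open B" "open B'" and T: "continuous_on B T" "continuous_on B' T'"
    and TB: "\<And>z. z \<in> B \<Longrightarrow> T z \<in> B' \<and> T' (T z) = z" "\<And>z. z \<in> B' \<Longrightarrow> T' z \<in> B \<and> T (T' z) = z"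
    and \<mu>: "continuous_on B \<mu>" "\<And>z. z \<in> B \<Longrightarrow> \<mu> z > 0"
    and \<Omega>: "\<And>z. z \<in> B \<Longrightarrow> z \<in> \<Omega> \<longleftrightarrow> snd (T z) \<ge> 0"
    and H: "\<And>z. z \<in> B \<Longrightarrow> z \<in> \<Omega> \<Longrightarrow> H z = \<mu> z * snd (T z)"
    and X: "\<And>x. x \<in> X \<longleftrightarrow> (x $ 1, x $ 2 + x $ 3) \<in> \<Omega> \<and> x $ 3 = H (x $ 1, x $ 2 + x $ 3) \<and> x $ 4 = 0"
    and p: "p \<in> X" "(p $ 1, p $ 2 + p $ 3) \<in> B"
  shows "flat_at X p"
proof -
  define P where "P x = (x $ 1, x $ 2 + x $ 3)" for x :: "real^4"
  define Q where "Q y = (y $ 4, y $ 1 + y $ 3)" for y :: "real^4"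
  have contP: "continuous_on S P" and contQ: "continuous_on S Q" for S
    unfolding P_def[abs_def] Q_def[abs_def] by (intro continuous_intros)+
  define \<phi> :: "real^4 \<Rightarrow> real^4" where
    "\<phi> x = vector [snd (T (P x)) - x $ 3 / \<mu> (P x), x $ 4, x $ 3 / \<mu> (P x), fst (T (P x))]" for x
  define \<psi> :: "real^4 \<Rightarrow> real^4" where
    "\<psi> y = vector [fst (T' (Q y)), snd (T' (Q y)) - \<mu> (T' (Q y)) * y $ 3, \<mu> (T' (Q y)) * y $ 3, y $ 2]" for y
  have \<mu>0: "\<mu> z \<noteq> 0" if "z \<in> B" for z using \<mu>(2)[OF that] by simp
  show ?thesis
  proof (rule flat_at_chart[where N = "P -` B" and M = "Q -` B'" and \<phi> = \<phi> and \<psi> = \<psi>])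
    show "open (P -` B)" "open (Q -` B')"
      using open_vimage[OF B(1) contP] open_vimage[OF B(2) contQ] .
    have "P p \<in> B" "P p \<in> \<Omega>" "p $ 3 = H (P p)" using p X[of p] by (auto simp: P_def)
    then have "p $ 3 \<ge> 0" using H[of "P p"] \<Omega>[of "P p"] \<mu>(2)[of "P p"] by simp
    then show "p \<in> half_space4 \<inter> P -` B" using p by (simp add: half_space4_def P_def)
    have TP: "continuous_on (half_space4 \<inter> P -` B) (\<lambda>x. T (P x))"
      "continuous_on (half_space4 \<inter> P -` B) (\<lambda>x. \<mu> (P x))"
      by (rule continuous_on_compose2[OF T(1) contP] continuous_on_compose2[OF \<mu>(1) contP]; auto)+
    show "continuous_on (half_space4 \<inter> P -` B) \<phi>"
      unfolding \<phi>_def[abs_def] by (intro continuous_intros TP) (use \<mu>0 in auto)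
    have TQ: "continuous_on (half_space4 \<inter> Q -` B') (\<lambda>x. T' (Q x))"
      by (rule continuous_on_compose2[OF T(2) contQ]) auto
    have \<mu>Q: "continuous_on (half_space4 \<inter> Q -` B') (\<lambda>x. \<mu> (T' (Q x)))"
      by (rule continuous_on_compose2[OF \<mu>(1) TQ]) (use TB in auto)
    show "continuous_on (half_space4 \<inter> Q -` B') \<psi>"
      unfolding \<psi>_def[abs_def] by (intro continuous_intros TQ \<mu>Q)
    show "\<phi> x \<in> half_space4 \<inter> Q -` B' \<and> \<psi> (\<phi> x) = x" if x: "x \<in> half_space4 \<inter> P -` B" for x
    proof -
      have xB: "P x \<in> B" "x $ 3 \<ge> 0" using x by (auto simp: half_space4_def)
      have Q: "Q (\<phi> x) = T (P x)" by (simp add: Q_def \<phi>_def)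
      have "\<psi> (\<phi> x) = vector [fst (P x), snd (P x) - \<mu> (P x) * \<phi> x $ 3, \<mu> (P x) * \<phi> x $ 3, \<phi> x $ 2]"
        using TB(1)[OF xB(1)] by (simp add: \<psi>_def Q)
      also have "\<dots> = x" using \<mu>0[OF xB(1)] by (simp add: vec4_eq_iff \<phi>_def P_def)
      finally show ?thesis
        using xB \<mu>(2)[OF xB(1)] TB(1)[OF xB(1)] Q by (simp add: half_space4_def) (simp add: \<phi>_def)
    qed
    show "\<psi> y \<in> half_space4 \<inter> P -` B \<and> \<phi> (\<psi> y) = y" if y: "y \<in> half_space4 \<inter> Q -` B'" for y
    proof -
      have yB: "Q y \<in> B'" "y $ 3 \<ge> 0" using y by (auto simp: half_space4_def)
      have PB: "T' (Q y) \<in> B" using TB(2)[OF yB(1)] by simp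
      have P: "P (\<psi> y) = T' (Q y)" by (simp add: P_def \<psi>_def)
      have "\<phi> (\<psi> y) = vector [snd (Q y) - \<psi> y $ 3 / \<mu> (T' (Q y)), \<psi> y $ 4, \<psi> y $ 3 / \<mu> (T' (Q y)), fst (Q y)]"
        using TB(2)[OF yB(1)] by (simp add: \<phi>_def P)
      also have "\<dots> = y" using \<mu>0[OF PB] by (simp add: vec4_eq_iff \<psi>_def Q_def)
      finally show ?thesis
        using yB \<mu>(2)[OF PB] PB P by (simp add: half_space4_def) (simp add: \<psi>_def)
    qed
    show "x \<in> X \<longleftrightarrow> \<phi> x $ 1 = 0 \<and> \<phi> x $ 2 = 0" if x: "x \<in> half_space4 \<inter> P -` B" for x
    proof -
      have xB: "P x \<in> B" "x $ 3 \<ge> 0" using x by (auto simp: half_space4_def)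
      have m: "\<mu> (P x) > 0" using \<mu>(2) xB by blast
      have "x \<in> X \<longleftrightarrow> P x \<in> \<Omega> \<and> x $ 3 = H (P x) \<and> x $ 4 = 0" using X by (simp add: P_def)
      also have "\<dots> \<longleftrightarrow> snd (T (P x)) \<ge> 0 \<and> x $ 3 = \<mu> (P x) * snd (T (P x)) \<and> x $ 4 = 0"
        using \<Omega>[OF xB(1)] H[OF xB(1)] by auto
      also have "\<dots> \<longleftrightarrow> x $ 3 = \<mu> (P x) * snd (T (P x)) \<and> x $ 4 = 0"
        using m xB(2) by (auto simp: zero_le_mult_iff)
      also have "\<dots> \<longleftrightarrow> \<phi> x $ 1 = 0 \<and> \<phi> x $ 2 = 0"
        using m by (auto simp: \<phi>_def field_simps)
      finally show ?thesis .
    qed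
  qed
qed

text \<open>Where the boundary of \<open>\<Omega>\<close> has a corner, the height vanishes like \<open>a * b\<close> on a quadrant
  \<open>a, b \<ge> 0\<close>. On the quadrant \<open>straighten\<close> is the complex square, with imaginary part \<open>2 * a * b\<close>; outside,
  it maps the translates of the boundary of the quadrant along the diagonal to horizontal lines.\<close>

definition straighten :: "real \<times> real \<Rightarrow> real \<times> real" where
  "straighten z = (let m = min 0 (min (fst z) (snd z)); a = fst z - m; b = snd z - m in
     (a\<^sup>2 - b\<^sup>2, 2 * a * b + m))"

definition unstraighten :: "real \<times> real \<Rightarrow> real \<times> real" where
  "unstraighten z = (let v = fst z; w = snd z; n = sqrt (v\<^sup>2 + (max w 0)\<^sup>2) in
     (sqrt ((n + v) / 2) + min w 0, sqrt ((n - v) / 2) + min w 0))"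

lemma unstraighten_straighten: "unstraighten (straighten z) = z"
proof -
  define m a b where "m = min 0 (min (fst z) (snd z))" and "a = fst z - m" and "b = snd z - m"
  have ab: "a \<ge> 0" "b \<ge> 0" by (auto simp: a_def b_def m_def)
  have m: "m = 0 \<or> m < 0 \<and> a * b = 0" by (auto simp: m_def a_def b_def min_def)
  have S: "straighten z = (a\<^sup>2 - b\<^sup>2, 2 * a * b + m)"
    by (simp add: straighten_def Let_def m_def a_def b_def)
  have mx: "max (2 * a * b + m) 0 = 2 * a * b" and mn: "min (2 * a * b + m) 0 = m"
    using m ab by auto
  have "(a\<^sup>2 - b\<^sup>2)\<^sup>2 + (2 * a * b)\<^sup>2 = (a\<^sup>2 + b\<^sup>2)\<^sup>2"
    by (simp add: power2_eq_square algebra_simps)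
  then have n: "sqrt ((a\<^sup>2 - b\<^sup>2)\<^sup>2 + (2 * a * b)\<^sup>2) = a\<^sup>2 + b\<^sup>2" by simp
  have "unstraighten (straighten z) = (sqrt (a\<^sup>2) + m, sqrt (b\<^sup>2) + m)"
    unfolding S unstraighten_def Let_def fst_conv snd_conv mx mn n by simp
  then show ?thesis using ab by (simp add: a_def b_def)
qed

lemma straighten_unstraighten: "straighten (unstraighten z) = z"
proof -
  define v w where "v = fst z" and "w = snd z"
  define n where "n = sqrt (v\<^sup>2 + (max w 0)\<^sup>2)"
  define a b where "a = sqrt ((n + v) / 2)" and "b = sqrt ((n - v) / 2)"
  have "\<bar>v\<bar> \<le> n" unfolding n_def by (rule real_le_rsqrt) simp
  then have nv: "n + v \<ge> 0" "n - v \<ge> 0" by auto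
  then have a2: "a\<^sup>2 = (n + v) / 2" and b2: "b\<^sup>2 = (n - v) / 2" and ab: "a \<ge> 0" "b \<ge> 0"
    by (auto simp: a_def b_def)
  have "(2 * a * b)\<^sup>2 = (n + v) * (n - v)" by (simp add: power_mult_distrib a2 b2)
  also have "\<dots> = n\<^sup>2 - v\<^sup>2" by (simp add: power2_eq_square algebra_simps)
  also have "\<dots> = (max w 0)\<^sup>2" by (simp add: n_def)
  finally have w: "2 * a * b = max w 0" using ab by (simp add: power2_eq_iff_nonneg)
  have U: "unstraighten z = (a + min w 0, b + min w 0)"
    by (simp add: unstraighten_def Let_def v_def w_def n_def a_def b_def)
  have m: "min 0 (min (a + min w 0) (b + min w 0)) = min w 0"
  proof (cases "w \<ge> 0")
    case True
    then show ?thesis using ab by simp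
  next
    case False
    then have "a = 0 \<or> b = 0" using w by (simp add: max_def)
    then show ?thesis using ab False by auto
  qed
  have "straighten (unstraighten z) = (a\<^sup>2 - b\<^sup>2, 2 * a * b + min w 0)"
    unfolding U straighten_def Let_def fst_conv snd_conv m by simp
  also have "\<dots> = (v, w)" using w by (simp add: a2 b2 field_simps max_def min_def split: if_splits)
  finally show ?thesis by (simp add: v_def w_def)
qed

lemma snd_straighten_nonneg_iff: "snd (straighten z) \<ge> 0 \<longleftrightarrow> fst z \<ge> 0 \<and> snd z \<ge> 0"
  and snd_straighten: "fst z \<ge> 0 \<Longrightarrow> snd z \<ge> 0 \<Longrightarrow> snd (straighten z) = 2 * fst z * snd z"
  by (auto simp: straighten_def Let_def min_def mult_less_0_iff split: if_splits)

lemma continuous_on_straighten: "continuous_on S straighten" "continuous_on S unstraighten"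
  unfolding straighten_def[abs_def] unstraighten_def[abs_def] Let_def by (intro continuous_intros; simp)+

subsection \<open>Surfaces of revolution\<close>

text \<open>A chart of the profile curve in the coordinates \<open>(r, x2, x4)\<close>, with \<open>r\<close> the distance from the plane
  \<open>x1 = x3 = 0\<close>, becomes a chart of the surface by keeping a coordinate \<open>e\<close> along the
  circles of rotation.\<close>

lemma flat_at_revolution:
  fixes f g :: "real^3 \<Rightarrow> real^3" and e :: "real \<times> real \<Rightarrow> real" and i :: "real \<times> real \<Rightarrow> real \<times> real"
  assumes fg: "open N3" "open M3" "homeomorphism N3 M3 f g"
    and C: "\<And>y. y \<in> N3 \<Longrightarrow> y \<in> C \<longleftrightarrow> f y $ 1 = 0 \<and> f y $ 2 = 0"
    and Q: "open Q" "open Q'" and cont: "continuous_on Q e" "continuous_on Q' i"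
    and e: "\<And>x z. (x, z) \<in> Q \<Longrightarrow> z \<ge> 0 \<Longrightarrow>
        (sqrt (x\<^sup>2 + z\<^sup>2), e (x, z)) \<in> Q' \<and> e (x, z) \<ge> 0 \<and> i (sqrt (x\<^sup>2 + z\<^sup>2), e (x, z)) = (x, z)"
    and i: "\<And>r t. (r, t) \<in> Q' \<Longrightarrow> t \<ge> 0 \<Longrightarrow> i (r, t) \<in> Q \<and> snd (i (r, t)) \<ge> 0 \<and>
        sqrt ((fst (i (r, t)))\<^sup>2 + (snd (i (r, t)))\<^sup>2) = r \<and> e (i (r, t)) = t"
    and X: "\<And>x. x \<in> X \<longleftrightarrow> x $ 3 \<ge> 0 \<and> vector [sqrt ((x $ 1)\<^sup>2 + (x $ 3)\<^sup>2), x $ 2, x $ 4] \<in> C"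
    and p: "p $ 3 \<ge> 0" "(p $ 1, p $ 3) \<in> Q" "vector [sqrt ((p $ 1)\<^sup>2 + (p $ 3)\<^sup>2), p $ 2, p $ 4] \<in> N3"
  shows "flat_at X p"
proof -
  define c :: "real^4 \<Rightarrow> real^3" where "c x = vector [sqrt ((x $ 1)\<^sup>2 + (x $ 3)\<^sup>2), x $ 2, x $ 4]" for x
  define c' :: "real^4 \<Rightarrow> real^3" where "c' y = vector [y $ 1, y $ 2, y $ 4]" for y
  have contc: "continuous_on S c" and contc': "continuous_on S c'" for S
    unfolding c_def[abs_def] c'_def[abs_def] by (intro continuous_intros)+
  have cf: "continuous_on N3 f" and cg: "continuous_on M3 g"
    and f: "\<And>y. y \<in> N3 \<Longrightarrow> f y \<in> M3 \<and> g (f y) = y" and g: "\<And>y. y \<in> M3 \<Longrightarrow> g y \<in> N3 \<and> f (g y) = y"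
    using fg(3) unfolding homeomorphism_def by blast+
  define N where "N = c -` N3 \<inter> (\<lambda>x. (x $ 1, x $ 3)) -` Q"
  define M where "M = c' -` M3 \<inter> (\<lambda>y. (g (c' y) $ 1, y $ 3)) -` Q'"
  define \<phi> :: "real^4 \<Rightarrow> real^4" where
    "\<phi> x = vector [f (c x) $ 1, f (c x) $ 2, e (x $ 1, x $ 3), f (c x) $ 3]" for x
  define \<psi> :: "real^4 \<Rightarrow> real^4" where
    "\<psi> y = vector [fst (i (g (c' y) $ 1, y $ 3)), g (c' y) $ 2, snd (i (g (c' y) $ 1, y $ 3)), g (c' y) $ 3]" for y
  show ?thesis
  proof (rule flat_at_chart[where N = N and M = M and \<phi> = \<phi> and \<psi> = \<psi>])
    show "open N" unfolding N_def
      by (intro open_Int open_vimage[OF fg(1) contc] open_vimage[OF Q(1)] continuous_intros)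
    have cg': "continuous_on (c' -` M3) (\<lambda>y. g (c' y))"
      by (rule continuous_on_compose2[OF cg contc']) auto
    show "open M" unfolding M_def
      by (rule continuous_open_preimage[OF _ open_vimage[OF fg(2) contc'] Q(2)])
         (intro continuous_intros cg')
    show "p \<in> half_space4 \<inter> N" using p by (simp add: half_space4_def N_def c_def)
    have "continuous_on (half_space4 \<inter> N) (\<lambda>x. f (c x))"
      by (rule continuous_on_compose2[OF cf contc]) (auto simp: N_def)
    moreover have "continuous_on (half_space4 \<inter> N) (\<lambda>x. e (x $ 1, x $ 3))"
      by (rule continuous_on_compose2[OF cont(1)]) (auto simp: N_def intro!: continuous_intros)
    ultimately show "continuous_on (half_space4 \<inter> N) \<phi>"
      unfolding \<phi>_def[abs_def] by (intro continuous_intros)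
    have cg'': "continuous_on (half_space4 \<inter> M) (\<lambda>y. g (c' y))"
      by (rule continuous_on_subset[OF cg']) (auto simp: M_def)
    moreover have "continuous_on (half_space4 \<inter> M) (\<lambda>y. i (g (c' y) $ 1, y $ 3))"
      by (rule continuous_on_compose2[OF cont(2)], intro continuous_intros cg'') (auto simp: M_def)
    ultimately show "continuous_on (half_space4 \<inter> M) \<psi>"
      unfolding \<psi>_def[abs_def] by (intro continuous_intros)
    show "\<phi> x \<in> half_space4 \<inter> M \<and> \<psi> (\<phi> x) = x" if x: "x \<in> half_space4 \<inter> N" for x
    proof -
      have xN: "c x \<in> N3" "(x $ 1, x $ 3) \<in> Q" "x $ 3 \<ge> 0"
        using x by (auto simp: N_def half_space4_def)
      have "c' (\<phi> x) = f (c x)" by (simp add: c'_def \<phi>_def vec3_eq_iff)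
      then have g': "g (c' (\<phi> x)) = c x" "c' (\<phi> x) \<in> M3" using f[OF xN(1)] by auto
      have t: "\<phi> x $ 3 = e (x $ 1, x $ 3)" by (simp add: \<phi>_def)
      have r: "c x $ 1 = sqrt ((x $ 1)\<^sup>2 + (x $ 3)\<^sup>2)" by (simp add: c_def)
      note e' = e[OF xN(2,3), folded r t]
      have "\<psi> (\<phi> x) = x" unfolding \<psi>_def g' using e' by (simp add: vec4_eq_iff c_def)
      then show ?thesis using e' g' by (simp add: half_space4_def M_def)
    qed
    show "\<psi> y \<in> half_space4 \<inter> N \<and> \<phi> (\<psi> y) = y" if y: "y \<in> half_space4 \<inter> M" for y
    proof -
      define z where "z = g (c' y)"
      have yM: "c' y \<in> M3" "(z $ 1, y $ 3) \<in> Q'" "y $ 3 \<ge> 0"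
        using y by (auto simp: M_def half_space4_def z_def)
      note i' = i[OF yM(2,3)]
      have \<psi>y: "\<psi> y = vector [fst (i (z $ 1, y $ 3)), z $ 2, snd (i (z $ 1, y $ 3)), z $ 3]"
        by (simp add: \<psi>_def z_def)
      have cz: "c (\<psi> y) = z" using i' by (simp add: c_def \<psi>y vec3_eq_iff)
      have "f z = c' y" "z \<in> N3" using g[OF yM(1)] by (auto simp: z_def)
      moreover have "e (\<psi> y $ 1, \<psi> y $ 3) = y $ 3" "(\<psi> y $ 1, \<psi> y $ 3) \<in> Q" "\<psi> y $ 3 \<ge> 0"
        using i' by (auto simp: \<psi>y)
      ultimately show ?thesis
        by (simp add: \<phi>_def cz half_space4_def N_def vec4_eq_iff) (simp add: c'_def)
    qed
    show "x \<in> X \<longleftrightarrow> \<phi> x $ 1 = 0 \<and> \<phi> x $ 2 = 0" if x: "x \<in> half_space4 \<inter> N" for x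
      using x X[of x] C[of "c x"] by (simp add: N_def half_space4_def \<phi>_def) (simp add: c_def)
  qed
qed

lemma smooth_real_C1:
  fixes f :: "real \<Rightarrow> real"
  assumes "smooth_on UNIV f"
  obtains f' where "\<And>x. (f has_real_derivative f' x) (at x)" "continuous_on UNIV f'"
proof -
  let ?D = "\<lambda>x. frechet_derivative f (at x)"
  have "Ck_on (Suc 0) UNIV f" using assms by (simp add: smooth_on_def del: Ck_on.simps)
  then have D: "\<And>x. (f has_derivative ?D x) (at x)" and c: "continuous_on UNIV (\<lambda>x. ?D x 1)"
    using Ck_on_SucD[of 0 UNIV f] by auto
  have "?D x v = ?D x 1 * v" for x v
    using linear_scale[OF has_derivative_linear[OF D[of x]], of v 1] by simp
  then have "?D x = (*) (?D x 1)" for x by blast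
  then have "(f has_real_derivative ?D x 1) (at x)" for x
    using D[of x] unfolding has_field_derivative_def by metis
  then show ?thesis by (rule that[OF _ c])
qed

text \<open>By continuity the derivative has no zero near \<open>s\<close>, so the mean value theorem applies.\<close>

lemma smooth_real_locally_injective:
  fixes f :: "real \<Rightarrow> real"
  assumes "smooth_on UNIV f" "\<not> (f has_real_derivative 0) (at s)"
  obtains e where "e > 0" "inj_on f {s - e <..< s + e}"
proof -
  obtain f' where f': "\<And>x. (f has_real_derivative f' x) (at x)" "continuous_on UNIV f'"
    using smooth_real_C1[OF assms(1)] by blast
  have "f' s \<noteq> 0" using assms(2) f'(1)[of s] by auto
  moreover have "open {x. f' x \<noteq> 0}"
    by (intro open_Collect_neq f'(2) continuous_on_const)
  ultimately have "\<exists>e>0. ball s e \<subseteq> {x. f' x \<noteq> 0}"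
    using open_contains_ball_eq[of "{x. f' x \<noteq> 0}" s] by simp
  then obtain e where e: "e > 0" "ball s e \<subseteq> {x. f' x \<noteq> 0}" by blast
  have "inj_on f {s - e <..< s + e}"
  proof (rule linorder_inj_onI')
    fix x y assume xy: "x \<in> {s - e <..< s + e}" "y \<in> {s - e <..< s + e}" "x < y"
    obtain z where z: "x < z" "z < y" "f y - f x = (y - x) * f' z"
      using MVT2[OF xy(3), of f f'] f'(1) by blast
    have "z \<in> ball s e" using z xy by (auto simp: dist_real_def)
    then have "f' z \<noteq> 0" using e(2) by blast
    then show "f x \<noteq> f y" using z xy(3) by auto
  qed
  then show ?thesis using that e(1) by blast
qed

text \<open>Near a point where the \<open>l\<close>-th component of the velocity does not vanish, the translates of the curve
  in the directions of the other two axes fill a neighbourhood.\<close>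

lemma embedded_curve_chart:
  fixes A :: "real \<Rightarrow> real^3"
  assumes A: "smooth_on UNIV A" "inj A" and closed: "\<And>S. closed S \<Longrightarrow> closed (A ` S)"
    and reg: "\<exists>i. \<not> ((\<lambda>s. A s $ i) has_real_derivative 0) (at s0)"
  obtains N M :: "(real^3) set" and f g where "open N" "open M" "homeomorphism N M f g" "A s0 \<in> N"
    "\<And>y. y \<in> N \<Longrightarrow> y \<in> range A \<longleftrightarrow> f y $ 1 = 0 \<and> f y $ 2 = 0"
proof -
  obtain l where l: "\<not> ((\<lambda>s. A s $ l) has_real_derivative 0) (at s0)" using reg by blast
  obtain i j where ij: "i \<noteq> j" "i \<noteq> l" "j \<noteq> l" and all: "\<And>k. k = i \<or> k = j \<or> k = l"
  proof -
    consider "l = 1" | "l = 2" | "l = 3" using exhaust_3 by blast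
    then show ?thesis
    proof cases
      case 1 then show ?thesis using that[of 2 3] exhaust_3 by auto
    next
      case 2 then show ?thesis using that[of 1 3] exhaust_3 by auto
    next
      case 3 then show ?thesis using that[of 1 2] exhaust_3 by auto
    qed
  qed
  obtain e where e: "e > 0" "inj_on (\<lambda>s. A s $ l) {s0 - e <..< s0 + e}"
    by (rule smooth_real_locally_injective[OF _ l]) (auto intro!: smooth_intros A)
  define I where "I = {s0 - e <..< s0 + e}"
  define G :: "real^3 \<Rightarrow> real^3" where
    "G z = A (z $ 3) + (z $ 1) *\<^sub>R axis i 1 + (z $ 2) *\<^sub>R axis j 1" for z
  define P where "P = {z :: real^3. z $ 3 \<in> I}"
  have contA: "continuous_on S A" for S
    using continuous_on_subset[OF smooth_on_continuous[OF A(1)]] by simp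
  have contG: "continuous_on S G" for S
    unfolding G_def[abs_def] by (intro continuous_intros continuous_on_compose2[OF contA[of UNIV]]) auto
  have Gk: "G z $ l = A (z $ 3) $ l" "G z $ i = A (z $ 3) $ i + z $ 1" "G z $ j = A (z $ 3) $ j + z $ 2" for z
    using ij by (auto simp: G_def axis_def)
  have "open P" unfolding P_def I_def greaterThanLessThan_iff
    by (intro open_Collect_conj open_Collect_less continuous_intros)
  have injG: "inj_on G P"
  proof (rule inj_onI)
    fix z w assume zw: "z \<in> P" "w \<in> P" "G z = G w"
    then have "z $ 3 = w $ 3"
      using Gk(1)[of z] Gk(1)[of w] e(2) by (auto simp: P_def I_def inj_on_def)
    then show "z = w" using Gk(2,3)[of z] Gk(2,3)[of w] zw(3) by (simp add: vec3_eq_iff)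
  qed
  have "open (G ` P)" by (rule invariance_of_domain[OF contG \<open>open P\<close> injG])
  obtain g where hom: "homeomorphism P (G ` P) G g"
    using invariance_of_domain_homeomorphism[OF \<open>open P\<close> contG _ injG] by auto
  define N where "N = G ` P - A ` (- I)"
  have "closed (- I)" unfolding I_def by (intro closed_Compl open_greaterThanLessThan)
  then have "open N" unfolding N_def using \<open>open (G ` P)\<close> closed by (intro open_Diff) auto
  define M where "M = P \<inter> G -` N"
  have "open M" unfolding M_def by (rule continuous_open_preimage[OF contG \<open>open P\<close> \<open>open N\<close>])
  have h: "homeomorphism N M g G"
    by (rule homeomorphism_symD, rule homeomorphism_of_subsets[OF hom]) (auto simp: M_def N_def)
  have G0: "G (vector [0, 0, s]) = A s" for s by (simp add: G_def)
  have s0: "A s0 \<in> N"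
  proof -
    have "vector [0, 0, s0] \<in> P" using e(1) by (simp add: P_def I_def)
    then have "A s0 \<in> G ` P" using G0[of s0] by (metis imageI)
    moreover have "A s0 \<notin> A ` (- I)" using inj_image_mem_iff[OF A(2)] e(1) by (simp add: I_def)
    ultimately show ?thesis by (simp add: N_def)
  qed
  have "y \<in> range A \<longleftrightarrow> g y $ 1 = 0 \<and> g y $ 2 = 0" if y: "y \<in> N" for y
  proof
    assume "y \<in> range A"
    then obtain s where s: "y = A s" by blast
    then have "s \<in> I" using y by (auto simp: N_def)
    then have "vector [0, 0, s] \<in> P" by (simp add: P_def)
    then have "g (G (vector [0, 0, s])) = vector [0, 0, s]"
      using hom by (simp add: homeomorphism_def)
    then show "g y $ 1 = 0 \<and> g y $ 2 = 0" by (simp add: G0 s)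
  next
    assume *: "g y $ 1 = 0 \<and> g y $ 2 = 0"
    have "y = G (g y)" using h y by (simp add: homeomorphism_def)
    also have "\<dots> = A (g y $ 3)" using * by (simp add: G_def)
    finally show "y \<in> range A" by blast
  qed
  from that[OF \<open>open N\<close> \<open>open M\<close> h s0 this] show ?thesis .
qed

section \<open>The disc\<close>

lemma half_disc_eq: "half_disc = {u. u $ 2 \<ge> 0} \<inter> cball 0 2"
proof -
  have "sq_norm u \<le> 4 \<longleftrightarrow> norm u \<le> 2" for u
    using real_sqrt_le_iff[of "sq_norm u" 4] unfolding norm_eq_sqrt_sq_norm real_sqrt_four by (rule sym)
  then show ?thesis unfolding half_disc_def by (intro set_eqI) simp
qed

lemma compact_half_disc: "compact half_disc"
  unfolding half_disc_eq
  by (intro closed_Int_compact compact_cball closed_Collect_le continuous_intros)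

lemma convex_half_disc: "convex half_disc"
proof -
  have "convex {u :: real^2. u $ 2 \<ge> 0}" by (auto simp: convex_def)
  then show ?thesis unfolding half_disc_eq by (intro convex_Int convex_cball)
qed

lemma interior_half_disc: "interior half_disc = {u. u $ 2 > 0} \<inter> ball 0 2"
  unfolding half_disc_eq interior_Int by simp

text \<open>Any homeomorphism with the round disc will do: by invariance of domain it maps interior to interior, hence
  boundary to boundary.\<close>

lemma half_disc_homeomorphism:
  obtains g g' where "homeomorphism (cball (0 :: real^2) 1) half_disc g g'"
    "g ` sphere 0 1 = half_disc - interior half_disc" "g ` ball 0 1 \<subseteq> interior half_disc"
proof -
  have "vector [0, 1] \<in> interior half_disc"
    by (simp add: interior_half_disc norm_vec2)
  then have "half_disc homeomorphic cball (0 :: real^2) 1"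
    by (intro homeomorphic_convex_compact_cball convex_half_disc compact_half_disc) auto
  then obtain g' g where h': "homeomorphism half_disc (cball (0 :: real^2) 1) g' g"
    unfolding homeomorphic_def by blast
  then have h: "homeomorphism (cball (0 :: real^2) 1) half_disc g g'" by (rule homeomorphism_symD)
  have inj: "inj_on g (cball 0 1)" "inj_on g' half_disc"
    using h unfolding homeomorphism_def by (metis inj_on_inverseI)+
  have 1: "g \<in> interior (cball 0 1) \<rightarrow> interior half_disc"
    using continuous_image_subset_interior[OF homeomorphism_cont1[OF h] inj(1)] h
    by (simp add: homeomorphism_def)
  have 2: "g' \<in> interior half_disc \<rightarrow> interior (cball 0 1)"
    using continuous_image_subset_interior[OF homeomorphism_cont2[OF h] inj(2)] h
    by (simp add: homeomorphism_def)
  have "g ` (cball 0 1 - interior (cball 0 1)) = half_disc - interior half_disc"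
  proof (intro equalityI subsetI)
    fix y assume "y \<in> g ` (cball 0 1 - interior (cball 0 1))"
    then obtain x where x: "x \<in> cball 0 1" "x \<notin> interior (cball 0 1)" "y = g x" by blast
    then have "g' y = x" "y \<in> half_disc" using h by (auto simp: homeomorphism_def)
    then show "y \<in> half_disc - interior half_disc" using 2 x(2) by auto
  next
    fix y assume y: "y \<in> half_disc - interior half_disc"
    then have "g (g' y) = y" "g' y \<in> cball 0 1" using h by (auto simp: homeomorphism_def)
    moreover from this have "g' y \<notin> interior (cball 0 1)" using 1 y by force
    ultimately show "y \<in> g ` (cball 0 1 - interior (cball 0 1))" by (metis DiffI imageI)
  qed
  moreover have "cball 0 1 - interior (cball 0 1) = sphere (0 :: real^2) 1" by auto
  ultimately have "g ` sphere 0 1 = half_disc - interior half_disc" by simp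
  moreover have "g ` ball 0 1 \<subseteq> interior half_disc" using 1 by auto
  ultimately show ?thesis using that h by blast
qed

lemma mirror_mirror: "mirror (mirror k) = k"
  by (simp add: mirror_def fun_eq_iff vec3_eq_iff)

subsection \<open>The unknotted part\<close>

text \<open>Away from the spun knot, the disc is the graph of the height \<open>q * bend (p\<^sup>2 + q\<^sup>2)\<close> over the
  half-disc.\<close>

text \<open>The planar charts are functions on pairs of real numbers.\<close>

definition half_disc_pairs :: "(real \<times> real) set" where
  "half_disc_pairs = {z. snd z \<ge> 0 \<and> (fst z)\<^sup>2 + (snd z)\<^sup>2 \<le> 4}"

definition height :: "real \<times> real \<Rightarrow> real" where
  "height z = snd z * bend ((fst z)\<^sup>2 + (snd z)\<^sup>2)"

definition bent_graph :: "(real^4) set" where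
  "bent_graph = {x. (x $ 1, x $ 2 + x $ 3) \<in> half_disc_pairs \<and>
     x $ 3 = height (x $ 1, x $ 2 + x $ 3) \<and> x $ 4 = 0}"

text \<open>Near \<open>(\<plusminus>2, 0)\<close> the half-disc is the quadrant where \<open>a = q\<close> and \<open>b = 4 - p\<^sup>2 - q\<^sup>2\<close> are nonnegative, and the height
  is \<open>a * b / 4\<close>, which is \<open>1/8\<close> of the second coordinate of \<open>straighten (a, b)\<close>.\<close>

lemma flat_at_bent_graph_corner:
  assumes p: "p \<in> bent_graph" "3 < (p $ 1)\<^sup>2 + (p $ 2 + p $ 3)\<^sup>2" and \<epsilon>: "\<epsilon> = 1 \<or> \<epsilon> = -1" "\<epsilon> * p $ 1 > 0"
  shows "flat_at bent_graph p"
proof -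
  define B where "B = {z :: real \<times> real. \<epsilon> * fst z > 0 \<and> 3 < (fst z)\<^sup>2 + (snd z)\<^sup>2 \<and> (fst z)\<^sup>2 + (snd z)\<^sup>2 < 5}"
  define W where "W = {z :: real \<times> real. \<bar>snd z\<bar> < 1 \<and> 0 < 4 - snd z - (fst z)\<^sup>2}"
  define h where "h z = (snd z, 4 - (fst z)\<^sup>2 - (snd z)\<^sup>2)" for z :: "real \<times> real"
  define h' where "h' z = (\<epsilon> * sqrt (4 - snd z - (fst z)\<^sup>2), fst z)" for z :: "real \<times> real"
  have \<epsilon>2: "\<epsilon>\<^sup>2 = 1" "\<epsilon> * \<epsilon> = 1" using \<epsilon>(1) by auto
  have oB: "open B" unfolding B_def
    by (intro open_Collect_conj open_Collect_less continuous_intros)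
  have oW: "open W" unfolding W_def
    by (intro open_Collect_conj open_Collect_less continuous_intros)
  have h: "h z \<in> W \<and> h' (h z) = z" if "z \<in> B" for z
  proof -
    have "\<epsilon> * \<bar>fst z\<bar> = fst z" using that \<epsilon> by (auto simp: B_def)
    then show ?thesis using that by (auto simp: B_def W_def h_def h'_def prod_eq_iff)
  qed
  have h': "h' z \<in> B \<and> h (h' z) = z" if "z \<in> W" for z
    using that \<epsilon>2 by (auto simp: B_def W_def h_def h'_def prod_eq_iff power_mult_distrib
        mult.assoc[symmetric])
  have hgt: "height z = 1/8 * snd (straighten (h z))" if z: "z \<in> B" "z \<in> half_disc_pairs" for z
  proof -
    have r: "3 \<le> (fst z)\<^sup>2 + (snd z)\<^sup>2" "(fst z)\<^sup>2 + (snd z)\<^sup>2 \<le> 4" "snd z \<ge> 0"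
      using z by (auto simp: B_def half_disc_pairs_def)
    then have "height z = snd z * ((4 - ((fst z)\<^sup>2 + (snd z)\<^sup>2)) / 4)"
      by (simp add: height_def bend_middle)
    moreover have "snd (straighten (h z)) = 2 * snd z * (4 - (fst z)\<^sup>2 - (snd z)\<^sup>2)"
      by (subst snd_straighten) (use r in \<open>auto simp: h_def\<close>)
    ultimately show ?thesis by (simp add: field_simps)
  qed
  have conth: "continuous_on S h" "continuous_on S h'" for S
    unfolding h_def[abs_def] h'_def[abs_def] by (intro continuous_intros)+
  show ?thesis
  proof (rule flat_at_graph[where B = B and B' = "unstraighten -` W" and T = "\<lambda>z. straighten (h z)"
        and T' = "\<lambda>z. h' (unstraighten z)" and \<mu> = "\<lambda>z. 1/8" and \<Omega> = half_disc_pairs and H = height])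
    show "open (unstraighten -` W)" by (rule open_vimage[OF oW continuous_on_straighten(2)])
    show "continuous_on B (\<lambda>z. straighten (h z))" "continuous_on (unstraighten -` W) (\<lambda>z. h' (unstraighten z))"
      by (rule continuous_on_compose2[OF continuous_on_straighten(1)[of UNIV] conth(1)]
          continuous_on_compose2[OF conth(2)[of UNIV] continuous_on_straighten(2)]; simp)+
    show "straighten (h z) \<in> unstraighten -` W \<and> h' (unstraighten (straighten (h z))) = z" if "z \<in> B" for z
      using h[OF that] by (simp add: unstraighten_straighten)
    show "h' (unstraighten z) \<in> B \<and> straighten (h (h' (unstraighten z))) = z" if "z \<in> unstraighten -` W" for z
      using h'[of "unstraighten z"] that by (simp add: straighten_unstraighten)
    show "z \<in> half_disc_pairs \<longleftrightarrow> snd (straighten (h z)) \<ge> 0" if "z \<in> B" for z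
      unfolding snd_straighten_nonneg_iff by (auto simp: half_disc_pairs_def h_def)
    show "(p $ 1, p $ 2 + p $ 3) \<in> B" using p \<epsilon> by (simp add: B_def bent_graph_def half_disc_pairs_def)
  qed (use oB hgt p in \<open>auto simp: bent_graph_def\<close>)
qed

text \<open>The height has the factor \<open>4 - p\<^sup>2 - q\<^sup>2\<close>, which replaces the coordinate \<open>q\<close> as long as \<open>q > 0\<close>.\<close>

lemma flat_at_bent_graph_top:
  assumes p: "p \<in> bent_graph" "3 < (p $ 1)\<^sup>2 + (p $ 2 + p $ 3)\<^sup>2" "p $ 2 + p $ 3 > 0"
  shows "flat_at bent_graph p"
proof -
  define B where "B = {z :: real \<times> real. snd z > 0 \<and> 3 < (fst z)\<^sup>2 + (snd z)\<^sup>2 \<and> (fst z)\<^sup>2 + (snd z)\<^sup>2 < 5}"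
  define W where "W = {z :: real \<times> real. \<bar>snd z\<bar> < 1 \<and> 0 < 4 - snd z - (fst z)\<^sup>2}"
  show ?thesis
  proof (rule flat_at_graph[where B = B and B' = W and T = "\<lambda>z. (fst z, 4 - (fst z)\<^sup>2 - (snd z)\<^sup>2)"
        and T' = "\<lambda>z. (fst z, sqrt (4 - snd z - (fst z)\<^sup>2))" and \<mu> = "\<lambda>z. snd z / 4"
        and \<Omega> = half_disc_pairs and H = height])
    show "open B" "open W" unfolding B_def W_def
      by (intro open_Collect_conj open_Collect_less continuous_intros)+
    show "height z = snd z / 4 * snd (fst z, 4 - (fst z)\<^sup>2 - (snd z)\<^sup>2)"
      if "z \<in> B" "z \<in> half_disc_pairs" for z
    proof -
      have "bend ((fst z)\<^sup>2 + (snd z)\<^sup>2) = (4 - ((fst z)\<^sup>2 + (snd z)\<^sup>2)) / 4"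
        by (rule bend_middle) (use that in \<open>auto simp: B_def half_disc_pairs_def\<close>)
      then show ?thesis unfolding height_def by (simp only: fst_conv snd_conv) (simp add: field_simps)
    qed
    show "(p $ 1, p $ 2 + p $ 3) \<in> B" using p by (simp add: B_def bent_graph_def half_disc_pairs_def)
  qed (use p in \<open>auto simp: B_def W_def half_disc_pairs_def prod_eq_iff bent_graph_def intro!: continuous_intros\<close>)
qed

lemma flat_at_bent_graph_interior:
  assumes p: "p \<in> bent_graph" "(p $ 1)\<^sup>2 + (p $ 2 + p $ 3)\<^sup>2 < 4"
  shows "flat_at bent_graph p"
proof -
  define B where "B = {z :: real \<times> real. (fst z)\<^sup>2 + (snd z)\<^sup>2 < 4}"
  show ?thesis
  proof (rule flat_at_graph[where B = B and B' = B and T = "\<lambda>z. z" and T' = "\<lambda>z. z"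
        and \<mu> = "\<lambda>z. bend ((fst z)\<^sup>2 + (snd z)\<^sup>2)" and \<Omega> = half_disc_pairs and H = height])
    show "open B" "open B" unfolding B_def
      by (intro open_Collect_less continuous_intros)+
  qed (use p in \<open>auto simp: B_def half_disc_pairs_def height_def bend_pos bent_graph_def intro!: continuous_intros\<close>)
qed

lemma flat_at_bent_graph: 
  assumes "p \<in> bent_graph"
  shows "flat_at bent_graph p"
proof -
  consider "(p $ 1)\<^sup>2 + (p $ 2 + p $ 3)\<^sup>2 < 4" | "3 < (p $ 1)\<^sup>2 + (p $ 2 + p $ 3)\<^sup>2" by linarith
  then show ?thesis
  proof cases
    case 1
    then show ?thesis by (rule flat_at_bent_graph_interior[OF assms])
  next
    case 2
    have "p $ 2 + p $ 3 \<ge> 0" using assms by (simp add: bent_graph_def half_disc_pairs_def)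
    then consider "p $ 2 + p $ 3 > 0" | "p $ 1 > 0" | "p $ 1 < 0"
      using 2 by (cases "p $ 2 + p $ 3 = 0"; cases "p $ 1 = 0") force+
    then show ?thesis
      using flat_at_bent_graph_top[OF assms 2] flat_at_bent_graph_corner[OF assms 2, of 1]
        flat_at_bent_graph_corner[OF assms 2, of "-1"] by cases auto
  qed
qed

context small_long_knot
begin

subsection \<open>The spun knot\<close>

definition half_spin :: "(real^4) set" where
  "half_spin = {x. x $ 3 \<ge> 0 \<and> vector [sqrt ((x $ 1)\<^sup>2 + (x $ 3)\<^sup>2), x $ 2, x $ 4] \<in> range profile}"

lemma closed_profile_image: "closed S \<Longrightarrow> closed (profile ` S)"
proof -
  have "proper_map euclidean euclidean profile"
  proof (rule proper_map_if_norm_ge[OF continuous_on_profile, of 2])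
    fix s :: real assume "2 \<le> norm s"
    then have "\<bar>s - 1\<bar> \<ge> 1/8" by (simp add: abs_if split: if_splits)
    then show "norm s \<le> norm (profile s)" by (simp add: profile_standard norm_vec3)
  qed
  then show "closed S \<Longrightarrow> closed (profile ` S)"
    by (simp add: proper_map_def closed_map_def)
qed

text \<open>Where \<open>x1 \<noteq> 0\<close>, the height \<open>x3\<close> itself is the coordinate along the circles, which preserves the
  boundary of the half-space. Near \<open>x1 = 0\<close> the coordinate is \<open>exp x1\<close>: the
  exponential keeps it in the interior of the half-space.\<close>

lemma flat_at_half_spin:
  assumes p: "p $ 3 \<ge> 0" "(p $ 1)\<^sup>2 + (p $ 3)\<^sup>2 > 0"
    and s0: "vector [sqrt ((p $ 1)\<^sup>2 + (p $ 3)\<^sup>2), p $ 2, p $ 4] = profile s0"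
  shows "flat_at half_spin p"
proof -
  have sm: "smooth_on UNIV profile" using smooth_on_profile[OF open_UNIV smooth_on_id[OF open_UNIV]] .
  have inj: "inj profile" by (rule injI) (rule inj_profile)
  obtain N M :: "(real^3) set" and f g :: "real^3 \<Rightarrow> real^3" where NM: "open N" "open M" "homeomorphism N M f g" "profile s0 \<in> N"
    and C: "\<And>y. y \<in> N \<Longrightarrow> y \<in> range profile \<longleftrightarrow> f y $ 1 = 0 \<and> f y $ 2 = 0"
    by (rule embedded_curve_chart[OF sm inj _ profile_regular[of s0]], erule closed_profile_image) blast
  note rev = flat_at_revolution[OF NM(1-3) C, where X = half_spin and p = p]
  have X: "x \<in> half_spin \<longleftrightarrow> x $ 3 \<ge> 0 \<and> vector [sqrt ((x $ 1)\<^sup>2 + (x $ 3)\<^sup>2), x $ 2, x $ 4] \<in> range profile" for x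
    by (simp add: half_spin_def)
  have side: "flat_at half_spin p" if \<epsilon>: "\<epsilon> = 1 \<or> \<epsilon> = -1" "\<epsilon> * p $ 1 > 0" for \<epsilon>
  proof (rule rev[where Q = "{z. \<epsilon> * fst z > 0}" and Q' = "{z. \<bar>snd z\<bar> < fst z}" and e = snd
        and i = "\<lambda>z. (\<epsilon> * sqrt ((fst z)\<^sup>2 - (snd z)\<^sup>2), snd z)"])
    show "open {z :: real \<times> real. \<epsilon> * fst z > 0}" "open {z :: real \<times> real. \<bar>snd z\<bar> < fst z}"
      by (intro open_Collect_less continuous_intros)+
    fix x z :: real assume x: "(x, z) \<in> {z. \<epsilon> * fst z > 0}" "z \<ge> 0"
    then have "\<epsilon> * \<bar>x\<bar> = x" "x\<^sup>2 > 0" using \<epsilon>(1) by auto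
    moreover from this have "\<bar>z\<bar> < sqrt (x\<^sup>2 + z\<^sup>2)" by (intro real_less_rsqrt) simp
    ultimately show "(sqrt (x\<^sup>2 + z\<^sup>2), snd (x, z)) \<in> {z. \<bar>snd z\<bar> < fst z} \<and> snd (x, z) \<ge> 0 \<and>
      (\<epsilon> * sqrt ((fst (sqrt (x\<^sup>2 + z\<^sup>2), snd (x, z)))\<^sup>2 - (snd (sqrt (x\<^sup>2 + z\<^sup>2), snd (x, z)))\<^sup>2),
         snd (sqrt (x\<^sup>2 + z\<^sup>2), snd (x, z))) = (x, z)"
      using x by simp
  next
    fix r t :: real assume rt: "(r, t) \<in> {z. \<bar>snd z\<bar> < fst z}" "t \<ge> 0"
    then have "t\<^sup>2 < r\<^sup>2" by (simp add: power_strict_mono)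
    moreover have "\<epsilon> * \<epsilon> = 1" "\<epsilon>\<^sup>2 = 1" using \<epsilon>(1) by auto
    ultimately show "(\<epsilon> * sqrt ((fst (r, t))\<^sup>2 - (snd (r, t))\<^sup>2), snd (r, t)) \<in> {z. \<epsilon> * fst z > 0} \<and>
       snd (\<epsilon> * sqrt ((fst (r, t))\<^sup>2 - (snd (r, t))\<^sup>2), snd (r, t)) \<ge> 0 \<and>
       sqrt ((fst (\<epsilon> * sqrt ((fst (r, t))\<^sup>2 - (snd (r, t))\<^sup>2), snd (r, t)))\<^sup>2 +
         (snd (\<epsilon> * sqrt ((fst (r, t))\<^sup>2 - (snd (r, t))\<^sup>2), snd (r, t)))\<^sup>2) = r \<and>
       snd (\<epsilon> * sqrt ((fst (r, t))\<^sup>2 - (snd (r, t))\<^sup>2), snd (r, t)) = t"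
      using rt by (simp add: power_mult_distrib mult.assoc[symmetric])
  qed (use X p \<epsilon> s0 NM(4) in \<open>auto intro!: continuous_intros\<close>)
  have top: "flat_at half_spin p" if "p $ 3 > 0"
  proof (rule rev[where Q = "{z. snd z > 0}" and Q' = "{z. 0 < snd z} \<inter> {z. \<bar>ln (snd z)\<bar> < fst z}"
        and e = "\<lambda>z. exp (fst z)" and i = "\<lambda>z. (ln (snd z), sqrt ((fst z)\<^sup>2 - (ln (snd z))\<^sup>2))"])
    show "open {z :: real \<times> real. snd z > 0}" by (intro open_Collect_less continuous_intros)
    have "continuous_on {z :: real \<times> real. 0 < snd z} (\<lambda>z. fst z - \<bar>ln (snd z)\<bar>)"
      by (intro continuous_intros) auto
    then have "open ({z :: real \<times> real. 0 < snd z} \<inter> (\<lambda>z. fst z - \<bar>ln (snd z)\<bar>) -` {0<..})"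
      by (rule continuous_open_preimage) (auto intro!: open_Collect_less continuous_intros)
    then show "open ({z :: real \<times> real. 0 < snd z} \<inter> {z. \<bar>ln (snd z)\<bar> < fst z})"
      by (simp add: vimage_def)
    fix x z :: real assume x: "(x, z) \<in> {z. snd z > 0}"
    then have "\<bar>x\<bar> < sqrt (x\<^sup>2 + z\<^sup>2)" by (intro real_less_rsqrt) simp
    then show "(sqrt (x\<^sup>2 + z\<^sup>2), exp (fst (x, z))) \<in> {z. 0 < snd z} \<inter> {z. \<bar>ln (snd z)\<bar> < fst z} \<and>
       exp (fst (x, z)) \<ge> 0 \<and>
       (ln (snd (sqrt (x\<^sup>2 + z\<^sup>2), exp (fst (x, z)))),
        sqrt ((fst (sqrt (x\<^sup>2 + z\<^sup>2), exp (fst (x, z))))\<^sup>2 - (ln (snd (sqrt (x\<^sup>2 + z\<^sup>2), exp (fst (x, z)))))\<^sup>2)) = (x, z)"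
      using x by simp
  next
    fix r t :: real assume rt: "(r, t) \<in> {z. 0 < snd z} \<inter> {z. \<bar>ln (snd z)\<bar> < fst z}"
    then have "(ln t)\<^sup>2 < r\<^sup>2" using power_strict_mono[of "\<bar>ln t\<bar>" r 2] by simp
    then show "(ln (snd (r, t)), sqrt ((fst (r, t))\<^sup>2 - (ln (snd (r, t)))\<^sup>2)) \<in> {z. snd z > 0} \<and>
       snd (ln (snd (r, t)), sqrt ((fst (r, t))\<^sup>2 - (ln (snd (r, t)))\<^sup>2)) \<ge> 0 \<and>
       sqrt ((fst (ln (snd (r, t)), sqrt ((fst (r, t))\<^sup>2 - (ln (snd (r, t)))\<^sup>2)))\<^sup>2 +
         (snd (ln (snd (r, t)), sqrt ((fst (r, t))\<^sup>2 - (ln (snd (r, t)))\<^sup>2)))\<^sup>2) = r \<and>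
       exp (fst (ln (snd (r, t)), sqrt ((fst (r, t))\<^sup>2 - (ln (snd (r, t)))\<^sup>2))) = t"
      using rt by auto
  qed (use X p that s0 NM(4) in \<open>auto intro!: continuous_intros\<close>)
  have "p $ 1 \<noteq> 0 \<or> p $ 3 \<noteq> 0" using p(2) by auto
  then consider "p $ 3 > 0" | "p $ 1 > 0" | "p $ 1 < 0" using p(1) by linarith
  then show ?thesis using top side[of 1] side[of "-1"] by cases auto
qed

subsection \<open>Gluing\<close>

definition disc :: "(real^4) set" where
  "disc = spun_plane ` half_disc"

lemma continuous_on_spun_plane: "continuous_on S spun_plane"
  using continuous_on_subset[OF smooth_on_continuous[OF smooth_on_spun_plane]] by simp

text \<open>Outside the compact half-annulus \<open>A\<close> the disc is the bent graph. Both surfaces are injectively parametrised, so the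
  images of \<open>A\<close> avoid the given point and can be removed.\<close>

lemma flat_at_disc_outer:
  assumes u0: "u0 \<in> half_disc" "sq_norm u0 < 1/2 \<or> sq_norm u0 > 3/2"
  shows "flat_at disc (spun_plane u0)"
proof -
  define graph :: "real^2 \<Rightarrow> real^4" where
    "graph u = vector [u $ 1, u $ 2 * (1 - bend (sq_norm u)), u $ 2 * bend (sq_norm u), 0]" for u
  define A where "A = {u \<in> half_disc. 1/2 \<le> sq_norm u \<and> sq_norm u \<le> 3/2}"
  have eq: "spun_plane u = graph u" if "u \<in> half_disc - A" for u
    using spun_plane_outer[OF sq_norm_far] that by (auto simp: A_def graph_def)
  have cs: "continuous_on S sq_norm" for S
    unfolding sq_norm_def[abs_def] by (intro continuous_intros)
  have "A = half_disc \<inter> ({u. 1/2 \<le> sq_norm u} \<inter> {u. sq_norm u \<le> 3/2})" by (auto simp: A_def)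
  then have "compact A"
    by (simp only:) (intro compact_Int_closed compact_half_disc closed_Int closed_Collect_le continuous_on_const cs)
  have "continuous_on A graph" unfolding graph_def[abs_def]
    by (intro continuous_intros cs)
  define N where "N = - (spun_plane ` A \<union> graph ` A)"
  have "open N" unfolding N_def
    by (intro open_Compl closed_Un compact_imp_closed compact_continuous_image continuous_on_spun_plane
        \<open>compact A\<close> \<open>continuous_on A graph\<close>)
  have g: "graph u $ 1 = u $ 1" "graph u $ 2 + graph u $ 3 = u $ 2" for u
    by (simp_all add: graph_def algebra_simps)
  have inj_graph: "graph u = graph v \<Longrightarrow> u = v" for u v
    using g[of u] g[of v] by (simp add: vec2_eq_iff)
  have bg: "bent_graph = graph ` half_disc"
  proof (intro equalityI subsetI)
    fix x assume x: "x \<in> bent_graph"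
    then have "vector [x $ 1, x $ 2 + x $ 3] \<in> half_disc" "x = graph (vector [x $ 1, x $ 2 + x $ 3])"
      by (auto simp: bent_graph_def half_disc_pairs_def half_disc_def sq_norm_def graph_def
          height_def vec4_eq_iff algebra_simps)
    then show "x \<in> graph ` half_disc" by blast
  next
    fix x assume "x \<in> graph ` half_disc"
    then show "x \<in> bent_graph"
      by (auto simp: bent_graph_def half_disc_pairs_def half_disc_def sq_norm_def graph_def
          height_def algebra_simps)
  qed
  have u0A: "u0 \<in> half_disc - A" using u0 by (auto simp: A_def)
  have "disc \<inter> N = bent_graph \<inter> N"
  proof (intro equalityI subsetI)
    fix x assume x: "x \<in> disc \<inter> N"
    then obtain u where "u \<in> half_disc - A" "x = spun_plane u" by (auto simp: disc_def N_def)
    then show "x \<in> bent_graph \<inter> N" using x eq[of u] by (auto simp: bg)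
  next
    fix x assume x: "x \<in> bent_graph \<inter> N"
    then obtain u where u: "u \<in> half_disc - A" "x = graph u" by (auto simp: bg N_def)
    then have "x = spun_plane u" using eq[of u] by simp
    then show "x \<in> disc \<inter> N" using x u(1) by (auto simp: disc_def)
  qed
  moreover have "spun_plane u0 \<in> N"
  proof -
    have "spun_plane u0 \<notin> spun_plane ` A"
      using inj_image_mem_iff[OF inj_spun_plane] u0A by simp
    moreover have "graph u0 \<notin> graph ` A" using inj_graph u0A by blast
    ultimately show ?thesis using eq[OF u0A] by (simp add: N_def)
  qed
  moreover have "flat_at bent_graph (spun_plane u0)"
    by (rule flat_at_bent_graph) (use eq[OF u0A] bg u0 in auto)
  ultimately show ?thesis using flat_at_local \<open>open N\<close> by blast
qed

text \<open>The bent part of the disc is compact and avoids the given point. After its removal, and in a cylinder of radius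
  \<open>5/4\<close> around the fixed plane, the disc is the half-spin of the profile: a point of the
  profile at this distance has a parameter less than \<open>5/4\<close>, whose square is below \<open>2\<close>.\<close>

lemma flat_at_disc_core:
  assumes u0: "u0 \<in> half_disc" "1/2 \<le> sq_norm u0" "sq_norm u0 \<le> 3/2"
  shows "flat_at disc (spun_plane u0)"
proof -
  define A where "A = {u \<in> half_disc. 2 \<le> sq_norm u}"
  have cs: "continuous_on S sq_norm" for S
    unfolding sq_norm_def[abs_def] by (intro continuous_intros)
  have "A = half_disc \<inter> {u. 2 \<le> sq_norm u}" by (auto simp: A_def)
  then have "compact A"
    by (simp only:) (intro compact_Int_closed compact_half_disc closed_Collect_le continuous_on_const cs)
  define N where "N = - (spun_plane ` A) \<inter> {x. sqrt ((x $ 1)\<^sup>2 + (x $ 3)\<^sup>2) < 5/4}"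
  have "open N" unfolding N_def
    by (intro open_Int open_Compl compact_imp_closed compact_continuous_image continuous_on_spun_plane
        \<open>compact A\<close> open_Collect_less continuous_intros)
  have nonneg: "profile (norm w) $ 1 \<ge> 0" for w :: "real^2"
    using profile_1_pos[of "norm w"] profile_0 by (cases "w = 0") auto
  have spun_profile: "vector [sqrt ((spun_plane u $ 1)\<^sup>2 + (spun_plane u $ 3)\<^sup>2), spun_plane u $ 2, spun_plane u $ 4]
      = profile (norm u)" if "sq_norm u \<le> 2" for u
    using spun_plane_core_radius[OF that] nonneg[of u] by (simp add: spun_plane_core[OF that] vec3_eq_iff)
  have height_nonneg: "spun_plane u $ 3 \<ge> 0" if "u \<in> half_disc" "sq_norm u \<le> 2" for u
    using that stretch_pos[OF sq_norm_nonneg[of u]] by (simp add: spun_plane_core half_disc_def)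
  have "disc \<inter> N = half_spin \<inter> N"
  proof (intro equalityI subsetI)
    fix x assume x: "x \<in> disc \<inter> N"
    then obtain u where u: "u \<in> half_disc" "x = spun_plane u" "u \<notin> A" by (auto simp: disc_def N_def)
    then have "sq_norm u \<le> 2" by (simp add: A_def)
    then show "x \<in> half_spin \<inter> N" using x height_nonneg[OF u(1)] spun_profile u(2) by (simp add: half_spin_def)
  next
    fix x assume x: "x \<in> half_spin \<inter> N"
    then obtain s where s: "vector [sqrt ((x $ 1)\<^sup>2 + (x $ 3)\<^sup>2), x $ 2, x $ 4] = profile s" and x3: "x $ 3 \<ge> 0"
      by (auto simp: half_spin_def)
    then have r: "sqrt ((x $ 1)\<^sup>2 + (x $ 3)\<^sup>2) = profile s $ 1" "x $ 2 = profile s $ 2" "x $ 4 = profile s $ 3"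
      by (simp_all add: vec3_eq_iff)
    have "profile s $ 1 < 5/4" "profile s $ 1 \<ge> 0" using x r(1)[symmetric] by (simp_all add: N_def)
    then have s1: "0 \<le> s" "s < 5/4" using profile_standard[of s] by (cases "\<bar>s - 1\<bar> \<ge> 1/8"; simp add: abs_if split: if_splits)+
    define a where "a = stretch (s\<^sup>2)"
    have a: "a > 0" "a * s = profile s $ 1"
      using stretch_pos[of "s\<^sup>2"] stretch_mult_sqrt[of "s\<^sup>2"] s1 by (simp_all add: a_def)
    define u :: "real^2" where "u = vector [x $ 1 / a, x $ 3 / a]"
    have "sq_norm u = ((x $ 1)\<^sup>2 + (x $ 3)\<^sup>2) / a\<^sup>2"
      by (simp add: sq_norm_def u_def power_divide add_divide_distrib)
    also have "(x $ 1)\<^sup>2 + (x $ 3)\<^sup>2 = (a * s)\<^sup>2"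
      unfolding a(2) r(1)[symmetric] by simp
    finally have sq: "sq_norm u = s\<^sup>2" using a(1) by (simp add: power_mult_distrib)
    have "s\<^sup>2 \<le> (5/4)\<^sup>2" using s1 by (intro power_mono) auto
    then have s2: "s\<^sup>2 \<le> 2" by (simp add: power2_eq_square)
    have "norm u = s" using s1 by (simp add: norm_eq_sqrt_sq_norm sq)
    moreover have "u $ 1 = x $ 1 / a" "u $ 2 = x $ 3 / a" by (simp_all add: u_def)
    moreover have "sq_norm u \<le> 2" using s2 by (simp add: sq)
    ultimately have "spun_plane u = x"
      using spun_plane_core[of u] a(1) r by (simp add: sq a_def[symmetric] vec4_eq_iff)
    moreover have "u \<in> half_disc" using s2 x3 a(1) by (simp add: half_disc_def sq) (simp add: u_def)
    ultimately show "x \<in> disc \<inter> N" using x by (auto simp: disc_def)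
  qed
  moreover have "spun_plane u0 \<in> N"
  proof -
    have "spun_plane u0 \<notin> spun_plane ` A"
      using inj_image_mem_iff[OF inj_spun_plane] u0 by (simp add: A_def)
    moreover have "profile (norm u0) $ 1 < 5/4"
    proof (cases "\<bar>norm u0 - 1\<bar> \<le> 1/8")
      case True
      then show ?thesis using profile_comp_bounds(1)[OF True] by linarith
    next
      case False
      have "norm u0 < 5/4" unfolding norm_eq_sqrt_sq_norm
        by (rule real_less_lsqrt) (use u0 in \<open>auto simp: power2_eq_square\<close>)
      then show ?thesis using profile_standard[of "norm u0"] False by simp
    qed
    moreover have "sqrt ((spun_plane u0 $ 1)\<^sup>2 + (spun_plane u0 $ 3)\<^sup>2) = profile (norm u0) $ 1"
      using spun_profile[of u0] u0 by (simp add: vec3_eq_iff)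
    ultimately show ?thesis by (simp add: N_def)
  qed
  moreover have "flat_at half_spin (spun_plane u0)"
  proof (rule flat_at_half_spin[OF height_nonneg _ spun_profile])
    have "norm u0 > 0" using u0 by (simp add: norm_eq_sqrt_sq_norm)
    then show "(spun_plane u0 $ 1)\<^sup>2 + (spun_plane u0 $ 3)\<^sup>2 > 0"
      using spun_plane_core_radius[of u0] profile_1_pos[of "norm u0"] u0 by simp
  qed (use u0 in auto)
  ultimately show ?thesis using flat_at_local \<open>open N\<close> by blast
qed

lemma locally_flat_disc: "locally_flat_in_half_space disc"
  unfolding locally_flat_in_half_space_iff
proof
  fix p assume "p \<in> disc"
  then obtain u where "u \<in> half_disc" "p = spun_plane u" by (auto simp: disc_def)
  then show "flat_at disc p"
    using flat_at_disc_outer[of u] flat_at_disc_core[of u] by force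
qed

subsection \<open>The boundary knot\<close>

definition boundary_knot :: "(real^3) set" where
  "boundary_knot = knot_closure 2 (concat_long (mirror \<kappa>) \<kappa>)"

text \<open>The reversal of the parameter in the definition of the mirror image makes the concatenation symmetric
  under the reflection in the first coordinate, which is the rotation by \<open>\<pi>\<close> in the
  boundary hyperplane.\<close>

lemma spun_plane_axis:
  "spun_plane (vector [t, 0]) = bounding_R3 (concat_long (mirror \<kappa>) \<kappa> t)"
proof -
  have sq: "sq_norm (vector [t, 0]) = t\<^sup>2" by (simp add: sq_norm_def)
  have s: "stretch (t\<^sup>2) * \<bar>t\<bar> = profile \<bar>t\<bar> $ 1" using stretch_mult_sqrt[of "t\<^sup>2"] by simp
  show ?thesis
  proof (cases "t \<le> 0")
    case True
    have "concat_long (mirror \<kappa>) \<kappa> t = vector [- (profile (- t) $ 1), profile (- t) $ 2, profile (- t) $ 3]"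
      using True by (simp add: concat_long_def mirror_def profile_def vec3_eq_iff)
    then show ?thesis using True s
      by (simp add: spun_plane_def Let_def sq bounding_R3_def vec4_eq_iff)
  next
    case False
    have "concat_long (mirror \<kappa>) \<kappa> t = profile t"
      using False by (simp add: concat_long_def profile_def)
    then show ?thesis using False s
      by (simp add: spun_plane_def Let_def sq bounding_R3_def vec4_eq_iff)
  qed
qed

lemma spun_plane_boundary: "spun_plane ` (half_disc - interior half_disc) = bounding_R3 ` boundary_knot"
proof -
  define S1 where "S1 = (\<lambda>t. vector [t, 0] :: real^2) ` {-2..2}"
  define S2 where "S2 = {u :: real^2. norm u = 2 \<and> u $ 2 \<ge> 0}"
  have "half_disc - interior half_disc = S1 \<union> S2"
  proof (intro equalityI subsetI)
    fix u assume u: "u \<in> half_disc - interior half_disc"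
    show "u \<in> S1 \<union> S2"
    proof (cases "u $ 2 = 0")
      case True
      then have "u = vector [u $ 1, 0]" "\<bar>u $ 1\<bar> \<le> 2"
        using u by (auto simp: half_disc_eq vec2_eq_iff norm_vec2)
      then show ?thesis unfolding S1_def by (intro UnI1 image_eqI[of _ _ "u $ 1"]) auto
    next
      case False
      then show ?thesis using u unfolding interior_half_disc by (auto simp: half_disc_eq S2_def)
    qed
  next
    fix u assume "u \<in> S1 \<union> S2"
    then show "u \<in> half_disc - interior half_disc"
      unfolding interior_half_disc by (auto simp: half_disc_eq S1_def S2_def norm_vec2)
  qed
  moreover have "spun_plane ` S1 = bounding_R3 ` concat_long (mirror \<kappa>) \<kappa> ` {-2..2}"
    by (simp add: S1_def image_image spun_plane_axis)
  moreover have "spun_plane ` S2 = bounding_R3 ` {x. norm x = 2 \<and> x $ 2 \<ge> 0 \<and> x $ 3 = 0}"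
  proof -
    have F: "spun_plane u = bounding_R3 (vector [u $ 1, u $ 2, 0])" if "u \<in> S2" for u
    proof -
      have "sqrt (sq_norm u) = 2" using that by (simp add: S2_def norm_eq_sqrt_sq_norm)
      then have "sq_norm u = 4" using real_sqrt_pow2[OF sq_norm_nonneg, of u] by simp
      then show ?thesis
        using spun_plane_outer[OF sq_norm_far, of u] bend_middle[of 4]
        by (simp add: bounding_R3_def vec4_eq_iff)
    qed
    have "(\<lambda>u. vector [u $ 1, u $ 2, 0] :: real^3) ` S2 = {x. norm x = 2 \<and> x $ 2 \<ge> 0 \<and> x $ 3 = 0}"
    proof (intro equalityI subsetI)
      fix x :: "real^3" assume x: "x \<in> {x. norm x = 2 \<and> x $ 2 \<ge> 0 \<and> x $ 3 = 0}"
      then show "x \<in> (\<lambda>u. vector [u $ 1, u $ 2, 0]) ` S2"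
        by (intro image_eqI[of _ _ "vector [x $ 1, x $ 2]"]) (auto simp: S2_def norm_vec2 norm_vec3 vec3_eq_iff)
    qed (auto simp: S2_def norm_vec2 norm_vec3)
    moreover have "spun_plane ` S2 = bounding_R3 ` (\<lambda>u. vector [u $ 1, u $ 2, 0]) ` S2"
      using F by (auto simp: image_image intro!: image_cong)
    ultimately show ?thesis by simp
  qed
  ultimately show ?thesis
    by (simp add: boundary_knot_def knot_closure_def image_Un)
qed

lemma spun_plane_interior:
  assumes "u \<in> interior half_disc"
  shows "spun_plane u $ 3 > 0"
proof -
  have u: "u $ 2 > 0" "norm u < 2" using assms by (auto simp: interior_half_disc)
  have r: "sq_norm u < 4"
    using u(2) real_sqrt_less_iff[of "sq_norm u" 4] unfolding norm_eq_sqrt_sq_norm real_sqrt_four by blast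
  show ?thesis
  proof (cases "sq_norm u \<le> 2")
    case True
    then show ?thesis using u stretch_pos[OF sq_norm_nonneg[of u]] by (simp add: spun_plane_core)
  next
    case False
    then show ?thesis using spun_plane_outer[OF sq_norm_far, of u] bend_pos[OF r] u by simp
  qed
qed

theorem knotted_disc: "knotted_disc_bounded_by disc boundary_knot"
proof -
  obtain g g' where g: "homeomorphism (cball (0 :: real^2) 1) half_disc g g'"
    "g ` sphere 0 1 = half_disc - interior half_disc" "g ` ball 0 1 \<subseteq> interior half_disc"
    by (rule half_disc_homeomorphism)
  obtain F' where "homeomorphism half_disc disc spun_plane F'"
    using homeomorphism_compact[OF compact_half_disc continuous_on_spun_plane]
      inj_on_subset[OF inj_spun_plane] by (metis disc_def subset_UNIV)
  from homeomorphism_compose[OF g(1) this]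
  have "homeomorphism (cball 0 1) disc (spun_plane \<circ> g) (g' \<circ> F')" .
  moreover have "(spun_plane \<circ> g) ` sphere 0 1 = bounding_R3 ` boundary_knot"
    by (simp only: image_comp[symmetric] g(2) spun_plane_boundary)
  moreover have "(spun_plane \<circ> g) ` ball 0 1 \<subseteq> {x. x $ 3 > 0}"
    using g(3) spun_plane_interior by auto
  ultimately show ?thesis
    unfolding knotted_disc_bounded_by_def using locally_flat_disc by blast
qed

end

theorem theorem5p5:
  fixes K :: "real \<Rightarrow> real^3"
  assumes "polynomial_knot K"
  shows "\<exists>P. knotted_plane P \<and>
           (\<exists>D J. D \<subseteq> P \<and> is_connected_sum J K (mirror K) \<and> knotted_disc_bounded_by D J)"
proof -
  obtain k where k: "long_knot_within (1/8) k" "equivalent_long_knots K k"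
    using polynomial_knot_tame[OF assms, of "1/8"] by auto
  interpret small_long_knot "mirror k"
    by standard (rule long_knot_within_mirror[OF k(1)])
  have "is_connected_sum boundary_knot K (mirror K)"
    unfolding is_connected_sum_def
  proof (intro exI conjI)
    show "standard_long_knot k" using long_knot_within_imp_standard[OF k(1)] by simp
    show "standard_long_knot (mirror k)" using long_knot_within_imp_standard[OF knot] by simp
    show "equivalent_long_knots (mirror K) (mirror k)" by (rule equivalent_long_knots_mirror[OF k(2)])
    show "equivalent_knots boundary_knot (knot_closure 2 (concat_long k (mirror k)))"
      unfolding equivalent_knots_def boundary_knot_def mirror_mirror
      using ambient_isotopy_end_id by (intro exI[of _ "\<lambda>x. x"]) simp
  qed (fact k(2))
  moreover have "disc \<subseteq> range spun_plane" by (auto simp: disc_def)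
  ultimately show ?thesis using knotted_plane_range knotted_disc by blast
qed

end
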